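(* Assume that: (i) problem (P) (defined in the context) is feasible; (ii) $\mathcal{U}$ is compact and $\mathcal{X}^s$ is closed; (iii) the cost functions $\ell_0,\dots,\ell_N$ are non-negative and continuous; (iv) the kernel $\mathcal{Q}$ is weakly continuous, i.e. for every $v\in C_b(\mathcal{X})$ the map $(x,u)\mapsto\int_{\mathcal{X}}v(y)\,\mathcal{Q}(dy|x,u)$ belongs to $C_b(\mathcal{X}\times\mathcal{U})$. Then the infimum in problem (P$^z$) (defined in the context) is attained by a Markov policy $\pi^\star$. Moreover, any Markov policy $\pi^\star=(\pi^\star_0,\dots,\pi^\star_N)$ that attains the infimum in (P$^z$) yields an optimal solution $(\pi,a)$ of (P), with $\pi=(\pi_0,\dots,\pi_{N-1})$, via $$\pi_0(\cdot|h_0)=\pi_0^{\star}(\cdot|(x_0,0)),$$ $$\pi_k(\cdot|h_k)=\pi^{\star}_k\Big(\cdot\,\Big|\,\Big(x_k,\sum_{j=0}^{k-1}\ell_j(x_j,u_j)\Big)\Big),\quad k=1,\dots,N-1,$$ $$a(h_N)=\pi^{\star}_N\Big(\{1\}\,\Big|\,\Big(x_N,\sum_{j=0}^{N-1}\ell_j(x_j,u_j)\Big)\Big),$$ for all $h_k=(x_k,u_{k-1},\dots,u_0,x_0)\in\mathcal{H}_k$, $k=0,\dots,N$.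
   Context: Notation: $[N]=\{0,1,\dots,N\}$; $\mathbb{1}_A$ is the indicator of $A$; $\delta_s$ is the Dirac measure at $s$; $\mathcal{B}(S)$ is the Borel $\sigma$-algebra of $S$; $C_b(S)$ is the space of bounded continuous real functions on $S$. MDP $\mathcal{M}$. $N\ge1$ is a finite horizon. The state space $\mathcal{X}$ and input space $\mathcal{U}$ are Borel subsets of complete separable metric spaces, and $\mathcal{Q}(\cdot|x,u)$ is a stochastic kernel on $\mathcal{X}$ given $\mathcal{X}\times\mathcal{U}$ (so $x_{k+1}\sim\mathcal{Q}(\cdot|x_k,u_k)$). The safe set is $\mathcal{X}^s\in\mathcal{B}(\mathcal{X})$, and $\mathcal{X}=\mathcal{X}^s\cup\{x^\dagger\}$ where $x^\dagger\notin\mathcal{X}^s$ is an absorbing unsafe state: $\mathcal{Q}(\{x^\dagger\}|x^\dagger,u)=1$ for all $u\in\mathcal{U}$. Histories: $\mathcal{H}_0=\mathcal{X}$, $\mathcal{H}_k=\mathcal{X}\times\mathcal{U}\times\mathcal{H}_{k-1}$, with elements $h_k=(x_k,u_{k-1},\dots,x_1,u_0,x_0)$. A policy $\pi=(\pi_0,\dots,\pi_{N-1})$ is a sequence of Borel stochastic kernels $\pi_k(\cdot|h_k)$ on $\mathcal{U}$ given $\mathcal{H}_k$; it is Markov if each $\pi_k(\cdot|h_k)$ depends only on the last state of $h_k$. $\Pi$ is the set of policies. Together with an initial state $x_0$, a policy $\pi$ induces a probability measure $\mathbb{P}^\pi_{x_0}$ on $\mathcal{H}_N$ with expectation $\mathbb{E}^\pi_{x_0}$.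 The cost functions $\ell_k:\mathcal{X}\times\mathcal{U}\to[0,\infty)$, $k\in[N-1]$, and $\ell_N:\mathcal{X}\to[0,\infty)$ are measurable; $\alpha\in[0,1]$; the initial state $x_0\in\mathcal{X}$ is fixed. Problem (P): minimize over $\pi\in\Pi$ and measurable $a:\mathcal{H}_N\to[0,1]$ $$\mathbb{E}_{x_0}^{\pi}\Big[a(h_N)\Big(\ell_N(x_N)+\sum_{k=0}^{N-1}\ell_k(x_k,u_k)\Big)\Big]\quad\text{subject to}\quad\mathbb{E}_{x_0}^{\pi}\Big[a(h_N)\prod_{k=0}^N\mathbb{1}_{\mathcal{X}^s}(x_k)\Big]\ge\alpha.$$ Augmented MDP $\mathcal{M}^z$. The cost space is $\mathcal{C}=[0,\infty)$, the state space is $\mathcal{Z}=\mathcal{X}\times\mathcal{C}$ with elements $z_k=(x_k,c_k)$, and $\mathcal{Z}^s=\mathcal{X}^s\times\mathcal{C}$. Input spaces: $\mathcal{U}_k=\mathcal{U}$ for $k\in[N-1]$ and $\mathcal{U}_N=\{0,1\}$. Kernels: for $k\in[N-1]$, $\mathcal{Q}^z_k(B\times C|z_k,u_k)=\mathcal{Q}(B|x_k,u_k)\,\delta_{c_k+\ell_k(x_k,u_k)}(C)$ for $B\in\mathcal{B}(\mathcal{X})$, $C\in\mathcal{B}(\mathcal{C})$, and $\mathcal{Q}^z_N(\{z\}|z,\cdot)=1$. Policies for $\mathcal{M}^z$ are sequences $(\pi_0,\dots,\pi_N)$ of stochastic kernels $\pi_k$ on $\mathcal{U}_k$ given the history of states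 in $\mathcal{Z}$ and inputs up to time $k$; Markov policies are those for which each $\pi_k$ depends only on $z_k$. Set $f_N(z_N,u_N)=u_N(c_N+\ell_N(x_N))$ and $g_N(z_N,u_N)=u_N\mathbb{1}_{\mathcal{Z}^s}(z_N)$. Problem (P$^z$): with $z_0=(x_0,0)$, minimize over policies $\pi$ of $\mathcal{M}^z$ the value $\mathbb{E}^\pi_{z_0}[f_N(z_N,u_N)]$ subject to $\mathbb{E}^\pi_{z_0}[g_N(z_N,u_N)]\ge\alpha$. *)

theory Defs
  imports "HOL-Probability.Probability"
begin

text \<open>A history \<open>(s\<^sub>0, a\<^sub>0, s\<^sub>1, \<dots>, a\<^sub>k\<^sub>-\<^sub>1, s\<^sub>k)\<close> is encoded as the pair of the family
  of its states (indexed by \<open>{..k}\<close>) and the family of its inputs (indexed by \<open>{..<k}\<close>).\<close>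

type_synonym ('s, 'a) hist = "(nat \<Rightarrow> 's) \<times> (nat \<Rightarrow> 'a)"

definition hist_space :: "'s measure \<Rightarrow> 'a measure \<Rightarrow> nat \<Rightarrow> ('s, 'a) hist measure" where
  "hist_space S A k = (\<Pi>\<^sub>M i\<in>{..k}. S) \<Otimes>\<^sub>M (\<Pi>\<^sub>M i\<in>{..<k}. A)"

text \<open>Law of the history up to time \<open>k\<close> for transition kernels \<open>T\<close>, policy \<open>p\<close> and initial
  state \<open>s\<close>. Stochastic kernels from \<open>K\<close> to \<open>L\<close> are the elements of \<open>K \<rightarrow>\<^sub>M prob_algebra L\<close>.\<close>

primrec hist_law ::
  "'s measure \<Rightarrow> 'a measure \<Rightarrow> (nat \<Rightarrow> 's \<times> 'a \<Rightarrow> 's measure) \<Rightarrow>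
   (nat \<Rightarrow> ('s, 'a) hist \<Rightarrow> 'a measure) \<Rightarrow> 's \<Rightarrow> nat \<Rightarrow> ('s, 'a) hist measure" where
  "hist_law S A T p s 0 = return (hist_space S A 0) (\<lambda>i\<in>{0}. s, \<lambda>_. undefined)"
| "hist_law S A T p s (Suc k) =
     hist_law S A T p s k \<bind> (\<lambda>h.
     p k h \<bind> (\<lambda>u.
     T k (fst h k, u) \<bind> (\<lambda>s'.
     return (hist_space S A (Suc k)) ((fst h)(Suc k := s'), (snd h)(k := u)))))"

record ('x, 'u) mdp =
  horizon :: nat
  states :: "'x set"
  inputs :: "'u set"
  kern :: "'x \<times> 'u \<Rightarrow> 'x measure"
  safe :: "'x set"
  unsafe :: 'x
  stage_cost :: "nat \<Rightarrow> 'x \<times> 'u \<Rightarrow> real"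
  term_cost :: "'x \<Rightarrow> real"

definition BX :: "('x::polish_space, 'u::polish_space) mdp \<Rightarrow> 'x measure" where
  "BX M = restrict_space borel (states M)"

definition BU :: "('x::polish_space, 'u::polish_space) mdp \<Rightarrow> 'u measure" where
  "BU M = restrict_space borel (inputs M)"

definition safety_mdp :: "('x::polish_space, 'u::polish_space) mdp \<Rightarrow> bool" where
  "safety_mdp M \<longleftrightarrow>
     horizon M \<ge> 1 \<and>
     states M \<in> sets borel \<and> inputs M \<in> sets borel \<and>
     kern M \<in> BX M \<Otimes>\<^sub>M BU M \<rightarrow>\<^sub>M prob_algebra (BX M) \<and>
     safe M \<in> sets (BX M) \<and>
     states M = safe M \<union> {unsafe M} \<and> unsafe M \<notin> safe M \<and>
     (\<forall>u\<in>inputs M. emeasure (kern M (unsafe M, u)) {unsafe M} = 1) \<and>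
     (\<forall>k<horizon M. stage_cost M k \<in> borel_measurable (BX M \<Otimes>\<^sub>M BU M)) \<and>
     (\<forall>k<horizon M. \<forall>x\<in>states M. \<forall>u\<in>inputs M. 0 \<le> stage_cost M k (x, u)) \<and>
     term_cost M \<in> borel_measurable (BX M) \<and>
     (\<forall>x\<in>states M. 0 \<le> term_cost M x)"

definition weakly_continuous_kernel :: "('x::polish_space, 'u::polish_space) mdp \<Rightarrow> bool" where
  "weakly_continuous_kernel M \<longleftrightarrow>
     (\<forall>v :: 'x \<Rightarrow> real. continuous_on (states M) v \<and> bounded (v ` states M) \<longrightarrow>
        continuous_on (states M \<times> inputs M) (\<lambda>w. \<integral>y. v y \<partial>kern M w) \<and>
        bounded ((\<lambda>w. \<integral>y. v y \<partial>kern M w) ` (states M \<times> inputs M)))"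

text \<open>A policy is a sequence of kernels of which only those below the horizon matter. The expected
  costs are taken in \<open>[0, \<infinity>]\<close>, since the cost functions need not be bounded.\<close>

definition policies ::
  "('x::polish_space, 'u::polish_space) mdp \<Rightarrow> (nat \<Rightarrow> ('x, 'u) hist \<Rightarrow> 'u measure) set" where
  "policies M =
     {p. \<forall>k<horizon M. p k \<in> hist_space (BX M) (BU M) k \<rightarrow>\<^sub>M prob_algebra (BU M)}"

definition law ::
  "('x::polish_space, 'u::polish_space) mdp \<Rightarrow> 'x \<Rightarrow>
   (nat \<Rightarrow> ('x, 'u) hist \<Rightarrow> 'u measure) \<Rightarrow> ('x, 'u) hist measure" where
  "law M x0 p = hist_law (BX M) (BU M) (\<lambda>_. kern M) p x0 (horizon M)"

type_synonym ('x, 'u) decision =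
  "(nat \<Rightarrow> ('x, 'u) hist \<Rightarrow> 'u measure) \<times> (('x, 'u) hist \<Rightarrow> real)"

definition cost_P ::
  "('x::polish_space, 'u::polish_space) mdp \<Rightarrow> 'x \<Rightarrow> ('x, 'u) decision \<Rightarrow> ennreal" where
  "cost_P M x0 = (\<lambda>(p, a).
     \<integral>\<^sup>+h. ennreal (a h * (term_cost M (fst h (horizon M)) +
                        (\<Sum>k<horizon M. stage_cost M k (fst h k, snd h k)))) \<partial>law M x0 p)"

definition safety_P ::
  "('x::polish_space, 'u::polish_space) mdp \<Rightarrow> 'x \<Rightarrow> ('x, 'u) decision \<Rightarrow> real" where
  "safety_P M x0 = (\<lambda>(p, a).
     \<integral>h. a h * (\<Prod>k\<le>horizon M. indicator (safe M) (fst h k)) \<partial>law M x0 p)"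

definition feasible_P ::
  "('x::polish_space, 'u::polish_space) mdp \<Rightarrow> real \<Rightarrow> 'x \<Rightarrow> ('x, 'u) decision set" where
  "feasible_P M \<alpha> x0 =
     {(p, a). p \<in> policies M \<and>
        a \<in> hist_space (BX M) (BU M) (horizon M) \<rightarrow>\<^sub>M restrict_space borel {0..1} \<and>
        safety_P M x0 (p, a) \<ge> \<alpha>}"

definition optimal_P ::
  "('x::polish_space, 'u::polish_space) mdp \<Rightarrow> real \<Rightarrow> 'x \<Rightarrow> ('x, 'u) decision \<Rightarrow> bool" where
  "optimal_P M \<alpha> x0 d \<longleftrightarrow>
     d \<in> feasible_P M \<alpha> x0 \<and> cost_P M x0 d = (INF d'\<in>feasible_P M \<alpha> x0. cost_P M x0 d')"

definition BC :: "real measure" where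
  "BC = restrict_space borel {0..}"

definition BZ :: "('x::polish_space, 'u::polish_space) mdp \<Rightarrow> ('x \<times> real) measure" where
  "BZ M = BX M \<Otimes>\<^sub>M BC"

definition kern_z ::
  "('x::polish_space, 'u::polish_space) mdp \<Rightarrow> nat \<Rightarrow> ('x \<times> real) \<times> 'u \<Rightarrow> ('x \<times> real) measure"
where
  "kern_z M k = (\<lambda>((x, c), u). kern M (x, u) \<Otimes>\<^sub>M return BC (c + stage_cost M k (x, u)))"

definition kern_z_final ::
  "('x::polish_space, 'u::polish_space) mdp \<Rightarrow> ('x \<times> real) \<times> nat \<Rightarrow> ('x \<times> real) measure" where
  "kern_z_final M = (\<lambda>(z, u). return (BZ M) z)"

text \<open>The input space \<open>{0, 1}\<close> of the last stage differs from the input space of the earlier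
  stages, so a policy is a pair of the kernels of the stages below the horizon and the kernel
  of the last stage.\<close>

type_synonym ('x, 'u) zhist = "('x \<times> real, 'u) hist"

type_synonym ('x, 'u) zpolicy =
  "(nat \<Rightarrow> ('x, 'u) zhist \<Rightarrow> 'u measure) \<times> (('x, 'u) zhist \<Rightarrow> nat measure)"

definition zpolicies ::
  "('x::polish_space, 'u::polish_space) mdp \<Rightarrow> ('x, 'u) zpolicy set" where
  "zpolicies M =
     {(p, q). (\<forall>k<horizon M. p k \<in> hist_space (BZ M) (BU M) k \<rightarrow>\<^sub>M prob_algebra (BU M)) \<and>
        q \<in> hist_space (BZ M) (BU M) (horizon M) \<rightarrow>\<^sub>M prob_algebra (count_space {0, 1})}"

text \<open>\<open>markov_via M (p, q) \<mu> \<nu>\<close>: the policy \<open>(p, q)\<close> depends only on the current state, and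
  \<open>\<mu> k z\<close> (below the horizon) and \<open>\<nu> z\<close> (at the horizon) are its input distributions in
  state \<open>z\<close>.\<close>

definition markov_via ::
  "('x::polish_space, 'u::polish_space) mdp \<Rightarrow> ('x, 'u) zpolicy \<Rightarrow>
   (nat \<Rightarrow> 'x \<times> real \<Rightarrow> 'u measure) \<Rightarrow> ('x \<times> real \<Rightarrow> nat measure) \<Rightarrow> bool" where
  "markov_via M = (\<lambda>(p, q) \<mu> \<nu>.
     (\<forall>k<horizon M. \<forall>h\<in>space (hist_space (BZ M) (BU M) k). p k h = \<mu> k (fst h k)) \<and>
     (\<forall>h\<in>space (hist_space (BZ M) (BU M) (horizon M)). q h = \<nu> (fst h (horizon M))))"

text \<open>Law of the history up to the horizon \<open>N\<close>, the input \<open>u\<^sub>N\<close> and the state reached after it,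
  from the initial state \<open>(x0, 0)\<close>.\<close>

definition law_z ::
  "('x::polish_space, 'u::polish_space) mdp \<Rightarrow> 'x \<Rightarrow> ('x, 'u) zpolicy \<Rightarrow>
   (('x, 'u) zhist \<times> nat \<times> 'x \<times> real) measure" where
  "law_z M x0 = (\<lambda>(p, q).
     hist_law (BZ M) (BU M) (kern_z M) p (x0, 0) (horizon M) \<bind> (\<lambda>h.
     q h \<bind> (\<lambda>u.
     kern_z_final M (fst h (horizon M), u) \<bind> (\<lambda>z'.
     return (hist_space (BZ M) (BU M) (horizon M) \<Otimes>\<^sub>M count_space {0, 1} \<Otimes>\<^sub>M BZ M)
       (h, u, z')))))"

definition final_cost :: "('x, 'u) mdp \<Rightarrow> 'x \<times> real \<Rightarrow> nat \<Rightarrow> real" where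
  "final_cost M = (\<lambda>(x, c) u. real u * (c + term_cost M x))"

definition final_safety :: "('x, 'u) mdp \<Rightarrow> 'x \<times> real \<Rightarrow> nat \<Rightarrow> real" where
  "final_safety M z u = real u * indicator (safe M \<times> {0..}) z"

definition cost_Pz ::
  "('x::polish_space, 'u::polish_space) mdp \<Rightarrow> 'x \<Rightarrow> ('x, 'u) zpolicy \<Rightarrow> ennreal" where
  "cost_Pz M x0 \<pi> =
     (\<integral>\<^sup>+(h, u, z'). ennreal (final_cost M (fst h (horizon M)) u) \<partial>law_z M x0 \<pi>)"

definition safety_Pz ::
  "('x::polish_space, 'u::polish_space) mdp \<Rightarrow> 'x \<Rightarrow> ('x, 'u) zpolicy \<Rightarrow> real" where
  "safety_Pz M x0 \<pi> =
     (\<integral>(h, u, z'). final_safety M (fst h (horizon M)) u \<partial>law_z M x0 \<pi>)"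

definition feasible_Pz ::
  "('x::polish_space, 'u::polish_space) mdp \<Rightarrow> real \<Rightarrow> 'x \<Rightarrow> ('x, 'u) zpolicy set" where
  "feasible_Pz M \<alpha> x0 = {\<pi> \<in> zpolicies M. safety_Pz M x0 \<pi> \<ge> \<alpha>}"

definition optimal_Pz ::
  "('x::polish_space, 'u::polish_space) mdp \<Rightarrow> real \<Rightarrow> 'x \<Rightarrow> ('x, 'u) zpolicy \<Rightarrow> bool" where
  "optimal_Pz M \<alpha> x0 \<pi> \<longleftrightarrow>
     \<pi> \<in> feasible_Pz M \<alpha> x0 \<and>
     cost_Pz M x0 \<pi> = (INF \<pi>'\<in>feasible_Pz M \<alpha> x0. cost_Pz M x0 \<pi>')"

end

theory Submission
  imports Defs
begin

text \<open>
  The augmented problem is a constrained problem with two linear objectives: the expected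
  final cost \<open>f\<close> is minimized subject to a lower bound \<open>\<alpha>\<close> on the expected final safety \<open>g\<close>.
  The proof goes through Lagrangian duality, using dynamic programming for the scalarized
  objectives \<open>E(a f - b g)\<close>. Because the last input may reject, the value functions \<open>V a b\<close>
  of these problems are bounded. Weak continuity of the kernel and compactness of the input space
  keep them lower semicontinuous (\<open>lsc_on_kern_z\<close>, \<open>lsc_on_INF\<close>), so
  minimizing inputs exist. Every policy, Markov or not, satisfies weak duality
  (\<open>lagrangian_bound\<close>).

  A minimizer of the Lagrangian need not satisfy the constraint, so minimizers have to be
  compared by a second objective. Lexicographic minimization is a monotone limit of scalarized
  problems, and suprema of increasing sequences of lower semicontinuous functions commute with minima
  over compact sets; this gives measurable lexicographic selectors (\<open>monotone_limit_selection\<close>,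
  \<open>lex_optimal_exists\<close>). If \<open>\<alpha>\<close> is below the maximal safety probability, an optimal multiplier
  exists. The lexicographically safest and least safe minimizers of its Lagrangian have safety
  at least and at most \<open>\<alpha>\<close>. Mixing them stage by stage with a constant probability
  keeps the policy Markov and the Lagrangian minimal, while the safety varies
  continuously; some mixture has safety exactly \<open>\<alpha>\<close> and is optimal by complementary slackness
  (\<open>optimal_policy_below_max_safety\<close>; for the multiplier \<open>0\<close> the safest minimizer already
  has cost \<open>0\<close>). If \<open>\<alpha>\<close> equals the maximal safety probability, the cost is
  minimized lexicographically among the safest policies (\<open>optimal_policy_at_max_safety\<close>).

  The two problems are equivalent because the accumulated cost is a function of the history and the
  unsafe state is absorbing: recording costs along a history maps the law of the original process to
  that of the augmented one (\<open>nn_integral_augment\<close>), and safety along the path is almost surely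
  safety at the horizon (\<open>safe_at_horizon\<close>). Hence decisions and policies correspond with equal cost
  and safety (\<open>transfer\<close>), which turns optimal Markov policies into optimal decisions.
\<close>

section \<open>Lower semicontinuity and measurable selection\<close>

text \<open>Lower semicontinuity of \<open>f\<close> relative to \<open>A\<close>. Closed sublevel sets turn minimization over a
  compact fibre into the projection of a closed set along a compact factor, which is closed.\<close>

definition lsc_on :: "'a::topological_space set \<Rightarrow> ('a \<Rightarrow> real) \<Rightarrow> bool" where
  "lsc_on A f \<longleftrightarrow> (\<forall>y. closedin (top_of_set A) {x\<in>A. f x \<le> y})"

lemma borel_measurable_lsc:
  assumes "lsc_on A f"
  shows "f \<in> borel_measurable (restrict_space borel A)"
  unfolding borel_measurable_iff_le
proof
  fix y
  obtain T where "closed T" "{x\<in>A. f x \<le> y} = T \<inter> A"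
    using assms unfolding lsc_on_def closedin_closed by (metis inf_commute)
  then show "{w \<in> space (restrict_space borel A). f w \<le> y} \<in> sets (restrict_space borel A)"
    by (auto simp: sets_restrict_space space_restrict_space image_iff intro!: bexI[of _ T])
qed

lemma lsc_on_subset:
  assumes "lsc_on A f" "B \<subseteq> A"
  shows "lsc_on B f"
  unfolding lsc_on_def
proof
  fix y
  obtain T where T: "closed T" "{x\<in>A. f x \<le> y} = A \<inter> T"
    using assms(1) unfolding lsc_on_def closedin_closed by blast
  then have "{x\<in>B. f x \<le> y} = B \<inter> T" using assms(2) by auto
  then show "closedin (top_of_set B) {x\<in>B. f x \<le> y}"
    using T(1) by (simp add: closedin_closed_Int)
qed

lemma lsc_on_continuous:
  assumes "continuous_on A f"
  shows "lsc_on A f"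
  unfolding lsc_on_def
proof
  fix y :: real
  have "{x\<in>A. f x \<le> y} = A \<inter> f -` {..y}" by auto
  then show "closedin (top_of_set A) {x\<in>A. f x \<le> y}"
    by (simp add: continuous_closedin_preimage assms)
qed

lemma lsc_on_incseq_limit:
  assumes lsc: "\<And>n::nat. lsc_on A (g n)"
    and inc: "\<And>x. x \<in> A \<Longrightarrow> incseq (\<lambda>n. g n x)"
    and lim: "\<And>x. x \<in> A \<Longrightarrow> (\<lambda>n. g n x) \<longlonglongrightarrow> f x"
  shows "lsc_on A f"
  unfolding lsc_on_def
proof
  fix y
  have "{x\<in>A. f x \<le> y} = (\<Inter>n. {x\<in>A. g n x \<le> y})"
    by (auto intro: order_trans[OF incseq_le[OF inc lim]] LIMSEQ_le_const2[OF lim])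
  moreover have "closedin (top_of_set A) (\<Inter>n. {x\<in>A. g n x \<le> y})"
    using lsc unfolding lsc_on_def by (intro closedin_INT) auto
  ultimately show "closedin (top_of_set A) {x\<in>A. f x \<le> y}" by simp
qed

lemma lsc_on_min:
  assumes "lsc_on A f" "lsc_on A g"
  shows "lsc_on A (\<lambda>x. min (f x) (g x))"
  unfolding lsc_on_def
proof
  fix y
  have "{x\<in>A. min (f x) (g x) \<le> y} = {x\<in>A. f x \<le> y} \<union> {x\<in>A. g x \<le> y}" by auto
  then show "closedin (top_of_set A) {x\<in>A. min (f x) (g x) \<le> y}"
    using assms by (auto simp: lsc_on_def)
qed

lemma lsc_on_continuous_minus_indicator:
  assumes f: "continuous_on A f" and S: "closedin (top_of_set A) S" and b: "0 \<le> b"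
  shows "lsc_on A (\<lambda>x. f x - b * indicator S x)"
  unfolding lsc_on_def
proof
  fix y :: real
  have SA: "S \<subseteq> A" using S by (rule closedin_imp_subset)
  have "{x\<in>A. f x - b * indicator S x \<le> y} = {x\<in>A. f x \<le> y} \<union> (S \<inter> {x\<in>A. f x \<le> y + b})"
    using SA b by (auto simp: indicator_def split: if_splits)
  then show "closedin (top_of_set A) {x\<in>A. f x - b * indicator S x \<le> y}"
    using lsc_on_continuous[OF f] S by (auto simp: lsc_on_def)
qed

lemma lsc_on_section:
  assumes "lsc_on (A \<times> K) \<phi>" "x \<in> A" "L \<subseteq> K"
  shows "lsc_on L (\<lambda>u. \<phi> (x, u))"
  unfolding lsc_on_def
proof
  fix y
  have "closedin (top_of_set L) (L \<inter> Pair x -` {w \<in> A \<times> K. \<phi> w \<le> y})"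
    using assms by (intro continuous_closedin_preimage_gen[where T="A \<times> K"])
      (auto simp: lsc_on_def intro!: continuous_intros)
  moreover have "L \<inter> Pair x -` {w \<in> A \<times> K. \<phi> w \<le> y} = {u\<in>L. \<phi> (x, u) \<le> y}"
    using assms by auto
  ultimately show "closedin (top_of_set L) {u\<in>L. \<phi> (x, u) \<le> y}" by simp
qed

text \<open>If no point were a minimizer, the open sets \<open>{x. f y < f x}\<close> would cover \<open>K\<close>; the best
  centre \<open>y\<close> of a finite subcover would then be beaten by another centre.\<close>

lemma lsc_on_attains_inf:
  assumes K: "compact K" "K \<noteq> {}" and f: "lsc_on K f"
  shows "\<exists>x\<in>K. \<forall>y\<in>K. f x \<le> f y"
proof (rule ccontr)
  assume "\<not> ?thesis"
  then have ex: "\<And>x. x \<in> K \<Longrightarrow> \<exists>y\<in>K. f y < f x" by force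
  have "openin (top_of_set K) {x\<in>K. f y < f x}" for y
  proof -
    have "K - {x\<in>K. f x \<le> f y} = {x\<in>K. f y < f x}" by auto
    then show ?thesis
      using f unfolding lsc_on_def by (metis openin_diff openin_subtopology_self)
  qed
  then have "\<forall>y. \<exists>T. open T \<and> {x\<in>K. f y < f x} = K \<inter> T"
    by (auto simp: openin_open)
  then obtain T where T: "\<And>y. open (T y)" "\<And>y. {x\<in>K. f y < f x} = K \<inter> T y" by metis
  have "K \<subseteq> (\<Union>y\<in>K. T y)"
    using ex T(2) by blast
  then obtain C where C: "C \<subseteq> K" "finite C" "K \<subseteq> (\<Union>y\<in>C. T y)"
    using compactE_image[OF K(1), of K T] T(1) by metis
  then have "C \<noteq> {}" using K(2) by auto
  with C(2) obtain m where m: "m \<in> C" "\<And>y. y \<in> C \<Longrightarrow> f m \<le> f y"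
    using arg_min_if_finite(1)[of C f] arg_min_least[of C _ f] by blast
  then obtain y where "y \<in> C" "m \<in> T y" using C by blast
  moreover have "m \<in> K" using m C by auto
  ultimately have "f y < f m" using T(2)[of y] by blast
  with m(2)[OF \<open>y \<in> C\<close>] show False by simp
qed

lemma compact_decreasing_nonempty:
  fixes F :: "nat \<Rightarrow> 'a::t2_space set"
  assumes F: "\<And>n. compact (F n)" "\<And>n. F n \<noteq> {}" and dec: "\<And>m n. m \<le> n \<Longrightarrow> F n \<subseteq> F m"
  shows "(\<Inter>n. F n) \<noteq> {}"
proof -
  have "F 0 \<inter> (\<Inter>n. F n) \<noteq> {}"
  proof (rule compact_imp_fip_image[OF F(1) compact_imp_closed[OF F(1)]])
    fix I :: "nat set" assume "finite I"
    then have "F (Max (insert 0 I)) \<subseteq> F 0 \<inter> (\<Inter>n\<in>I. F n)"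
      by (intro Int_greatest INF_greatest dec) (auto simp: Max_ge_iff)
    then show "F 0 \<inter> (\<Inter>n\<in>I. F n) \<noteq> {}" using F(2) by blast
  qed
  then show ?thesis by blast
qed

lemma INF_eq_attained:
  fixes f :: "'a \<Rightarrow> real"
  assumes "x \<in> K" "\<And>y. y \<in> K \<Longrightarrow> f x \<le> f y"
  shows "(INF y\<in>K. f y) = f x"
  by (intro antisym cINF_lower cINF_greatest bdd_belowI2[where m="f x"]) (use assms in auto)

lemma lsc_on_INF:
  assumes K: "compact K" "K \<noteq> {}" and f: "lsc_on (A \<times> K) \<phi>"
  shows "lsc_on A (\<lambda>x. INF u\<in>K. \<phi> (x, u))"
    and "x \<in> A \<Longrightarrow> \<exists>u\<in>K. (INF u\<in>K. \<phi> (x, u)) = \<phi> (x, u)"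
    and "x \<in> A \<Longrightarrow> u \<in> K \<Longrightarrow> (INF u\<in>K. \<phi> (x, u)) \<le> \<phi> (x, u)"
proof -
  have min: "\<exists>u\<in>K. \<forall>v\<in>K. \<phi> (x, u) \<le> \<phi> (x, v)" if "x \<in> A" for x
    using lsc_on_attains_inf[OF K lsc_on_section[OF f that order_refl]] .
  show att: "\<exists>u\<in>K. (INF u\<in>K. \<phi> (x, u)) = \<phi> (x, u)" if "x \<in> A" for x
    using min[OF that] INF_eq_attained[of _ K "\<lambda>u. \<phi> (x, u)"] by blast
  show low: "(INF u\<in>K. \<phi> (x, u)) \<le> \<phi> (x, u)" if "x \<in> A" "u \<in> K" for x u
    using min[OF that(1)] INF_eq_attained[of _ K "\<lambda>u. \<phi> (x, u)"] that(2) by metis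
  show "lsc_on A (\<lambda>x. INF u\<in>K. \<phi> (x, u))"
    unfolding lsc_on_def
  proof
    fix y
    have "closed_map (top_of_set (A \<times> K)) (top_of_set A) fst"
      using closed_map_fst[of "top_of_set K" "top_of_set A"] K(1)
      by (simp add: subtopology_Times euclidean_product_topology compact_space_subtopology)
    then have "closedin (top_of_set A) (fst ` {w\<in>A \<times> K. \<phi> w \<le> y})"
      using f unfolding closed_map_def lsc_on_def by blast
    moreover have "fst ` {w\<in>A \<times> K. \<phi> w \<le> y} = {x\<in>A. \<exists>u\<in>K. \<phi> (x, u) \<le> y}"
      by force
    moreover have "{x\<in>A. \<exists>u\<in>K. \<phi> (x, u) \<le> y}
       = {x\<in>A. (INF u\<in>K. \<phi> (x, u)) \<le> y}"
      using att low by (auto intro: order_trans; metis)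
    ultimately show "closedin (top_of_set A) {x\<in>A. (INF u\<in>K. \<phi> (x, u)) \<le> y}" by simp
  qed
qed

text \<open>The Pasch--Hausdorff envelope, the largest \<open>m\<close>-Lipschitz minorant. It approximates a
  bounded lower semicontinuous function from below by functions that are Lipschitz in each coordinate,
  uniformly in the others; this uniformity lets weak continuity of a kernel on one factor act on functions
  of two variables.\<close>

definition lip_env :: "'a::metric_space set \<Rightarrow> ('a \<Rightarrow> real) \<Rightarrow> nat \<Rightarrow> 'a \<Rightarrow> real" where
  "lip_env A f m x = (INF y\<in>A. f y + real m * dist x y)"

lemma lip_env:
  assumes f: "lsc_on A f" and bd: "\<And>x. x \<in> A \<Longrightarrow> c \<le> f x \<and> f x \<le> d"
  shows lip_env_bounds: "x \<in> A \<Longrightarrow> c \<le> lip_env A f m x \<and> lip_env A f m x \<le> d"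
    and lip_env_lipschitz: "x \<in> A \<Longrightarrow> y \<in> A \<Longrightarrow> lip_env A f m x \<le> lip_env A f m y + m * dist x y"
    and lip_env_incseq: "x \<in> A \<Longrightarrow> incseq (\<lambda>m. lip_env A f m x)"
    and lip_env_tendsto: "x \<in> A \<Longrightarrow> (\<lambda>m. lip_env A f m x) \<longlonglongrightarrow> f x"
proof -
  have bb: "bdd_below ((\<lambda>y. f y + real m * dist x y) ` A)" for x m
    by (rule bdd_belowI2[where m=c]) (use bd in \<open>auto intro: add_increasing2\<close>)
  have low: "y \<in> A \<Longrightarrow> lip_env A f m x \<le> f y + m * dist x y" for x y m
    unfolding lip_env_def by (intro cINF_lower bb)
  have great: "A \<noteq> {} \<Longrightarrow> (\<And>y. y \<in> A \<Longrightarrow> t \<le> f y + m * dist x y) \<Longrightarrow> t \<le> lip_env A f m x" for x m t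
    unfolding lip_env_def by (intro cINF_greatest) auto
  have le: "lip_env A f m x \<le> f x" if "x \<in> A" for x m
    using low[OF that, of m x] by simp
  have ge: "c \<le> lip_env A f m x" if "x \<in> A" for x m
    by (rule great) (use that bd in \<open>auto intro: add_increasing2\<close>)
  show "x \<in> A \<Longrightarrow> c \<le> lip_env A f m x \<and> lip_env A f m x \<le> d" for x
    using le ge bd by (meson order_trans)
  show "lip_env A f m x \<le> lip_env A f m y + m * dist x y" if "x \<in> A" "y \<in> A" for x y
  proof -
    have "lip_env A f m x - m * dist x y \<le> lip_env A f m y"
    proof (rule great)
      fix z assume "z \<in> A"
      have "lip_env A f m x \<le> f z + m * dist x z" by (rule low) fact
      also have "\<dots> \<le> f z + m * (dist x y + dist y z)"
        by (intro add_left_mono mult_left_mono dist_triangle) auto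
      finally show "lip_env A f m x - m * dist x y \<le> f z + m * dist y z"
        by (simp add: algebra_simps)
    qed (use that in auto)
    then show ?thesis by simp
  qed
  show inc: "incseq (\<lambda>m. lip_env A f m x)" if "x \<in> A" for x
  proof (rule incseq_SucI)
    fix m show "lip_env A f m x \<le> lip_env A f (Suc m) x"
      by (rule great) (use that in \<open>auto intro!: order_trans[OF low] mult_right_mono\<close>)
  qed
  show "(\<lambda>m. lip_env A f m x) \<longlonglongrightarrow> f x" if x: "x \<in> A" for x
  proof (rule order_tendstoI)
    fix y assume "f x < y"
    then show "eventually (\<lambda>m. lip_env A f m x < y) sequentially"
      using le[OF x] by (intro always_eventually) (meson le_less_trans)
  next
    fix y assume "y < f x"
    then obtain y' where y': "y < y'" "y' < f x" using dense by blast
    have "openin (top_of_set A) (A - {z\<in>A. f z \<le> y'})"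
      using f unfolding lsc_on_def by (metis openin_diff openin_subtopology_self)
    moreover have "x \<in> A - {z\<in>A. f z \<le> y'}" using x y' by auto
    ultimately obtain e where e: "e > 0" "\<And>z. z \<in> A \<Longrightarrow> dist z x < e \<Longrightarrow> y' < f z"
      unfolding openin_euclidean_subtopology_iff by (metis (mono_tags, lifting) DiffE mem_Collect_eq not_le)
    obtain m0 where m0: "(y' - c) / e \<le> real m0" using real_arch_simple by blast
    have "y < lip_env A f m x" if "m \<ge> m0" for m
    proof (rule less_le_trans[OF y'(1)], rule great)
      fix z assume z: "z \<in> A"
      show "y' \<le> f z + m * dist x z"
      proof (cases "dist z x < e")
        case True
        then show ?thesis using e(2)[OF z True] by (auto intro: add_increasing2 less_imp_le)
      next
        case False
        have "y' - c \<le> m0 * e" using m0 e by (simp add: field_simps)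
        also have "\<dots> \<le> m * dist x z"
          using False that e by (intro mult_mono) (auto simp: dist_commute)
        finally show ?thesis using bd[OF z] by simp
      qed
    qed (use x in auto)
    then show "eventually (\<lambda>m. y < lip_env A f m x) sequentially"
      unfolding eventually_sequentially by blast
  qed
qed

lemma continuous_on_lip_env:
  assumes f: "lsc_on A f" and bd: "\<And>x. x \<in> A \<Longrightarrow> c \<le> f x \<and> f x \<le> d"
  shows "continuous_on A (lip_env A f m)"
proof (rule continuous_onI)
  fix x and e :: real assume x: "x \<in> A" and e: "0 < e"
  show "\<exists>d>0. \<forall>x'\<in>A. dist x' x < d \<longrightarrow> dist (lip_env A f m x') (lip_env A f m x) \<le> e"
  proof (intro exI conjI ballI impI)
    show "0 < e / (m + 1)" using e by simp
    fix y assume y: "y \<in> A" "dist y x < e / (m + 1)"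
    have "dist (lip_env A f m y) (lip_env A f m x) \<le> m * dist y x"
      using lip_env_lipschitz[OF f bd, of x y m] lip_env_lipschitz[OF f bd, of y x m] x y
      by (auto simp: dist_real_def dist_commute abs_le_iff)
    also have "\<dots> \<le> (m + 1) * dist y x" by (intro mult_right_mono) auto
    also have "\<dots> \<le> e" using y(2) by (simp add: field_simps)
    finally show "dist (lip_env A f m y) (lip_env A f m x) \<le> e" .
  qed
qed

text \<open>Successive selection of the points of \<open>A\<close> that are nearest to \<open>p 0\<close>, then to \<open>p 1\<close>, and so
  on. If \<open>p\<close> is dense, only one point of a compact set survives all rounds, because a point is
  determined by its distances to a dense sequence.\<close>

primrec nearest :: "(nat \<Rightarrow> 'u::metric_space) \<Rightarrow> 'u set \<Rightarrow> nat \<Rightarrow> 'u set" where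
  "nearest p A 0 = A"
| "nearest p A (Suc i) = {u \<in> nearest p A i. \<forall>v\<in>nearest p A i. dist u (p i) \<le> dist v (p i)}"

lemma compact_nearest:
  assumes "compact A" "A \<noteq> {}"
  shows "compact (nearest p A i) \<and> nearest p A i \<noteq> {}"
proof (induction i)
  case (Suc i)
  let ?N = "nearest p A i"
  obtain u where u: "u \<in> ?N" "\<forall>v\<in>?N. dist u (p i) \<le> dist v (p i)"
    using continuous_attains_inf[of ?N "\<lambda>u. dist u (p i)"] Suc
      continuous_on_dist[OF continuous_on_id continuous_on_const] by blast
  then have eq: "nearest p A (Suc i) = ?N \<inter> cball (p i) (dist u (p i))"
    by (auto simp: dist_commute intro: order_trans)
  have "compact (nearest p A (Suc i))" unfolding eq using Suc by (intro compact_Int_closed) auto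
  then show ?case using u by auto
qed (use assms in simp)

lemma nearest_antimono: "i \<le> j \<Longrightarrow> nearest p A j \<subseteq> nearest p A i"
  by (induction j rule: dec_induct) auto

text \<open>Whether a round leaves a point of \<open>L\<close> is expressed by countably many conditions of the same
  form on the previous round, so measurability of hitting sets passes from round to round.\<close>

lemma nearest_hits_iff:
  assumes A: "compact A" "A \<noteq> {}" and L: "closed L"
  shows "nearest p A (Suc i) \<inter> L \<noteq> {} \<longleftrightarrow>
    nearest p A i \<inter> L \<noteq> {} \<and>
    (\<forall>q::rat. nearest p A i \<inter> cball (p i) (of_rat q) \<noteq> {} \<longrightarrow>
       nearest p A i \<inter> (L \<inter> cball (p i) (of_rat q)) \<noteq> {})"
    (is "?l \<longleftrightarrow> ?r")
proof
  assume ?l then show ?r by (fastforce simp: dist_commute intro: order_trans)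
next
  assume r: ?r
  let ?N = "nearest p A i"
  have N: "compact ?N" using compact_nearest[OF A] by auto
  then have "compact (?N \<inter> L)" using L by auto
  then obtain u where u: "u \<in> ?N" "u \<in> L" "\<forall>v\<in>?N \<inter> L. dist u (p i) \<le> dist v (p i)"
    using continuous_attains_inf[of "?N \<inter> L" "\<lambda>u. dist u (p i)"] r
      continuous_on_dist[OF continuous_on_id continuous_on_const] by blast
  have "dist u (p i) \<le> dist v (p i)" if v: "v \<in> ?N" for v
  proof (rule ccontr)
    assume "\<not> ?thesis"
    then obtain q where q: "dist v (p i) < of_rat q" "of_rat q < dist u (p i)"
      using of_rat_dense[of "dist v (p i)" "dist u (p i)"] by auto
    then have "?N \<inter> cball (p i) (of_rat q) \<noteq> {}"
      using v by (auto simp: dist_commute intro!: exI[of _ v])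
    then have "?N \<inter> (L \<inter> cball (p i) (of_rat q)) \<noteq> {}" using r by blast
    then obtain w where "w \<in> ?N \<inter> L" "dist w (p i) \<le> of_rat q"
      by (force simp: dist_commute)
    then show False using u(3) q by force
  qed
  then show ?l using u by auto
qed

text \<open>The selector is the point that survives all rounds of nearest-point selection; it lies in a
  closed set exactly when every round meets that set.\<close>

lemma compact_valued_selection:
  fixes A :: "'z \<Rightarrow> 'u::{metric_space, second_countable_topology} set"
  assumes A: "\<And>z. z \<in> space Z \<Longrightarrow> compact (A z) \<and> A z \<noteq> {}"
    and meas: "\<And>L. closed L \<Longrightarrow> {z\<in>space Z. A z \<inter> L \<noteq> {}} \<in> sets Z"
  shows "\<exists>s\<in>Z \<rightarrow>\<^sub>M borel. \<forall>z\<in>space Z. s z \<in> A z"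
proof -
  obtain D :: "'u set" where D: "countable D" "\<And>X. open X \<Longrightarrow> X \<noteq> {} \<Longrightarrow> \<exists>d\<in>D. d \<in> X"
    by (rule countable_dense_setE) blast
  then have "D \<noteq> {}" using open_UNIV by (metis UNIV_not_empty empty_iff)
  define p where "p = from_nat_into D"
  have p: "\<exists>i. p i \<in> X" if "open X" "X \<noteq> {}" for X
    using D(2)[OF that] from_nat_into_surj[OF D(1)] by (auto simp: p_def)
  have mi: "{z\<in>space Z. nearest p (A z) i \<inter> L \<noteq> {}} \<in> sets Z" if "closed L" for i L
    using that
  proof (induction i arbitrary: L)
    case (Suc i)
    have "{z\<in>space Z. nearest p (A z) (Suc i) \<inter> L \<noteq> {}} = {z\<in>space Z. nearest p (A z) i \<inter> L \<noteq> {} \<and>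
      (\<forall>q::rat. nearest p (A z) i \<inter> cball (p i) (of_rat q) \<noteq> {} \<longrightarrow>
         nearest p (A z) i \<inter> (L \<inter> cball (p i) (of_rat q)) \<noteq> {})}"
      by (intro Collect_cong conj_cong refl nearest_hits_iff Suc.prems) (use A in auto)
    also have "\<dots> = {z\<in>space Z. nearest p (A z) i \<inter> L \<noteq> {}} \<inter>
      (\<Inter>q::rat. (space Z - {z\<in>space Z. nearest p (A z) i \<inter> cball (p i) (of_rat q) \<noteq> {}}) \<union>
         {z\<in>space Z. nearest p (A z) i \<inter> (L \<inter> cball (p i) (of_rat q)) \<noteq> {}})"
      by blast
    finally have eq: "{z\<in>space Z. nearest p (A z) (Suc i) \<inter> L \<noteq> {}} = \<dots>" .
    show ?case unfolding eq
      by (intro sets.Int sets.countable_INT' sets.Un sets.Diff Suc.IH closed_Int)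
        (use Suc.prems in \<open>auto intro!: Suc.IH closed_Int\<close>)
  qed (use meas in simp)
  have ne: "(\<Inter>i. nearest p (A z) i \<inter> L) \<noteq> {}"
    if z: "z \<in> space Z" and L: "closed L" "\<And>i. nearest p (A z) i \<inter> L \<noteq> {}" for z L
    by (rule compact_decreasing_nonempty)
       (use L compact_nearest[OF conjunct1[OF A[OF z]] conjunct2[OF A[OF z]]] nearest_antimono[THEN subsetD] in auto)
  define s where "s z = (SOME u. \<forall>i. u \<in> nearest p (A z) i)" for z
  have s: "s z \<in> nearest p (A z) i" if "z \<in> space Z" for z i
  proof -
    have "nearest p (A z) i \<inter> UNIV \<noteq> {}" for i
      using compact_nearest[OF conjunct1[OF A[OF that]] conjunct2[OF A[OF that]]] by simp
    from ne[OF that closed_UNIV this] have "\<exists>u. \<forall>i. u \<in> nearest p (A z) i" by blast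
    from someI_ex[OF this] show ?thesis unfolding s_def by blast
  qed
  have uniq: "u = s z" if "z \<in> space Z" and u: "\<And>i. u \<in> nearest p (A z) i" for z u
  proof (rule ccontr)
    assume "u \<noteq> s z"
    then have "open (ball u (dist u (s z) / 2))" "ball u (dist u (s z) / 2) \<noteq> {}" by auto
    from p[OF this] obtain i where i: "dist u (p i) < dist u (s z) / 2" by auto
    have "dist (s z) (p i) \<le> dist u (p i)"
      using u[of i] s[OF that(1), of "Suc i"] by auto
    then show False using i dist_triangle2[of u "s z" "p i"] by (simp add: dist_commute)
  qed
  have "s \<in> Z \<rightarrow>\<^sub>M borel"
  proof (rule borel_measurableI)
    fix S :: "'u set" assume "open S"
    then have cl: "closed (- S)" by auto
    have "s -` S \<inter> space Z = space Z - (\<Inter>i. {z\<in>space Z. nearest p (A z) i \<inter> - S \<noteq> {}})"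
    proof (intro set_eqI iffI)
      fix z assume z: "z \<in> s -` S \<inter> space Z"
      have "\<not> (\<forall>i. nearest p (A z) i \<inter> - S \<noteq> {})"
      proof
        assume "\<forall>i. nearest p (A z) i \<inter> - S \<noteq> {}"
        then obtain u where u: "\<And>i. u \<in> nearest p (A z) i" "u \<notin> S"
          using ne[OF _ cl, of z] z by blast
        with uniq[of z u] z show False by auto
      qed
      then show "z \<in> space Z - (\<Inter>i. {z\<in>space Z. nearest p (A z) i \<inter> - S \<noteq> {}})" using z by auto
    qed (use s in blast)
    also have "\<dots> \<in> sets Z"
      by (intro sets.Diff sets.countable_INT') (use mi cl in auto)
    finally show "s -` S \<inter> space Z \<in> sets Z" .
  qed
  moreover have "\<forall>z\<in>space Z. s z \<in> A z" using s[of _ 0] by simp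
  ultimately show ?thesis by blast
qed

text \<open>For an increasing sequence of lower semicontinuous objectives, the supremum over \<open>n\<close> and the
  minimum over \<open>u\<close> commute: the sets of points that stay below the limit of the minima are compact,
  nonempty and decreasing. One measurable selector is therefore optimal for the limiting objective,
  although that objective need not be jointly lower semicontinuous (\<open>t n\<close> is only measurable in
  \<open>z\<close>) and may take the value infinity.\<close>

lemma monotone_limit_selection:
  fixes \<phi> :: "nat \<Rightarrow> 'z::topological_space \<times> 'u::{metric_space, second_countable_topology} \<Rightarrow> real"
    and t :: "nat \<Rightarrow> 'z \<Rightarrow> real"
  assumes K: "compact K" "K \<noteq> {}"
    and lsc: "\<And>n. lsc_on (A \<times> K) (\<phi> n)"
    and t[measurable]: "\<And>n. t n \<in> borel_measurable (restrict_space borel A)"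
    and inc: "\<And>z u n. z \<in> A \<Longrightarrow> u \<in> K \<Longrightarrow> \<phi> n (z, u) - t n z \<le> \<phi> (Suc n) (z, u) - t (Suc n) z"
  shows "\<exists>s\<in>restrict_space borel A \<rightarrow>\<^sub>M borel. \<forall>z\<in>A. s z \<in> K \<and>
    (\<forall>n. ennreal (\<phi> n (z, s z) - t n z) \<le> (SUP n. ennreal ((INF u\<in>K. \<phi> n (z, u)) - t n z)))"
proof -
  let ?Z = "restrict_space borel A"
  define W where "W z = (SUP n. ennreal ((INF u\<in>K. \<phi> n (z, u)) - t n z))" for z
  define B where "B n z = {u\<in>K. ennreal (\<phi> n (z, u) - t n z) \<le> W z}" for n z
  have mINF: "(\<lambda>z. INF u\<in>L. \<phi> n (z, u)) \<in> borel_measurable ?Z"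
    if "closed L" "L \<subseteq> K" "L \<noteq> {}" for n L
  proof -
    have "compact L" using compact_Int_closed[OF K(1) that(1)] that(2) by (simp add: Int_absorb1)
    moreover have "lsc_on (A \<times> L) (\<phi> n)"
      by (rule lsc_on_subset[OF lsc]) (use that in auto)
    ultimately show ?thesis using lsc_on_INF(1) that borel_measurable_lsc by blast
  qed
  have W[measurable]: "W \<in> borel_measurable ?Z"
    unfolding W_def using mINF[OF compact_imp_closed[OF K(1)] order_refl K(2)] by measurable
  have incn: "\<phi> m (z, u) - t m z \<le> \<phi> n (z, u) - t n z" if "z \<in> A" "u \<in> K" "m \<le> n" for m n z u
    by (rule lift_Suc_mono_le[of "\<lambda>n. \<phi> n (z, u) - t n z"]) (use inc that in auto)
  have Bcl: "compact (B n z)" if z: "z \<in> A" for n z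
  proof (cases "W z = \<infinity>")
    case True
    then show ?thesis using K by (simp add: B_def)
  next
    case False
    then obtain w where w: "0 \<le> w" "W z = ennreal w" by (cases "W z") auto
    then have "B n z = {u\<in>K. \<phi> n (z, u) \<le> w + t n z}"
      by (auto simp: B_def ennreal_le_iff2)
    moreover have "closedin (top_of_set K) {u\<in>K. \<phi> n (z, u) \<le> w + t n z}"
      using lsc_on_section[OF lsc z order_refl] unfolding lsc_on_def by blast
    ultimately show ?thesis using K(1) closedin_compact by auto
  qed
  have Bdec: "B n z \<subseteq> B m z" if "z \<in> A" "m \<le> n" for m n z
    using incn[OF that(1) _ that(2)] unfolding B_def
    by (auto intro: order_trans[OF ennreal_leI])
  have hit: "(\<Inter>n. B n z) \<inter> L \<noteq> {} \<longleftrightarrow> (\<forall>n. \<exists>u\<in>K \<inter> L. ennreal (\<phi> n (z, u) - t n z) \<le> W z)"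
    (is "?l \<longleftrightarrow> ?r") if z: "z \<in> A" and L: "closed L" for z L
  proof
    assume ?l then show ?r unfolding B_def by blast
  next
    assume r: ?r
    have "(\<Inter>n. B n z \<inter> L) \<noteq> {}"
    proof (rule compact_decreasing_nonempty)
      fix n show "compact (B n z \<inter> L)" using Bcl[OF z] L by auto
      show "B n z \<inter> L \<noteq> {}" using r by (auto simp: B_def)
    qed (use Bdec[OF z] in auto)
    then show ?l by auto
  qed
  have inf: "(\<exists>u\<in>L. ennreal (\<phi> n (z, u) - t n z) \<le> W z) \<longleftrightarrow>
      ennreal ((INF u\<in>L. \<phi> n (z, u)) - t n z) \<le> W z"
      if L: "closed L" "L \<subseteq> K" "L \<noteq> {}" and z: "z \<in> A" for L n z
  proof -
    have cL: "compact L" using compact_Int_closed[OF K(1) that(1)] that(2) by (simp add: Int_absorb1)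
    obtain u where u: "u \<in> L" "\<And>v. v \<in> L \<Longrightarrow> \<phi> n (z, u) \<le> \<phi> n (z, v)"
      using lsc_on_attains_inf[OF cL L(3) lsc_on_section[OF lsc z L(2)]] by blast
    have "(INF u\<in>L. \<phi> n (z, u)) = \<phi> n (z, u)"
      using INF_eq_attained[of u L "\<lambda>u. \<phi> n (z, u)"] u by auto
    moreover have "ennreal (\<phi> n (z, u) - t n z) \<le> ennreal (\<phi> n (z, v) - t n z)" if "v \<in> L" for v
      using u(2)[OF that] by (intro ennreal_leI) simp
    ultimately show ?thesis using u(1) by (metis order_trans)
  qed
  have "\<exists>s\<in>?Z \<rightarrow>\<^sub>M borel. \<forall>z\<in>space ?Z. s z \<in> (\<Inter>n. B n z)"
  proof (rule compact_valued_selection)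
    fix z assume "z \<in> space ?Z"
    then have z: "z \<in> A" by (simp add: space_restrict_space)
    have "(\<Inter>n. B n z) \<inter> UNIV \<noteq> {}"
      unfolding hit[OF z closed_UNIV]
      using inf[OF compact_imp_closed[OF K(1)] order_refl K(2) z]
      by (auto simp: W_def intro: SUP_upper)
    moreover have "compact (\<Inter>n. B n z)"
    proof -
      have "closed (\<Inter>n. B n z)" by (intro closed_INT ballI compact_imp_closed Bcl[OF z])
      then have "compact (B 0 z \<inter> (\<Inter>n. B n z))" by (rule compact_Int_closed[OF Bcl[OF z]])
      moreover have "B 0 z \<inter> (\<Inter>n. B n z) = (\<Inter>n. B n z)" by blast
      ultimately show ?thesis by simp
    qed
    ultimately show "compact (\<Inter>n. B n z) \<and> (\<Inter>n. B n z) \<noteq> {}" by simp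
  next
    fix L :: "'u set" assume L: "closed L"
    have KL: "closed (K \<inter> L)" using L K by (auto intro: compact_imp_closed)
    show "{z \<in> space ?Z. (\<Inter>n. B n z) \<inter> L \<noteq> {}} \<in> sets ?Z"
    proof (cases "K \<inter> L = {}")
      case True
      have "{z \<in> space ?Z. (\<Inter>n. B n z) \<inter> L \<noteq> {}} = {}"
        using True unfolding B_def by blast
      then show ?thesis by (metis sets.empty_sets)
    next
      case False
      have [measurable]: "(\<lambda>z. INF u\<in>K \<inter> L. \<phi> n (z, u)) \<in> borel_measurable ?Z" for n
        by (rule mINF[OF KL _ False]) auto
      have "{z \<in> space ?Z. (\<Inter>n. B n z) \<inter> L \<noteq> {}} =
        {z \<in> space ?Z. \<forall>n. ennreal ((INF u\<in>K \<inter> L. \<phi> n (z, u)) - t n z) \<le> W z}"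
        using hit[OF _ L] inf[OF KL _ False] by (auto simp: space_restrict_space)
      also have "\<dots> \<in> sets ?Z" by measurable
      finally show ?thesis .
    qed
  qed
  then show ?thesis
    by (force simp: space_restrict_space B_def W_def)
qed

section \<open>Laws of controlled processes\<close>

lemma space_hist_space:
  "h \<in> space (hist_space S A k) \<longleftrightarrow>
    fst h \<in> PiE {..k} (\<lambda>_. space S) \<and> snd h \<in> PiE {..<k} (\<lambda>_. space A)"
  by (cases h) (simp add: hist_space_def space_pair_measure space_PiM)

lemma measurable_hist_state[measurable]:
  "j \<le> k \<Longrightarrow> (\<lambda>h. fst h j) \<in> hist_space S A k \<rightarrow>\<^sub>M S"
  unfolding hist_space_def by (intro measurable_compose[OF measurable_fst] measurable_component_singleton) auto

lemma measurable_hist_input[measurable]: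
  "j < k \<Longrightarrow> (\<lambda>h. snd h j) \<in> hist_space S A k \<rightarrow>\<^sub>M A"
  unfolding hist_space_def by (intro measurable_compose[OF measurable_snd] measurable_component_singleton) auto

lemma measurable_state_input:
  "(\<lambda>hu. (fst (fst hu) k, snd hu)) \<in> hist_space S A k \<Otimes>\<^sub>M A \<rightarrow>\<^sub>M S \<Otimes>\<^sub>M A"
  by (intro measurable_Pair measurable_compose[OF measurable_fst measurable_hist_state]) auto

definition hist_ext :: "nat \<Rightarrow> ('s, 'a) hist \<Rightarrow> 'a \<Rightarrow> 's \<Rightarrow> ('s, 'a) hist" where
  "hist_ext k h u s = ((fst h)(Suc k := s), (snd h)(k := u))"

lemma measurable_hist_ext[measurable]:
  assumes f: "f \<in> M \<rightarrow>\<^sub>M hist_space S A k" and g: "g \<in> M \<rightarrow>\<^sub>M A" and r: "r \<in> M \<rightarrow>\<^sub>M S"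
  shows "(\<lambda>x. hist_ext k (f x) (g x) (r x)) \<in> M \<rightarrow>\<^sub>M hist_space S A (Suc k)"
proof -
  have f1: "(\<lambda>x. fst (f x)) \<in> M \<rightarrow>\<^sub>M (\<Pi>\<^sub>M i\<in>{..k}. S)" and f2: "(\<lambda>x. snd (f x)) \<in> M \<rightarrow>\<^sub>M (\<Pi>\<^sub>M i\<in>{..<k}. A)"
    using f unfolding hist_space_def by (auto intro: measurable_compose[OF _ measurable_fst] measurable_compose[OF _ measurable_snd])
  show ?thesis
    unfolding hist_ext_def hist_space_def
    by (intro measurable_Pair measurable_fun_upd[OF _ f1 r] measurable_fun_upd[OF _ f2 g]) auto
qed

text \<open>Controlled processes with arbitrary state and input spaces, so that the same facts serve the
  original and the cost-augmented process.\<close>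

locale controlled_process =
  fixes S :: "'s measure" and A :: "'a measure" and T :: "nat \<Rightarrow> 's \<times> 'a \<Rightarrow> 's measure"
    and p :: "nat \<Rightarrow> ('s, 'a) hist \<Rightarrow> 'a measure" and s :: 's and N :: nat
  assumes T[measurable]: "\<And>k. k < N \<Longrightarrow> T k \<in> S \<Otimes>\<^sub>M A \<rightarrow>\<^sub>M prob_algebra S"
    and p[measurable]: "\<And>k. k < N \<Longrightarrow> p k \<in> hist_space S A k \<rightarrow>\<^sub>M prob_algebra A"
    and s: "s \<in> space S"
begin

abbreviation H :: "nat \<Rightarrow> ('s, 'a) hist measure" where "H k \<equiv> hist_space S A k"

abbreviation L :: "nat \<Rightarrow> ('s, 'a) hist measure" where "L k \<equiv> hist_law S A T p s k"

lemma init_in_space: "(\<lambda>i\<in>{0}. s, \<lambda>_. undefined) \<in> space (H 0)"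
  using s by (auto simp: space_hist_space)

lemma T_sub[measurable]: "k < N \<Longrightarrow> T k \<in> S \<Otimes>\<^sub>M A \<rightarrow>\<^sub>M subprob_algebra S"
  by (intro measurable_prob_algebraD T)

lemma p_sub[measurable]: "k < N \<Longrightarrow> p k \<in> H k \<rightarrow>\<^sub>M subprob_algebra A"
  by (intro measurable_prob_algebraD p)

lemma step_kernels:
  assumes k: "k < N"
  shows "(\<lambda>((h, u), s'). return (H (Suc k)) (hist_ext k h u s')) \<in> (H k \<Otimes>\<^sub>M A) \<Otimes>\<^sub>M S \<rightarrow>\<^sub>M prob_algebra (H (Suc k))"
    and "(\<lambda>(h, u). T k (fst h k, u) \<bind> (\<lambda>s'. return (H (Suc k)) (hist_ext k h u s')))
      \<in> H k \<Otimes>\<^sub>M A \<rightarrow>\<^sub>M prob_algebra (H (Suc k))"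
    and "(\<lambda>h. p k h \<bind> (\<lambda>u. T k (fst h k, u) \<bind> (\<lambda>s'. return (H (Suc k)) (hist_ext k h u s'))))
      \<in> H k \<rightarrow>\<^sub>M prob_algebra (H (Suc k))"
proof -
  show 1: "(\<lambda>((h, u), s'). return (H (Suc k)) (hist_ext k h u s')) \<in> (H k \<Otimes>\<^sub>M A) \<Otimes>\<^sub>M S \<rightarrow>\<^sub>M prob_algebra (H (Suc k))"
    unfolding case_prod_beta' by (rule measurable_compose[OF _ measurable_return_prob_space]) measurable
  have "(\<lambda>hu. T k (fst (fst hu) k, snd hu)) \<in> H k \<Otimes>\<^sub>M A \<rightarrow>\<^sub>M prob_algebra S"
    by (rule measurable_compose[OF measurable_state_input T[OF k]])
  from measurable_bind_prob_space2[OF this, of "\<lambda>hu s'. return (H (Suc k)) (hist_ext k (fst hu) (snd hu) s')" "H (Suc k)"] 1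
  show 2: "(\<lambda>(h, u). T k (fst h k, u) \<bind> (\<lambda>s'. return (H (Suc k)) (hist_ext k h u s')))
      \<in> H k \<Otimes>\<^sub>M A \<rightarrow>\<^sub>M prob_algebra (H (Suc k))"
    by (simp add: case_prod_beta')
  show "(\<lambda>h. p k h \<bind> (\<lambda>u. T k (fst h k, u) \<bind> (\<lambda>s'. return (H (Suc k)) (hist_ext k h u s'))))
      \<in> H k \<rightarrow>\<^sub>M prob_algebra (H (Suc k))"
    by (rule measurable_bind_prob_space2[OF p[OF k]]) (use 2 in simp)
qed

lemma hist_law_Suc: "L (Suc k) =
  L k \<bind> (\<lambda>h. p k h \<bind> (\<lambda>u. T k (fst h k, u) \<bind> (\<lambda>s'. return (H (Suc k)) (hist_ext k h u s'))))"
  by (simp add: hist_ext_def)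

lemma hist_law_in_prob_algebra: "k \<le> N \<Longrightarrow> L k \<in> space (prob_algebra (H k))"
proof (induction k)
  case 0
  then show ?case using init_in_space by (simp add: space_prob_algebra prob_space_return)
next
  case (Suc k)
  then have k: "k < N" and IH: "L k \<in> space (prob_algebra (H k))" by auto
  show ?case
    unfolding hist_law_Suc space_prob_algebra
    using prob_space_bind'[OF IH step_kernels(3)[OF k]] sets_bind'[OF IH step_kernels(3)[OF k]] by auto
qed

lemma sets_hist_law: "k \<le> N \<Longrightarrow> sets (L k) = sets (H k)"
  and space_hist_law: "k \<le> N \<Longrightarrow> space (L k) = space (H k)"
  and prob_space_hist_law: "k \<le> N \<Longrightarrow> prob_space (L k)"
  using hist_law_in_prob_algebra[of k] by (auto simp: space_prob_algebra dest: sets_eq_imp_space_eq)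

lemma nn_integral_hist_law_0:
  "F \<in> borel_measurable (H 0) \<Longrightarrow> (\<integral>\<^sup>+h. F h \<partial>L 0) = F (\<lambda>i\<in>{0}. s, \<lambda>_. undefined)"
  using init_in_space by (simp add: nn_integral_return)

lemma policy_space:
  assumes "k < N" "h \<in> space (H k)"
  shows "sets (p k h) = sets A" "space (p k h) = space A" "prob_space (p k h)"
  using measurable_space[OF p[OF assms(1)] assms(2)]
  by (auto simp: space_prob_algebra dest: sets_eq_imp_space_eq)

lemma transition_space:
  assumes "k < N" "x \<in> space S" "u \<in> space A"
  shows "sets (T k (x, u)) = sets S" "space (T k (x, u)) = space S" "prob_space (T k (x, u))"
  using measurable_space[OF T[OF assms(1)], of "(x, u)"] assms(2,3)
  by (auto simp: space_prob_algebra space_pair_measure dest: sets_eq_imp_space_eq)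

lemma hist_state_space: "h \<in> space (H k) \<Longrightarrow> j \<le> k \<Longrightarrow> fst h j \<in> space S"
  by (auto simp: space_hist_space)

text \<open>One step of the law as an iterated integral; all later statements about laws go through this
  form of the recursion.\<close>

lemma nn_integral_hist_law_Suc:
  assumes k: "k < N" and F[measurable]: "F \<in> borel_measurable (H (Suc k))"
  shows "(\<integral>\<^sup>+h. F h \<partial>L (Suc k)) =
    (\<integral>\<^sup>+h. \<integral>\<^sup>+u. \<integral>\<^sup>+s'. F (hist_ext k h u s') \<partial>T k (fst h k, u) \<partial>p k h \<partial>L k)"
proof -
  have "(\<integral>\<^sup>+h. F h \<partial>L (Suc k)) = (\<integral>\<^sup>+h. \<integral>\<^sup>+h'. F h' \<partial>(p k h \<bind> (\<lambda>u. T k (fst h k, u) \<bind>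
      (\<lambda>s'. return (H (Suc k)) (hist_ext k h u s')))) \<partial>L k)"
    unfolding hist_law_Suc
    by (rule nn_integral_bind[OF F])
       (use step_kernels(3)[OF k] sets_hist_law[of k] k in \<open>auto intro!: measurable_prob_algebraD cong: measurable_cong_sets\<close>)
  also have "\<dots> = (\<integral>\<^sup>+h. \<integral>\<^sup>+u. \<integral>\<^sup>+s'. F (hist_ext k h u s') \<partial>T k (fst h k, u) \<partial>p k h \<partial>L k)"
  proof (rule nn_integral_cong)
    fix h assume "h \<in> space (L k)"
    then have h: "h \<in> space (H k)" using space_hist_law[of k] k by auto
    have "(\<lambda>u. T k (fst h k, u) \<bind> (\<lambda>s'. return (H (Suc k)) (hist_ext k h u s'))) \<in> A \<rightarrow>\<^sub>M prob_algebra (H (Suc k))"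
      using measurable_compose[OF measurable_Pair1'[OF h] step_kernels(2)[OF k]] by simp
    then have m: "(\<lambda>u. T k (fst h k, u) \<bind> (\<lambda>s'. return (H (Suc k)) (hist_ext k h u s'))) \<in> p k h \<rightarrow>\<^sub>M subprob_algebra (H (Suc k))"
      using policy_space[OF k h] by (auto intro!: measurable_prob_algebraD cong: measurable_cong_sets)
    have "(\<integral>\<^sup>+h'. F h' \<partial>(p k h \<bind> (\<lambda>u. T k (fst h k, u) \<bind> (\<lambda>s'. return (H (Suc k)) (hist_ext k h u s')))))
      = (\<integral>\<^sup>+u. \<integral>\<^sup>+h'. F h' \<partial>(T k (fst h k, u) \<bind> (\<lambda>s'. return (H (Suc k)) (hist_ext k h u s'))) \<partial>p k h)"
      by (rule nn_integral_bind[OF F m])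
    also have "\<dots> = (\<integral>\<^sup>+u. \<integral>\<^sup>+s'. F (hist_ext k h u s') \<partial>T k (fst h k, u) \<partial>p k h)"
    proof (rule nn_integral_cong)
      fix u assume "u \<in> space (p k h)"
      then have u: "u \<in> space A" using policy_space[OF k h] by simp
      note Ts = transition_space[OF k hist_state_space[OF h order_refl] u]
      have "(\<lambda>s'. return (H (Suc k)) (hist_ext k h u s')) \<in> S \<rightarrow>\<^sub>M prob_algebra (H (Suc k))"
        using h u by measurable
      then have m: "(\<lambda>s'. return (H (Suc k)) (hist_ext k h u s')) \<in> T k (fst h k, u) \<rightarrow>\<^sub>M subprob_algebra (H (Suc k))"
        using Ts by (auto intro!: measurable_prob_algebraD cong: measurable_cong_sets)
      have e: "(\<lambda>s'. hist_ext k h u s') \<in> S \<rightarrow>\<^sub>M H (Suc k)" using h u by measurable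
      show "(\<integral>\<^sup>+h'. F h' \<partial>(T k (fst h k, u) \<bind> (\<lambda>s'. return (H (Suc k)) (hist_ext k h u s'))))
        = (\<integral>\<^sup>+s'. F (hist_ext k h u s') \<partial>T k (fst h k, u))"
        unfolding nn_integral_bind[OF F m]
        by (intro nn_integral_cong nn_integral_return) (use Ts measurable_space[OF e] in auto)
    qed
    finally show "(\<integral>\<^sup>+h'. F h' \<partial>(p k h \<bind> (\<lambda>u. T k (fst h k, u) \<bind> (\<lambda>s'. return (H (Suc k)) (hist_ext k h u s')))))
      = (\<integral>\<^sup>+u. \<integral>\<^sup>+s'. F (hist_ext k h u s') \<partial>T k (fst h k, u) \<partial>p k h)" .
  qed
  finally show ?thesis .
qed

lemma nn_integral_step_measurable[measurable]:
  assumes k: "k < N" and F[measurable]: "F \<in> borel_measurable (H (Suc k))"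
  shows "(\<lambda>h. \<integral>\<^sup>+u. \<integral>\<^sup>+s'. F (hist_ext k h u s') \<partial>T k (fst h k, u) \<partial>p k h) \<in> borel_measurable (H k)"
proof -
  have "(\<lambda>hu. \<integral>\<^sup>+s'. F (hist_ext k (fst hu) (snd hu) s') \<partial>T k (fst (fst hu) k, snd hu)) \<in> borel_measurable (H k \<Otimes>\<^sub>M A)"
    by (rule nn_integral_measurable_subprob_algebra2[where N=S])
       (auto simp: case_prod_beta' intro: measurable_compose[OF measurable_state_input T_sub[OF k]])
  then show ?thesis
    by (intro nn_integral_measurable_subprob_algebra2[where N=A] p_sub k) (simp add: case_prod_beta')
qed

end

text \<open>By induction on the number of steps: each step integrates over the input and the next state, and
  both integrals agree along \<open>\<Psi>\<close>. The transition kernels need to match only through test functions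
  of the extended history.\<close>

lemma hist_law_image:
  assumes P: "controlled_process S A T p s N" and P': "controlled_process S' A T' p' s' N"
    and \<Psi>: "\<And>k. k \<le> N \<Longrightarrow> \<Psi> k \<in> hist_space S A k \<rightarrow>\<^sub>M hist_space S' A k"
    and init: "\<Psi> 0 (\<lambda>i\<in>{0}. s, \<lambda>_. undefined) = (\<lambda>i\<in>{0}. s', \<lambda>_. undefined)"
    and pol: "\<And>k h. k < N \<Longrightarrow> h \<in> space (hist_space S A k) \<Longrightarrow> p' k (\<Psi> k h) = p k h"
    and step: "\<And>k h u G. k < N \<Longrightarrow> h \<in> space (hist_space S A k) \<Longrightarrow> u \<in> space A \<Longrightarrow>
      G \<in> borel_measurable (hist_space S' A (Suc k)) \<Longrightarrow>
      (\<integral>\<^sup>+y. G (hist_ext k (\<Psi> k h) u y) \<partial>T' k (fst (\<Psi> k h) k, u)) =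
      (\<integral>\<^sup>+x. G (\<Psi> (Suc k) (hist_ext k h u x)) \<partial>T k (fst h k, u))"
    and k: "k \<le> N" and F: "F \<in> borel_measurable (hist_space S' A k)"
  shows "(\<integral>\<^sup>+h. F h \<partial>hist_law S' A T' p' s' k) = (\<integral>\<^sup>+h. F (\<Psi> k h) \<partial>hist_law S A T p s k)"
  using k F
proof (induction k arbitrary: F)
  case 0
  have "F \<circ> \<Psi> 0 \<in> borel_measurable (hist_space S A 0)"
    using \<Psi>[of 0] 0 by (auto intro: measurable_comp)
  then show ?case
    using controlled_process.nn_integral_hist_law_0[OF P, of "F \<circ> \<Psi> 0"]
      controlled_process.nn_integral_hist_law_0[OF P' 0(2)] init
    by (simp del: hist_law.simps)
next
  case (Suc k)
  then have k: "k < N" and m: "F \<circ> \<Psi> (Suc k) \<in> borel_measurable (hist_space S A (Suc k))"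
    using \<Psi> by (auto intro: measurable_comp)
  let ?G = "\<lambda>h. \<integral>\<^sup>+u. \<integral>\<^sup>+y. F (hist_ext k h u y) \<partial>T' k (fst h k, u) \<partial>p' k h"
  have "(\<integral>\<^sup>+h. F h \<partial>hist_law S' A T' p' s' (Suc k)) = (\<integral>\<^sup>+h. ?G h \<partial>hist_law S' A T' p' s' k)"
    by (rule controlled_process.nn_integral_hist_law_Suc[OF P' k Suc.prems(2)])
  also have "\<dots> = (\<integral>\<^sup>+h. ?G (\<Psi> k h) \<partial>hist_law S A T p s k)"
    using k by (intro Suc.IH controlled_process.nn_integral_step_measurable[OF P' k Suc.prems(2)]) simp
  also have "\<dots> = (\<integral>\<^sup>+h. \<integral>\<^sup>+u. \<integral>\<^sup>+x. F (\<Psi> (Suc k) (hist_ext k h u x)) \<partial>T k (fst h k, u) \<partial>p k h \<partial>hist_law S A T p s k)"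
  proof (rule nn_integral_cong)
    fix h assume "h \<in> space (hist_law S A T p s k)"
    then have h: "h \<in> space (hist_space S A k)"
      using controlled_process.space_hist_law[OF P, of k] k by auto
    show "?G (\<Psi> k h) = (\<integral>\<^sup>+u. \<integral>\<^sup>+x. F (\<Psi> (Suc k) (hist_ext k h u x)) \<partial>T k (fst h k, u) \<partial>p k h)"
      unfolding pol[OF k h]
      by (intro nn_integral_cong step[OF k h _ Suc.prems(2)])
         (simp add: controlled_process.policy_space[OF P k h])
  qed
  also have "\<dots> = (\<integral>\<^sup>+h. F (\<Psi> (Suc k) h) \<partial>hist_law S A T p s (Suc k))"
    using controlled_process.nn_integral_hist_law_Suc[OF P k m] by simp
  finally show ?case .
qed

section \<open>Augmented kernels and weak continuity\<close>

lemma sets_restrict_borel_pair: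
  fixes A :: "'a::second_countable_topology set" and B :: "'b::second_countable_topology set"
  shows "sets (restrict_space borel A \<Otimes>\<^sub>M restrict_space borel B) = sets (restrict_space borel (A \<times> B))"
    (is "sets ?P = sets ?R")
proof -
  have sp: "space ?P = A \<times> B" "space ?R = A \<times> B"
    by (auto simp: space_pair_measure space_restrict_space)
  have f: "fst \<in> ?R \<rightarrow>\<^sub>M restrict_space borel A" and g: "snd \<in> ?R \<rightarrow>\<^sub>M restrict_space borel B"
    by (rule measurable_restrict_space3; auto intro!: borel_measurable_continuous_onI continuous_intros)+
  have 1: "(\<lambda>x. x) \<in> ?R \<rightarrow>\<^sub>M ?P"
    using measurable_Pair[OF f g] by simp
  have idA: "(\<lambda>x. x) \<in> restrict_space borel A \<rightarrow>\<^sub>M borel" and idB: "(\<lambda>x. x) \<in> restrict_space borel B \<rightarrow>\<^sub>M borel"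
    by (simp_all add: measurable_restrict_space1)
  have "fst \<in> ?P \<rightarrow>\<^sub>M (borel :: 'a measure)"
    using measurable_compose[OF measurable_fst idA] .
  moreover have "snd \<in> ?P \<rightarrow>\<^sub>M (borel :: 'b measure)"
    using measurable_compose[OF measurable_snd idB] .
  ultimately have "(\<lambda>x. (fst x, snd x)) \<in> ?P \<rightarrow>\<^sub>M (borel :: 'a measure) \<Otimes>\<^sub>M (borel :: 'b measure)"
    by (rule measurable_Pair)
  then have "(\<lambda>x. x) \<in> ?P \<rightarrow>\<^sub>M (borel :: ('a \<times> 'b) measure)"
    by (simp only: borel_prod prod.collapse)
  then have 2: "(\<lambda>x. x) \<in> ?P \<rightarrow>\<^sub>M ?R"
    by (intro measurable_restrict_space2) (auto simp: sp)
  show ?thesis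
  proof (intro set_eqI iffI)
    fix C assume C: "C \<in> sets ?P"
    have "C \<subseteq> space ?R" using sets.sets_into_space[OF C] sp by simp
    then show "C \<in> sets ?R" using measurable_sets[OF 1 C] by (simp add: Int_absorb2)
  next
    fix C assume C: "C \<in> sets ?R"
    have "C \<subseteq> space ?P" using sets.sets_into_space[OF C] sp by simp
    then show "C \<in> sets ?P" using measurable_sets[OF 2 C] by (simp add: Int_absorb2)
  qed
qed

text \<open>The measurable setting suffices for translating between the two problems; compactness and
  continuity enter only in the extension of this locale below.\<close>

locale safety_process =
  fixes M :: "('x::polish_space, 'u::polish_space) mdp"
  assumes safety_mdp: "safety_mdp M"
begin

abbreviation N :: nat where "N \<equiv> horizon M"
abbreviation X :: "'x set" where "X \<equiv> states M"
abbreviation U :: "'u set" where "U \<equiv> inputs M"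
abbreviation Z :: "('x \<times> real) set" where "Z \<equiv> states M \<times> {0..}"

lemma horizon_pos: "1 \<le> N" using safety_mdp by (simp add: safety_mdp_def)

lemma space_BX[simp]: "space (BX M) = X" by (simp add: BX_def space_restrict_space)
lemma space_BU[simp]: "space (BU M) = U" by (simp add: BU_def space_restrict_space)
lemma space_BC[simp]: "space BC = {0..}" by (simp add: BC_def space_restrict_space)
lemma space_BZ[simp]: "space (BZ M) = Z" by (simp add: BZ_def space_pair_measure)

lemma sets_BZ: "sets (BZ M) = sets (restrict_space borel Z)"
  unfolding BZ_def BX_def BC_def by (rule sets_restrict_borel_pair)

lemma kern_measurable[measurable]: "kern M \<in> BX M \<Otimes>\<^sub>M BU M \<rightarrow>\<^sub>M prob_algebra (BX M)"
  using safety_mdp by (simp add: safety_mdp_def)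

lemma stage_cost_measurable[measurable]:
  "k < N \<Longrightarrow> stage_cost M k \<in> borel_measurable (BX M \<Otimes>\<^sub>M BU M)"
  using safety_mdp by (simp add: safety_mdp_def)

lemma stage_cost_nonneg: "k < N \<Longrightarrow> x \<in> X \<Longrightarrow> u \<in> U \<Longrightarrow> 0 \<le> stage_cost M k (x, u)"
  using safety_mdp by (simp add: safety_mdp_def)

lemma term_cost_measurable[measurable]: "term_cost M \<in> borel_measurable (BX M)"
  using safety_mdp by (simp add: safety_mdp_def)

lemma term_cost_nonneg: "x \<in> X \<Longrightarrow> 0 \<le> term_cost M x"
  using safety_mdp by (simp add: safety_mdp_def)

lemma safe_measurable[measurable]: "safe M \<in> sets (BX M)"
  using safety_mdp by (simp add: safety_mdp_def)

lemma kern_space: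
  assumes "x \<in> X" "u \<in> U"
  shows "sets (kern M (x, u)) = sets (BX M)" "space (kern M (x, u)) = X" "prob_space (kern M (x, u))"
  using measurable_space[OF kern_measurable, of "(x, u)"] assms
  by (auto simp: space_prob_algebra space_pair_measure dest: sets_eq_imp_space_eq)

lemma BZ_projections[measurable]:
  "fst \<in> BZ M \<rightarrow>\<^sub>M BX M" "snd \<in> BZ M \<rightarrow>\<^sub>M (borel :: real measure)"
  unfolding BZ_def BC_def by (simp, intro measurable_compose[OF measurable_snd] measurable_restrict_space1) simp

lemma safe_product_measurable[measurable]: "safe M \<times> {0..} \<in> sets (BZ M)"
  unfolding BZ_def BC_def by (intro pair_measureI) (auto simp: sets_restrict_space)

lemma cost_update_measurable:
  assumes "k < N"
  shows "(\<lambda>((x, c), u). c + stage_cost M k (x, u)) \<in> BZ M \<Otimes>\<^sub>M BU M \<rightarrow>\<^sub>M BC"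
proof -
  note stage_cost_measurable[OF assms, measurable]
  have "(\<lambda>w. snd (fst w) + stage_cost M k (fst (fst w), snd w)) \<in> borel_measurable (BZ M \<Otimes>\<^sub>M BU M)"
    by measurable
  then show ?thesis
    unfolding BC_def case_prod_beta'
    by (rule measurable_restrict_space2[rotated])
       (auto simp: space_pair_measure stage_cost_nonneg[OF assms])
qed

lemma kern_z_measurable[measurable]:
  assumes "k < N"
  shows "kern_z M k \<in> BZ M \<Otimes>\<^sub>M BU M \<rightarrow>\<^sub>M prob_algebra (BZ M)"
proof -
  have "(\<lambda>w. kern M (fst (fst w), snd w)) \<in> BZ M \<Otimes>\<^sub>M BU M \<rightarrow>\<^sub>M prob_algebra (BX M)"
    by measurable
  moreover have "(\<lambda>w. return BC (snd (fst w) + stage_cost M k (fst (fst w), snd w)))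
      \<in> BZ M \<Otimes>\<^sub>M BU M \<rightarrow>\<^sub>M prob_algebra BC"
    using measurable_compose[OF cost_update_measurable[OF assms] measurable_return_prob_space]
    by (simp add: case_prod_beta')
  ultimately show ?thesis
    unfolding kern_z_def case_prod_beta' BZ_def[of M] by (rule measurable_pair_prob)
qed

lemma append_cost_measurable: "c \<in> {0..} \<Longrightarrow> x \<in> X \<Longrightarrow> u \<in> U \<Longrightarrow> (\<lambda>y. (y, c)) \<in> kern M (x, u) \<rightarrow>\<^sub>M BZ M"
  unfolding BZ_def using kern_space by (auto intro!: measurable_Pair measurable_ident_sets)

text \<open>Given state and input, the cost coordinate moves deterministically, so the product kernel is an
  image of the original kernel.\<close>

lemma kern_z_eq_distr:
  assumes k: "k < N" and x: "x \<in> X" and c: "0 \<le> c" and u: "u \<in> U"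
  shows "kern_z M k ((x, c), u) = distr (kern M (x, u)) (BZ M) (\<lambda>y. (y, c + stage_cost M k (x, u)))"
    (is "?l = ?r")
proof -
  let ?c = "c + stage_cost M k (x, u)"
  have c': "?c \<in> {0..}" using c stage_cost_nonneg[OF k x u] by simp
  interpret R: prob_space "return BC ?c" using c' by (intro prob_space_return) simp
  have sets: "sets ?l = sets (BZ M)"
    unfolding kern_z_def BZ_def prod.case using kern_space[OF x u] by (intro sets_pair_measure_cong) auto
  show ?thesis
  proof (rule measure_eqI)
    show "sets ?l = sets ?r" using sets by simp
    fix B assume "B \<in> sets ?l"
    then have B: "B \<in> sets (kern M (x, u) \<Otimes>\<^sub>M return BC ?c)" "B \<in> sets (BZ M)"
      using sets by (auto simp: kern_z_def)
    have "emeasure ?l B = (\<integral>\<^sup>+y. emeasure (return BC ?c) (Pair y -` B) \<partial>kern M (x, u))"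
      unfolding kern_z_def using R.emeasure_pair_measure_alt[OF B(1)] by simp
    also have "\<dots> = (\<integral>\<^sup>+y. indicator ((\<lambda>y. (y, ?c)) -` B \<inter> space (kern M (x, u))) y \<partial>kern M (x, u))"
      by (intro nn_integral_cong)
         (use sets_Pair1[OF B(1)] in \<open>auto simp: indicator_def\<close>)
    also have "\<dots> = emeasure (kern M (x, u)) ((\<lambda>y. (y, ?c)) -` B \<inter> space (kern M (x, u)))"
      by (intro nn_integral_indicator measurable_sets[OF append_cost_measurable[OF c' x u] B(2)])
    also have "\<dots> = emeasure ?r B"
      using emeasure_distr[OF append_cost_measurable[OF c' x u] B(2)] by simp
    finally show "emeasure ?l B = emeasure ?r B" .
  qed
qed

lemma nn_integral_kern_z:
  assumes "k < N" "x \<in> X" "0 \<le> c" "u \<in> U" "G \<in> borel_measurable (BZ M)"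
  shows "(\<integral>\<^sup>+z. G z \<partial>kern_z M k ((x, c), u)) = (\<integral>\<^sup>+y. G (y, c + stage_cost M k (x, u)) \<partial>kern M (x, u))"
  using assms stage_cost_nonneg[of k x u]
  by (simp add: kern_z_eq_distr nn_integral_distr append_cost_measurable)

lemma kern_z_space:
  assumes "k < N" "z \<in> Z" "u \<in> U"
  shows "sets (kern_z M k (z, u)) = sets (BZ M)" "space (kern_z M k (z, u)) = Z" "prob_space (kern_z M k (z, u))"
  using measurable_space[OF kern_z_measurable[OF assms(1)], of "(z, u)"] assms
  by (auto simp: space_prob_algebra space_pair_measure dest: sets_eq_imp_space_eq)

end

locale continuous_safety_process = safety_process M
  for M :: "('x::polish_space, 'u::polish_space) mdp" +
  assumes compact_U: "compact (inputs M)" and U_nonempty: "inputs M \<noteq> {}"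
    and safe_closed: "closedin (top_of_set (states M)) (safe M)"
    and stage_cost_cont: "\<And>k. k < horizon M \<Longrightarrow> continuous_on (states M \<times> inputs M) (stage_cost M k)"
    and term_cost_cont: "continuous_on (states M) (term_cost M)"
    and weak: "weakly_continuous_kernel M"
begin

lemma borel_measurable_lsc_BZ: "lsc_on Z v \<Longrightarrow> v \<in> borel_measurable (BZ M)"
  using borel_measurable_lsc[of Z v] measurable_cong_sets[OF sets_BZ refl] by blast

lemma integrable_kern_z:
  fixes v :: "'x \<times> real \<Rightarrow> real"
  assumes "k < N" "z \<in> Z" "u \<in> U" "v \<in> borel_measurable (BZ M)" "\<And>z. z \<in> Z \<Longrightarrow> c \<le> v z \<and> v z \<le> d"
  shows "integrable (kern_z M k (z, u)) v"
proof -
  interpret prob_space "kern_z M k (z, u)" using kern_z_space assms by auto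
  show ?thesis
  proof (rule integrable_const_bound[where B="\<bar>c\<bar> + \<bar>d\<bar>"])
    show "AE z' in kern_z M k (z, u). norm (v z') \<le> \<bar>c\<bar> + \<bar>d\<bar>"
      using assms(5) kern_z_space[OF assms(1-3)] by (force intro!: AE_I2)
    show "v \<in> borel_measurable (kern_z M k (z, u))"
      using assms(4) kern_z_space(1)[OF assms(1-3)] by (simp cong: measurable_cong_sets)
  qed
qed

text \<open>Weak continuity handles test functions of the state alone, while the new cost coordinate
  \<open>c + stage_cost M k (x, u)\<close> varies with the argument. Freezing that coordinate at its limit costs
  at most the Lipschitz constant times its change, uniformly in the next state.\<close>

lemma continuous_on_kern_z_lip_env:
  assumes k: "k < N" and v: "lsc_on Z v" and bd: "\<And>z. z \<in> Z \<Longrightarrow> c \<le> v z \<and> v z \<le> d"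
  shows "continuous_on (Z \<times> U) (\<lambda>w. \<integral>z'. lip_env Z v m z' \<partial>kern_z M k w)"
proof -
  let ?v = "lip_env Z v m"
  let ?g = "\<lambda>w. \<integral>z'. ?v z' \<partial>kern_z M k w"
  let ?\<gamma> = "\<lambda>w. snd (fst w) + stage_cost M k (fst (fst w), snd w)"
  have vc: "continuous_on Z ?v" by (rule continuous_on_lip_env[OF v bd])
  have vm: "?v \<in> borel_measurable (BZ M)"
    using borel_measurable_lsc_BZ lsc_on_continuous[OF vc] by blast
  have vb: "z \<in> Z \<Longrightarrow> c \<le> ?v z \<and> ?v z \<le> d" for z by (rule lip_env_bounds[OF v bd])
  have \<gamma>c: "continuous_on (Z \<times> U) ?\<gamma>"
    by (intro continuous_intros continuous_on_compose2[OF stage_cost_cont[OF k]]) auto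
  have \<gamma>Z: "0 \<le> ?\<gamma> w" if "w \<in> Z \<times> U" for w
    using that stage_cost_nonneg[OF k] by (auto simp: add_nonneg_nonneg)
  have g: "?g w = (\<integral>y. ?v (y, ?\<gamma> w) \<partial>kern M (fst (fst w), snd w))" if w: "w \<in> Z \<times> U" for w
    using w \<gamma>Z[OF w] kern_z_eq_distr[OF k, of "fst (fst w)" "snd (fst w)" "snd w"] vm
      integral_distr[OF append_cost_measurable[of "?\<gamma> w" "fst (fst w)" "snd w"] vm]
    by (auto simp: mem_Times_iff)
  show ?thesis
    unfolding continuous_on_def
  proof
    fix w0 assume w0: "w0 \<in> Z \<times> U"
    define t where "t = ?\<gamma> w0"
    have t: "0 \<le> t" using \<gamma>Z[OF w0] by (simp add: t_def)
    let ?p = "\<lambda>w. \<integral>y. ?v (y, t) \<partial>kern M (fst (fst w), snd w)"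
    let ?e = "\<lambda>w. m * \<bar>?\<gamma> w - t\<bar> + \<bar>?p w - ?p w0\<bar>"
    have "continuous_on X (\<lambda>y. ?v (y, t))"
      using t by (intro continuous_on_compose2[OF vc] continuous_intros) auto
    moreover have "bounded ((\<lambda>y. ?v (y, t)) ` X)"
      unfolding bounded_iff
      using vb t by (intro exI[of _ "\<bar>c\<bar> + \<bar>d\<bar>"]) force
    ultimately have "continuous_on (X \<times> U) (\<lambda>w. \<integral>y. ?v (y, t) \<partial>kern M w)"
      using weak unfolding weakly_continuous_kernel_def by blast
    moreover have "continuous_on (Z \<times> U) (\<lambda>w. (fst (fst w), snd w))"
      by (intro continuous_intros)
    moreover have "(\<lambda>w. (fst (fst w), snd w)) ` (Z \<times> U) \<subseteq> X \<times> U" by auto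
    ultimately have pc: "continuous_on (Z \<times> U) ?p"
      using continuous_on_compose2 by blast
    have int: "integrable (kern M (x, u)) (\<lambda>y. ?v (y, s))" if "x \<in> X" "u \<in> U" "0 \<le> s" for x u s
    proof -
      interpret prob_space "kern M (x, u)" using kern_space that by auto
      show ?thesis
      proof (rule integrable_const_bound[where B="\<bar>c\<bar> + \<bar>d\<bar>"])
        show "AE y in kern M (x, u). norm (?v (y, s)) \<le> \<bar>c\<bar> + \<bar>d\<bar>"
          using vb kern_space(2)[OF that(1,2)] that(3) by (force intro!: AE_I2)
        show "(\<lambda>y. ?v (y, s)) \<in> borel_measurable (kern M (x, u))"
          using measurable_compose[OF append_cost_measurable vm] that by auto
      qed
    qed
    have le: "\<bar>?g w - ?g w0\<bar> \<le> ?e w" if w: "w \<in> Z \<times> U" for w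
    proof -
      obtain x c' u where w': "w = ((x, c'), u)" "x \<in> X" "u \<in> U" using w by (cases w) auto
      interpret prob_space "kern M (x, u)" using kern_space w' by auto
      have "\<bar>(\<integral>y. ?v (y, ?\<gamma> w) \<partial>kern M (x, u)) - (\<integral>y. ?v (y, t) \<partial>kern M (x, u))\<bar>
          = \<bar>\<integral>y. (?v (y, ?\<gamma> w) - ?v (y, t)) \<partial>kern M (x, u)\<bar>"
        using int[OF w'(2,3) \<gamma>Z[OF w]] int[OF w'(2,3) t] by simp
      also have "\<dots> \<le> (\<integral>y. \<bar>?v (y, ?\<gamma> w) - ?v (y, t)\<bar> \<partial>kern M (x, u))"
        by (rule integral_abs_bound)
      also have "\<dots> \<le> (\<integral>y. m * \<bar>?\<gamma> w - t\<bar> \<partial>kern M (x, u))"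
      proof (rule integral_mono)
        show "integrable (kern M (x, u)) (\<lambda>y. \<bar>?v (y, ?\<gamma> w) - ?v (y, t)\<bar>)"
          using int[OF w'(2,3) \<gamma>Z[OF w]] int[OF w'(2,3) t] by simp
        fix y assume "y \<in> space (kern M (x, u))"
        then have y: "(y, ?\<gamma> w) \<in> Z" "(y, t) \<in> Z"
          using kern_space(2)[OF w'(2,3)] \<gamma>Z[OF w] t by auto
        have "dist (y, ?\<gamma> w) (y, t) = \<bar>?\<gamma> w - t\<bar>"
          by (simp add: dist_Pair_Pair dist_real_def)
        then show "\<bar>?v (y, ?\<gamma> w) - ?v (y, t)\<bar> \<le> m * \<bar>?\<gamma> w - t\<bar>"
          using lip_env_lipschitz[OF v bd y, of m] lip_env_lipschitz[OF v bd y(2,1), of m]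
          by (simp add: abs_le_iff dist_commute)
      qed simp
      also have "\<dots> = m * \<bar>?\<gamma> w - t\<bar>" by (simp add: prob_space)
      finally have "\<bar>?g w - ?p w\<bar> \<le> m * \<bar>?\<gamma> w - t\<bar>" using g[OF w] w' by simp
      moreover have "?g w0 = ?p w0" using g[OF w0] by (simp add: t_def)
      ultimately show ?thesis by (smt (verit))
    qed
    have ec: "continuous_on (Z \<times> U) ?e" by (intro continuous_intros \<gamma>c pc)
    have "?e w0 = 0" by (simp add: t_def)
    with ec w0 have "(?e \<longlongrightarrow> 0) (at w0 within Z \<times> U)"
      unfolding continuous_on_def by (metis (no_types, lifting))
    then have "((\<lambda>w. ?g w - ?g w0) \<longlongrightarrow> 0) (at w0 within Z \<times> U)"
      by (rule Lim_null_comparison[rotated])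
         (use le in \<open>auto simp: eventually_at_filter\<close>)
    then show "(?g \<longlongrightarrow> ?g w0) (at w0 within Z \<times> U)"
      by (rule LIM_zero_cancel)
  qed
qed

text \<open>A bounded lower semicontinuous function is the increasing limit of its Lipschitz envelopes, and
  integration preserves this limit.\<close>

lemma lsc_on_kern_z:
  assumes k: "k < N" and v: "lsc_on Z v" and bd: "\<And>z. z \<in> Z \<Longrightarrow> c \<le> v z \<and> v z \<le> d"
  shows "lsc_on (Z \<times> U) (\<lambda>w. \<integral>z'. v z' \<partial>kern_z M k w)"
proof (rule lsc_on_incseq_limit)
  let ?v = "lip_env Z v"
  have vc: "continuous_on Z (?v m)" for m by (rule continuous_on_lip_env[OF v bd])
  have vm: "?v m \<in> borel_measurable (BZ M)" for m
    using borel_measurable_lsc_BZ lsc_on_continuous[OF vc] by blast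
  have vb: "z \<in> Z \<Longrightarrow> c \<le> ?v m z \<and> ?v m z \<le> d" for z m by (rule lip_env_bounds[OF v bd])
  show "lsc_on (Z \<times> U) (\<lambda>w. \<integral>z'. ?v m z' \<partial>kern_z M k w)" for m
    by (rule lsc_on_continuous[OF continuous_on_kern_z_lip_env[OF k v bd]])
  fix w assume "w \<in> Z \<times> U"
  then obtain z u where w: "w = (z, u)" "z \<in> Z" "u \<in> U" by auto
  note K = kern_z_space[OF k w(2,3)]
  have int: "integrable (kern_z M k w) (?v m)" for m
    unfolding w by (rule integrable_kern_z[OF k w(2,3) vm vb])
  show "incseq (\<lambda>n. \<integral>z'. ?v n z' \<partial>kern_z M k w)"
  proof (rule incseq_SucI, rule integral_mono)
    fix n z' assume "z' \<in> space (kern_z M k w)"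
    then show "?v n z' \<le> ?v (Suc n) z'"
      using incseq_SucD[OF lip_env_incseq[OF v bd]] K w by auto
  qed (rule int)+
  show "(\<lambda>n. \<integral>z'. ?v n z' \<partial>kern_z M k w) \<longlonglongrightarrow> (\<integral>z'. v z' \<partial>kern_z M k w)"
  proof (rule integral_dominated_convergence[where w="\<lambda>_. \<bar>c\<bar> + \<bar>d\<bar>"])
    interpret prob_space "kern_z M k w" using K w by simp
    show "integrable (kern_z M k w) (\<lambda>_. \<bar>c\<bar> + \<bar>d\<bar>)" by simp
    show "AE z' in kern_z M k w. (\<lambda>i. ?v i z') \<longlonglongrightarrow> v z'"
      using lip_env_tendsto[OF v bd] K w by (auto intro!: AE_I2)
    show "AE z' in kern_z M k w. norm (?v i z') \<le> \<bar>c\<bar> + \<bar>d\<bar>" for i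
      using vb[of _ i] K w by (force intro!: AE_I2)
    show "v \<in> borel_measurable (kern_z M k w)"
      using borel_measurable_lsc_BZ[OF v] K(1) w(1) by (simp cong: measurable_cong_sets)
    show "?v i \<in> borel_measurable (kern_z M k w)" for i
      using int by auto
  qed
qed

end

section \<open>Scalarized and lexicographic dynamic programming\<close>

lemma ennreal_linear_growth:
  fixes \<delta> :: real
  assumes "\<And>n::nat. ennreal (n * \<delta>) \<le> w" "w < \<infinity>"
  shows "\<delta> \<le> 0"
proof (rule ccontr)
  assume "\<not> ?thesis"
  then have \<delta>: "0 < \<delta>" by simp
  obtain r where r: "0 \<le> r" "w = ennreal r" using assms(2) by (cases w) auto
  obtain n where n: "r < real n * \<delta>" using reals_Archimedean3[OF \<delta>] by blast
  show False using assms(1)[of n] r n by (simp add: ennreal_le_iff)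
qed

context continuous_safety_process
begin

text \<open>Net cost of accepting in the final state \<open>z\<close>: cost weighted by \<open>a\<close> minus safety weighted by \<open>b\<close>.
  Keeping both weights homogeneous (instead of one multiplier) includes the pure safety problem
  \<open>a = 0\<close>.\<close>

definition gain :: "real \<Rightarrow> real \<Rightarrow> 'x \<times> real \<Rightarrow> real" where
  "gain a b z = a * (snd z + term_cost M (fst z)) - b * indicator (safe M \<times> {0..}) z"

abbreviation kz :: "nat \<Rightarrow> ('x \<times> real) \<times> 'u \<Rightarrow> ('x \<times> real) measure" where
  "kz m \<equiv> kern_z M (N - Suc m)"

text \<open>Dynamic programming for the scalarized problem, with \<open>m\<close> stages left, hence at stage \<open>N - m\<close>.
  Rejection is always available at the end, so \<open>V\<close> takes values in \<open>{- b..0}\<close> even though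
  the costs are unbounded.\<close>

primrec V :: "real \<Rightarrow> real \<Rightarrow> nat \<Rightarrow> 'x \<times> real \<Rightarrow> real" where
  "V a b 0 = (\<lambda>z. min 0 (gain a b z))"
| "V a b (Suc m) = (\<lambda>z. INF u\<in>U. \<integral>z'. V a b m z' \<partial>kz m (z, u))"

text \<open>Value of choosing input \<open>u\<close> in state \<open>z\<close> with \<open>Suc m\<close> stages left and continuing optimally.\<close>

definition Q :: "real \<Rightarrow> real \<Rightarrow> nat \<Rightarrow> ('x \<times> real) \<times> 'u \<Rightarrow> real" where
  "Q a b m w = (\<integral>z'. V a b m z' \<partial>kz m w)"

lemma stage_less: "m < N \<Longrightarrow> N - Suc m < N"
  using horizon_pos by simp

lemma gain_lower: "0 \<le> a \<Longrightarrow> 0 \<le> b \<Longrightarrow> z \<in> Z \<Longrightarrow> - b \<le> gain a b z"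
  using mult_nonneg_nonneg[of a "snd z + term_cost M (fst z)"] term_cost_nonneg[of "fst z"]
  by (auto simp: gain_def indicator_def mem_Times_iff intro: order_trans[of "- b" 0])

lemma gain_add: "gain (a + a') (b + b') z = gain a b z + gain a' b' z"
  by (simp add: gain_def algebra_simps)

lemma gain_scale: "gain (r * a) (r * b) z = r * gain a b z"
  by (simp add: gain_def algebra_simps)

lemma lsc_on_gain: "0 \<le> b \<Longrightarrow> lsc_on Z (gain a b)"
  unfolding gain_def
  by (intro lsc_on_continuous_minus_indicator continuous_intros continuous_on_compose2[OF term_cost_cont]
      closedin_Times safe_closed) auto

lemma V_lsc_bounds:
  assumes "0 \<le> a" "0 \<le> b"
  shows "m \<le> N \<Longrightarrow> lsc_on Z (V a b m) \<and> (\<forall>z\<in>Z. - b \<le> V a b m z \<and> V a b m z \<le> 0)"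
proof (induction m)
  case 0
  have "lsc_on Z (\<lambda>z. min 0 (gain a b z))"
    by (intro lsc_on_min lsc_on_gain lsc_on_continuous assms) auto
  then show ?case using gain_lower[OF assms] assms by simp
next
  case (Suc m)
  then have m: "m < N" and lsc: "lsc_on Z (V a b m)"
    and bd: "\<And>z. z \<in> Z \<Longrightarrow> - b \<le> V a b m z \<and> V a b m z \<le> 0" by auto
  note phi = lsc_on_kern_z[OF stage_less[OF m] lsc bd]
  have "- b \<le> V a b (Suc m) z \<and> V a b (Suc m) z \<le> 0" if z: "z \<in> Z" for z
  proof -
    obtain u where u: "u \<in> U" "V a b (Suc m) z = (\<integral>z'. V a b m z' \<partial>kz m (z, u))"
      using lsc_on_INF(2)[OF compact_U U_nonempty phi z] by auto
    interpret prob_space "kz m (z, u)" using kern_z_space[OF stage_less[OF m] z u(1)] by simp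
    note int = integrable_kern_z[OF stage_less[OF m] z u(1) borel_measurable_lsc_BZ[OF lsc] bd]
    show ?thesis
      unfolding u(2) using kern_z_space(2)[OF stage_less[OF m] z u(1)] bd
      by (intro conjI integral_ge_const integral_le_const int AE_I2) auto
  qed
  then show ?case using lsc_on_INF(1)[OF compact_U U_nonempty phi] by simp
qed

declare V.simps(1)[simp del] V.simps(2)[simp del]

lemma V_lower: "0 \<le> a \<Longrightarrow> 0 \<le> b \<Longrightarrow> m \<le> N \<Longrightarrow> z \<in> Z \<Longrightarrow> - b \<le> V a b m z"
  and V_upper: "0 \<le> a \<Longrightarrow> 0 \<le> b \<Longrightarrow> m \<le> N \<Longrightarrow> z \<in> Z \<Longrightarrow> V a b m z \<le> 0"
  and V_lsc: "0 \<le> a \<Longrightarrow> 0 \<le> b \<Longrightarrow> m \<le> N \<Longrightarrow> lsc_on Z (V a b m)"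
  using V_lsc_bounds by auto

lemma V_measurable: "0 \<le> a \<Longrightarrow> 0 \<le> b \<Longrightarrow> m \<le> N \<Longrightarrow> V a b m \<in> borel_measurable (BZ M)"
  by (intro borel_measurable_lsc_BZ V_lsc)

lemma Q_lsc:
  assumes "0 \<le> a" "0 \<le> b" "m < N"
  shows "lsc_on (Z \<times> U) (Q a b m)"
proof -
  have "m \<le> N" using assms by simp
  note * = assms(1,2) this
  show ?thesis
    unfolding Q_def[abs_def]
    using V_lower[OF *] V_upper[OF *]
    by (intro lsc_on_kern_z[OF stage_less[OF assms(3)] V_lsc[OF *], where c="- b" and d=0]) auto
qed

lemma V_Suc: "V a b (Suc m) z = (INF u\<in>U. Q a b m (z, u))"
  by (simp add: Q_def V.simps)

lemma V_attained: "0 \<le> a \<Longrightarrow> 0 \<le> b \<Longrightarrow> m < N \<Longrightarrow> z \<in> Z \<Longrightarrow> \<exists>u\<in>U. V a b (Suc m) z = Q a b m (z, u)"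
  unfolding V_Suc by (rule lsc_on_INF(2)[OF compact_U U_nonempty Q_lsc])

lemma V_le_Q: "0 \<le> a \<Longrightarrow> 0 \<le> b \<Longrightarrow> m < N \<Longrightarrow> z \<in> Z \<Longrightarrow> u \<in> U \<Longrightarrow> V a b (Suc m) z \<le> Q a b m (z, u)"
  unfolding V_Suc by (rule lsc_on_INF(3)[OF compact_U U_nonempty Q_lsc])

lemma V_integrable:
  assumes "0 \<le> a" "0 \<le> b" "m < N" "z \<in> Z" "u \<in> U"
  shows "integrable (kz m (z, u)) (V a b m)"
  using assms V_lower V_upper
  by (intro integrable_kern_z[OF stage_less, where c="- b" and d=0] V_measurable) auto

lemma nn_integral_V:
  assumes nn: "0 \<le> a" "0 \<le> b" and m: "m < N" and z: "z \<in> Z" and u: "u \<in> U"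
  shows "(\<integral>\<^sup>+z'. ennreal (V a b m z' + b) \<partial>kz m (z, u)) = ennreal (Q a b m (z, u) + b)"
proof -
  note K = kern_z_space[OF stage_less[OF m] z u]
  interpret prob_space "kz m (z, u)" by (rule K)
  note int = V_integrable[OF nn m z u]
  have "(\<integral>\<^sup>+z'. ennreal (V a b m z' + b) \<partial>kz m (z, u))
      = ennreal (\<integral>z'. V a b m z' + b \<partial>kz m (z, u))"
  proof (rule nn_integral_eq_integral)
    show "AE z' in kz m (z, u). 0 \<le> V a b m z' + b"
      using V_lower[OF nn, of m] m K(2) by (force intro!: AE_I2)
  qed (use int in simp)
  also have "(\<integral>z'. V a b m z' + b \<partial>kz m (z, u)) = Q a b m (z, u) + b"
    unfolding Q_def using int by (simp add: prob_space)
  finally show ?thesis .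
qed

text \<open>Inequalities between terminal gains, with nonnegative weights and a constant, propagate backwards
  through the minimizations. Homogeneity, monotonicity, superadditivity and Lipschitz dependence on
  the weights all follow from this.\<close>

lemma V_comparison:
  assumes nonneg: "0 \<le> a" "0 \<le> b" "0 \<le> a1" "0 \<le> b1" "0 \<le> a2" "0 \<le> b2" "0 \<le> r" "0 \<le> t"
    and base: "\<And>z. z \<in> Z \<Longrightarrow> r * V a1 b1 0 z + t * V a2 b2 0 z + d \<le> V a b 0 z"
  shows "m \<le> N \<Longrightarrow> z \<in> Z \<Longrightarrow> r * V a1 b1 m z + t * V a2 b2 m z + d \<le> V a b m z"
    and "m < N \<Longrightarrow> z \<in> Z \<Longrightarrow> u \<in> U \<Longrightarrow> r * Q a1 b1 m (z, u) + t * Q a2 b2 m (z, u) + d \<le> Q a b m (z, u)"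
proof -
  have Qstep: "r * Q a1 b1 m (z, u) + t * Q a2 b2 m (z, u) + d \<le> Q a b m (z, u)"
    if m: "m < N" and zu: "z \<in> Z" "u \<in> U"
      and IH: "\<And>z. z \<in> Z \<Longrightarrow> r * V a1 b1 m z + t * V a2 b2 m z + d \<le> V a b m z" for m z u
  proof -
    let ?K = "kz m (z, u)"
    note K = kern_z_space[OF stage_less[OF m] zu]
    interpret prob_space ?K by (rule K)
    note int = V_integrable[OF nonneg(1,2) m zu] V_integrable[OF nonneg(3,4) m zu] V_integrable[OF nonneg(5,6) m zu]
    have "r * Q a1 b1 m (z, u) + t * Q a2 b2 m (z, u) + d = (\<integral>z'. r * V a1 b1 m z' + t * V a2 b2 m z' + d \<partial>?K)"
      unfolding Q_def using int by (simp add: prob_space)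
    also have "\<dots> \<le> Q a b m (z, u)"
      unfolding Q_def using int IH K(2) by (intro integral_mono) auto
    finally show ?thesis .
  qed
  have main: "m \<le> N \<Longrightarrow> \<forall>z\<in>Z. r * V a1 b1 m z + t * V a2 b2 m z + d \<le> V a b m z" for m
  proof (induction m)
    case (Suc m)
    then have m: "m < N" by simp
    show ?case
    proof
      fix z assume z: "z \<in> Z"
      obtain u where u: "u \<in> U" "V a b (Suc m) z = Q a b m (z, u)"
        using V_attained[OF nonneg(1,2) m z] by blast
      have "r * V a1 b1 (Suc m) z + t * V a2 b2 (Suc m) z + d \<le> r * Q a1 b1 m (z, u) + t * Q a2 b2 m (z, u) + d"
        using nonneg by (intro add_right_mono add_mono mult_left_mono V_le_Q m z u)
      also have "\<dots> \<le> Q a b m (z, u)" by (rule Qstep[OF m z u(1)]) (use Suc m in auto)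
      finally show "r * V a1 b1 (Suc m) z + t * V a2 b2 (Suc m) z + d \<le> V a b (Suc m) z" using u by simp
    qed
  qed (use base in blast)
  then show "m \<le> N \<Longrightarrow> z \<in> Z \<Longrightarrow> r * V a1 b1 m z + t * V a2 b2 m z + d \<le> V a b m z" by blast
  show "m < N \<Longrightarrow> z \<in> Z \<Longrightarrow> u \<in> U \<Longrightarrow> r * Q a1 b1 m (z, u) + t * Q a2 b2 m (z, u) + d \<le> Q a b m (z, u)"
    using Qstep main by simp
qed

text \<open>Lexicographic value: the objective with weights \<open>(a, b)\<close> is minimized first, the one with weights
  \<open>(a', b')\<close> second. Scalarizing with weight \<open>n\<close> on the first objective and subtracting its optimal
  value leaves an increasing sequence. Adding \<open>b'\<close> makes it nonnegative. The limit is infinite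
  where no minimizer of the first objective has finite second objective.\<close>

definition W :: "real \<Rightarrow> real \<Rightarrow> real \<Rightarrow> real \<Rightarrow> nat \<Rightarrow> 'x \<times> real \<Rightarrow> ennreal" where
  "W a b a' b' m z = (SUP n. ennreal (V (real n * a + a') (real n * b + b') m z - real n * V a b m z + b'))"

text \<open>The selectors \<open>s m\<close> for \<open>Suc m\<close> remaining stages and the acceptance rule \<open>d\<close> do not increase the
  expected lexicographic value, and they conserve the value of the first objective wherever the
  lexicographic value is finite.\<close>

definition lex_optimal :: "real \<Rightarrow> real \<Rightarrow> real \<Rightarrow> real \<Rightarrow> (nat \<Rightarrow> 'x \<times> real \<Rightarrow> 'u) \<Rightarrow> ('x \<times> real \<Rightarrow> bool) \<Rightarrow> bool" where
  "lex_optimal a b a' b' s d \<longleftrightarrow>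
    (\<forall>m<N. s m \<in> BZ M \<rightarrow>\<^sub>M BU M) \<and> d \<in> BZ M \<rightarrow>\<^sub>M count_space UNIV \<and>
    (\<forall>m<N. \<forall>z\<in>Z. (\<integral>\<^sup>+z'. W a b a' b' m z' \<partial>kz m (z, s m z)) \<le> W a b a' b' (Suc m) z \<and>
       (W a b a' b' (Suc m) z < \<infinity> \<longrightarrow> Q a b m (z, s m z) \<le> V a b (Suc m) z)) \<and>
    (\<forall>z\<in>Z. ennreal ((if d z then gain a' b' z else 0) + b') \<le> W a b a' b' 0 z \<and>
       (W a b a' b' 0 z < \<infinity> \<longrightarrow> (if d z then gain a b z else 0) \<le> V a b 0 z))"

lemma W_measurable:
  "0 \<le> a \<Longrightarrow> 0 \<le> b \<Longrightarrow> 0 \<le> a' \<Longrightarrow> 0 \<le> b' \<Longrightarrow> m \<le> N \<Longrightarrow> W a b a' b' m \<in> borel_measurable (BZ M)"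
proof -
  assume *: "0 \<le> a" "0 \<le> b" "0 \<le> a'" "0 \<le> b'" "m \<le> N"
  have [measurable]: "V (real n * a + a') (real n * b + b') m \<in> borel_measurable (BZ M)"
    "V a b m \<in> borel_measurable (BZ M)" for n using * by (auto intro!: V_measurable)
  show ?thesis unfolding W_def by measurable
qed

text \<open>At each stage the objectives of weight \<open>n\<close>, minus \<open>n\<close> times the optimal first objective,
  increase with \<open>n\<close> and are lower semicontinuous in the input, so the compact selection for monotone
  limits applies. The final choice between accepting and rejecting is the same argument with two
  points. A bound uniform in \<open>n\<close> forces the excess in the first objective to vanish.\<close>

lemma lex_optimal_exists:
  assumes nn: "0 \<le> a" "0 \<le> b" "0 \<le> a'" "0 \<le> b'"
  shows "\<exists>s d. lex_optimal a b a' b' s d"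
proof -
  define an where "an n = real n * a + a'" for n
  define bn where "bn n = real n * b + b'" for n
  let ?W = "W a b a' b'"
  have nnn: "0 \<le> an n" "0 \<le> bn n" for n using nn by (auto simp: an_def bn_def)
  have W: "?W m z = (SUP n. ennreal (V (an n) (bn n) m z - n * V a b m z + b'))" for m z
    by (simp add: W_def an_def bn_def)
  have gn: "gain (an n) (bn n) z = n * gain a b z + gain a' b' z" for n z
    by (simp add: an_def bn_def gain_add gain_scale)
  have super0: "V (an n) (bn n) 0 z + V a b 0 z \<le> V (an (Suc n)) (bn (Suc n)) 0 z" for n z
    by (simp add: gn algebra_simps min_def V.simps)
  have low0: "n * V a b 0 z + V a' b' 0 z \<le> V (an n) (bn n) 0 z" for n z
  proof (induction n)
    case 0 then show ?case by (simp add: an_def bn_def)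
  next
    case (Suc n) then show ?case using super0[of n z] by (simp add: algebra_simps)
  qed
  have superV: "V (an n) (bn n) m z + V a b m z \<le> V (an (Suc n)) (bn (Suc n)) m z"
    if "m \<le> N" "z \<in> Z" for m z n
    using V_comparison(1)[OF nnn[of "Suc n"] nnn[of n] nn(1,2), of 1 1 0] super0 that by simp
  have superQ: "Q (an n) (bn n) m (z, u) + Q a b m (z, u) \<le> Q (an (Suc n)) (bn (Suc n)) m (z, u)"
    if "m < N" "z \<in> Z" "u \<in> U" for m z u n
    using V_comparison(2)[OF nnn[of "Suc n"] nnn[of n] nn(1,2), of 1 1 0] super0 that by simp
  have lowV: "n * V a b m z + V a' b' m z \<le> V (an n) (bn n) m z"
    if "m \<le> N" "z \<in> Z" for m z n
    using V_comparison(1)[OF nnn[of n] nn, of n 1 0] low0 that by simp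
  have lowQ: "n * Q a b m (z, u) + Q a' b' m (z, u) \<le> Q (an n) (bn n) m (z, u)"
    if "m < N" "z \<in> Z" "u \<in> U" for m z u n
    using V_comparison(2)[OF nnn[of n] nn, of n 1 0] low0 that by simp
  have "\<exists>s\<in>BZ M \<rightarrow>\<^sub>M BU M. \<forall>z\<in>Z. \<forall>n. ennreal (Q (an n) (bn n) m (z, s z) - n * V a b (Suc m) z + b') \<le> ?W (Suc m) z"
    if m: "m < N" for m
  proof -
    have "\<exists>s\<in>restrict_space borel Z \<rightarrow>\<^sub>M borel. \<forall>z\<in>Z. s z \<in> U \<and>
      (\<forall>n. ennreal (Q (an n) (bn n) m (z, s z) - (n * V a b (Suc m) z - b')) \<le>
        (SUP n. ennreal ((INF u\<in>U. Q (an n) (bn n) m (z, u)) - (n * V a b (Suc m) z - b'))))"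
    proof (rule monotone_limit_selection[OF compact_U U_nonempty])
      show "lsc_on (Z \<times> U) (Q (an n) (bn n) m)" for n by (rule Q_lsc[OF nnn m])
      have [measurable]: "V a b (Suc m) \<in> borel_measurable (restrict_space borel Z)"
        using V_lsc[OF nn(1,2)] m by (intro borel_measurable_lsc) simp
      show "(\<lambda>z. n * V a b (Suc m) z - b') \<in> borel_measurable (restrict_space borel Z)" for n :: nat
        by measurable
      fix z u and n :: nat assume zu: "z \<in> Z" "u \<in> U"
      show "Q (an n) (bn n) m (z, u) - (n * V a b (Suc m) z - b')
        \<le> Q (an (Suc n)) (bn (Suc n)) m (z, u) - (Suc n * V a b (Suc m) z - b')"
        using superQ[OF m zu, of n] V_le_Q[OF nn(1,2) m zu] by (simp add: algebra_simps)
    qed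
    then obtain s where s: "s \<in> restrict_space borel Z \<rightarrow>\<^sub>M borel"
      "\<And>z. z \<in> Z \<Longrightarrow> s z \<in> U" and le: "\<And>z n. z \<in> Z \<Longrightarrow> ennreal (Q (an n) (bn n) m (z, s z) - (n * V a b (Suc m) z - b')) \<le>
        (SUP n. ennreal ((INF u\<in>U. Q (an n) (bn n) m (z, u)) - (n * V a b (Suc m) z - b')))" by blast
    have "s \<in> BZ M \<rightarrow>\<^sub>M BU M"
      unfolding BU_def using s measurable_cong_sets[OF sets_BZ refl, of borel]
      by (intro measurable_restrict_space2) auto
    moreover have "ennreal (Q (an n) (bn n) m (z, s z) - n * V a b (Suc m) z + b') \<le> ?W (Suc m) z" if "z \<in> Z" for z n
      using le[OF that, of n] unfolding W V_Suc[of "an _"] by (simp add: algebra_simps)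
    ultimately show ?thesis by blast
  qed
  then have "\<forall>m. \<exists>s. m < N \<longrightarrow> s \<in> BZ M \<rightarrow>\<^sub>M BU M \<and> (\<forall>z\<in>Z. \<forall>n. ennreal (Q (an n) (bn n) m (z, s z) - n * V a b (Suc m) z + b') \<le> ?W (Suc m) z)"
    by blast
  then obtain s where s: "\<And>m. m < N \<Longrightarrow> s m \<in> BZ M \<rightarrow>\<^sub>M BU M" and
    sW: "\<And>m z n. m < N \<Longrightarrow> z \<in> Z \<Longrightarrow> ennreal (Q (an n) (bn n) m (z, s m z) - n * V a b (Suc m) z + b') \<le> ?W (Suc m) z"
    by metis
  have sU: "s m z \<in> U" if "m < N" "z \<in> Z" for m z
    using measurable_space[OF s[OF that(1)]] that(2) by simp
  define d where "d z \<longleftrightarrow> (\<forall>n. ennreal (gain (an n) (bn n) z - n * V a b 0 z + b') \<le> ?W 0 z)" for z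
  have dm: "d \<in> BZ M \<rightarrow>\<^sub>M count_space UNIV"
  proof -
    have [measurable]: "gain (an n) (bn n) \<in> borel_measurable (BZ M)" for n
      by (intro borel_measurable_lsc_BZ lsc_on_gain nnn)
    have [measurable]: "V a b 0 \<in> borel_measurable (BZ M)" by (rule V_measurable[OF nn(1,2)]) simp
    have [measurable]: "?W 0 \<in> borel_measurable (BZ M)" by (rule W_measurable[OF nn]) simp
    show ?thesis unfolding d_def by measurable
  qed
  have d0: "ennreal ((if d z then gain (an n) (bn n) z else 0) - n * V a b 0 z + b') \<le> ?W 0 z" for z n
  proof (cases "d z")
    case False
    then obtain n0 where n0: "?W 0 z < ennreal (gain (an n0) (bn n0) z - n0 * V a b 0 z + b')"
      unfolding d_def by (auto simp: not_le)
    define k where "k = max n n0"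
    have "real n0 * (gain a b z - V a b 0 z) \<le> real k * (gain a b z - V a b 0 z)"
      by (intro mult_right_mono) (auto simp: k_def V.simps)
    then have "gain (an n0) (bn n0) z - n0 * V a b 0 z \<le> gain (an k) (bn k) z - k * V a b 0 z"
      unfolding gn by (simp add: algebra_simps)
    then have 1: "?W 0 z < ennreal (gain (an k) (bn k) z - k * V a b 0 z + b')"
      using n0 by (elim less_le_trans) (simp add: ennreal_leI)
    have 2: "ennreal (V (an k) (bn k) 0 z - k * V a b 0 z + b') \<le> ?W 0 z"
      unfolding W by (rule SUP_upper) simp
    have "V (an k) (bn k) 0 z = 0"
      using 1 2 by (auto simp: min_def V.simps split: if_splits)
    then have "ennreal (0 - k * V a b 0 z + b') \<le> ?W 0 z" using 2 by simp
    moreover have "ennreal (0 - n * V a b 0 z + b') \<le> ennreal (0 - k * V a b 0 z + b')"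
      by (intro ennreal_leI add_right_mono diff_left_mono mult_right_mono_neg) (auto simp: k_def V.simps)
    ultimately show ?thesis using False by simp
  qed (simp add: d_def)
  have step: "(\<integral>\<^sup>+z'. ?W m z' \<partial>kz m (z, s m z)) \<le> ?W (Suc m) z" if m: "m < N" and z: "z \<in> Z" for m z
  proof -
    let ?e = "\<lambda>n z'. V (an n) (bn n) m z' - n * V a b m z' + b'"
    let ?K = "kz m (z, s m z)"
    note K = kern_z_space[OF stage_less[OF m] z sU[OF m z]]
    interpret prob_space ?K by (rule K)
    note int = V_integrable[OF nnn m z sU[OF m z]] V_integrable[OF nn(1,2) m z sU[OF m z]]
    have pos: "0 \<le> ?e n z'" if "z' \<in> Z" for n z'
      using lowV[of m z' n] V_lower[OF nn(3,4), of m z'] m that by simp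
    have "(\<integral>\<^sup>+z'. ?W m z' \<partial>?K) = (SUP n. \<integral>\<^sup>+z'. ennreal (?e n z') \<partial>?K)"
      unfolding W
    proof (rule nn_integral_monotone_convergence_SUP_AE)
      show "AE z' in ?K. ennreal (?e n z')
          \<le> ennreal (V (an (Suc n)) (bn (Suc n)) m z' - Suc n * V a b m z' + b')" for n
      proof (rule AE_I2, rule ennreal_leI)
        fix z' assume "z' \<in> space ?K"
        then show "?e n z'
          \<le> V (an (Suc n)) (bn (Suc n)) m z' - Suc n * V a b m z' + b'"
          using superV[of m z' n] m K(2) by (simp add: algebra_simps)
      qed
      show "(\<lambda>z'. ennreal (?e n z')) \<in> borel_measurable ?K" for n
        using int by (auto intro!: measurable_compose[OF _ measurable_ennreal] borel_measurable_add borel_measurable_diff borel_measurable_times)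
    qed
    also have "\<dots> \<le> ?W (Suc m) z"
    proof (rule SUP_least)
      fix n
      have "(\<integral>\<^sup>+z'. ennreal (?e n z') \<partial>?K) =
        ennreal (\<integral>z'. ?e n z' \<partial>?K)"
        using int pos K(2) by (intro nn_integral_eq_integral AE_I2) auto
      also have "(\<integral>z'. ?e n z' \<partial>?K)
        = Q (an n) (bn n) m (z, s m z) - n * Q a b m (z, s m z) + b'"
        unfolding Q_def using int by (simp add: prob_space)
      also have "ennreal \<dots> \<le> ennreal (Q (an n) (bn n) m (z, s m z) - n * V a b (Suc m) z + b')"
        using V_le_Q[OF nn(1,2) m z sU[OF m z]] by (intro ennreal_leI) (simp add: mult_left_mono)
      also have "\<dots> \<le> ?W (Suc m) z" by (rule sW[OF m z])
      finally show "(\<integral>\<^sup>+z'. ennreal (?e n z') \<partial>?K) \<le> ?W (Suc m) z" .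
    qed
    finally show ?thesis .
  qed
  have primary: "Q a b m (z, s m z) \<le> V a b (Suc m) z" if m: "m < N" and z: "z \<in> Z" and fin: "?W (Suc m) z < \<infinity>" for m z
  proof -
    have "ennreal (real n * (Q a b m (z, s m z) - V a b (Suc m) z)) \<le> ?W (Suc m) z" for n
    proof -
      have "- b' \<le> Q a' b' m (z, s m z)"
        using V_lower[OF nn(3,4), of "Suc m" z] V_le_Q[OF nn(3,4) m z sU[OF m z]] m z by simp
      then have "ennreal (real n * (Q a b m (z, s m z) - V a b (Suc m) z)) \<le> ennreal (Q (an n) (bn n) m (z, s m z) - n * V a b (Suc m) z + b')"
        using lowQ[OF m z sU[OF m z], of n] by (intro ennreal_leI) (simp add: algebra_simps)
      also have "\<dots> \<le> ?W (Suc m) z" by (rule sW[OF m z])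
      finally show ?thesis .
    qed
    from ennreal_linear_growth[OF this fin] show ?thesis by simp
  qed
  have final: "ennreal ((if d z then gain a' b' z else 0) + b') \<le> ?W 0 z" for z
    using d0[of z 0] by (simp add: an_def bn_def split: if_splits)
  have fprimary: "(if d z then gain a b z else 0) \<le> V a b 0 z" if z: "z \<in> Z" and fin: "?W 0 z < \<infinity>" for z
  proof -
    have "ennreal (real n * ((if d z then gain a b z else 0) - V a b 0 z)) \<le> ?W 0 z" for n
    proof -
      have "ennreal (real n * ((if d z then gain a b z else 0) - V a b 0 z)) \<le>
         ennreal ((if d z then gain (an n) (bn n) z else 0) - n * V a b 0 z + b')"
        using gain_lower[OF nn(3,4) z] nn(4) by (intro ennreal_leI) (simp add: gn algebra_simps)
      also have "\<dots> \<le> ?W 0 z" by (rule d0)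
      finally show ?thesis .
    qed
    from ennreal_linear_growth[OF this fin] show ?thesis by simp
  qed
  show ?thesis
    unfolding lex_optimal_def
    by (intro exI[of _ s] exI[of _ d]) (use s dm step primary final fprimary in blast)
qed

end

section \<open>Cost and safety of augmented policies\<close>

lemma coin_space:
  assumes "q \<in> space (prob_algebra (count_space {0, 1::nat}))"
  shows "sets q = Pow {0, 1}" "space q = {0, 1}" "prob_space q"
proof -
  have 1: "sets q = sets (count_space {0, 1})" and 2: "prob_space q"
    using assms unfolding space_prob_algebra by blast+
  show "sets q = Pow {0, 1}" using 1 unfolding sets_count_space .
  show "space q = {0, 1}" using sets_eq_imp_space_eq[OF 1] by simp
  show "prob_space q" by (rule 2)
qed

lemma nn_integral_coin:
  assumes "q \<in> space (prob_algebra (count_space {0, 1::nat}))" "f 0 = 0"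
  shows "(\<integral>\<^sup>+u. f u \<partial>q) = f 1 * ennreal (measure q {1})"
proof -
  note q = coin_space[OF assms(1)]
  interpret prob_space q by (rule q)
  have "(\<integral>\<^sup>+u. f u \<partial>q) = (\<integral>\<^sup>+u. f 1 * indicator {1} u \<partial>q)"
    using assms(2) by (intro nn_integral_cong) (auto simp: q indicator_def)
  also have "\<dots> = f 1 * emeasure q {1}"
    by (intro nn_integral_cmult_indicator) (simp add: q)
  finally show ?thesis by (simp add: emeasure_eq_measure)
qed

context safety_process
begin

lemma controlled_z:
  assumes x0: "x0 \<in> X" and pol: "(p, q) \<in> zpolicies M"
  shows "controlled_process (BZ M) (BU M) (kern_z M) p (x0, 0) N"
  using assms kern_z_measurable by unfold_locales (auto simp: zpolicies_def)

lemma controlled_x: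
  assumes x0: "x0 \<in> X" and pol: "p \<in> policies M"
  shows "controlled_process (BX M) (BU M) (\<lambda>_. kern M) p x0 N"
  using assms kern_measurable by unfold_locales (auto simp: policies_def)

abbreviation HZ :: "('x, 'u) zhist measure" where "HZ \<equiv> hist_space (BZ M) (BU M) N"

abbreviation LZ where "LZ x0 p \<equiv> hist_law (BZ M) (BU M) (kern_z M) p (x0, 0) N"

lemma
  assumes x0: "x0 \<in> X" and pol: "(p, q) \<in> zpolicies M"
  shows sets_law_z: "sets (law_z M x0 (p, q)) = sets (HZ \<Otimes>\<^sub>M count_space {0, 1} \<Otimes>\<^sub>M BZ M)"
    and nn_integral_law_z:
      "(\<lambda>(h, u, z'). F h u) \<in> borel_measurable (HZ \<Otimes>\<^sub>M count_space {0, 1} \<Otimes>\<^sub>M BZ M) \<Longrightarrow>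
       (\<integral>\<^sup>+(h, u, z'). F h u \<partial>law_z M x0 (p, q)) = (\<integral>\<^sup>+h. \<integral>\<^sup>+u. F h u \<partial>q h \<partial>LZ x0 p)"
proof -
  let ?C = "count_space {0, 1::nat}"
  let ?R = "HZ \<Otimes>\<^sub>M ?C \<Otimes>\<^sub>M BZ M"
  interpret P: controlled_process "BZ M" "BU M" "kern_z M" p "(x0, 0)" N by (rule controlled_z[OF x0 pol])
  have q: "q \<in> HZ \<rightarrow>\<^sub>M prob_algebra ?C" using pol by (simp add: zpolicies_def)
  have last: "fst h N \<in> space (BZ M)" if "h \<in> space HZ" for h
    using that by (rule P.hist_state_space) simp
  have inner: "kern_z_final M (fst h N, u) \<bind> (\<lambda>z'. return ?R (h, u, z')) = return ?R (h, u, fst h N)"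
    if "h \<in> space HZ" "u \<in> {0, 1}" for h u
    unfolding kern_z_final_def prod.case
    by (rule bind_return[where N="?R"])
       (use that last in \<open>auto intro!: measurable_compose[OF _ return_measurable] measurable_Pair\<close>)
  note qsp = coin_space[OF measurable_space[OF q]]
  have law: "law_z M x0 (p, q) = LZ x0 p \<bind> (\<lambda>h. q h \<bind> (\<lambda>u. return ?R (h, u, fst h N)))"
    unfolding law_z_def prod.case
    by (intro bind_cong refl inner) (use P.space_hist_law[of N] qsp(2) in auto)
  have m3: "(\<lambda>hu. (fst hu, snd hu, fst (fst hu) N)) \<in> HZ \<Otimes>\<^sub>M ?C \<rightarrow>\<^sub>M ?R"
    by (intro measurable_Pair measurable_compose[OF measurable_fst measurable_hist_state]) auto
  have m2: "(\<lambda>h. q h \<bind> (\<lambda>u. return ?R (h, u, fst h N))) \<in> HZ \<rightarrow>\<^sub>M prob_algebra ?R"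
    by (rule measurable_bind_prob_space2[OF q])
       (use measurable_compose[OF m3 measurable_return_prob_space] in \<open>simp add: case_prod_beta'\<close>)
  show "sets (law_z M x0 (p, q)) = sets ?R"
    unfolding law by (rule sets_bind'[OF P.hist_law_in_prob_algebra m2]) simp
  assume F: "(\<lambda>(h, u, z'). F h u) \<in> borel_measurable ?R"
  have "(\<integral>\<^sup>+w. (case w of (h, u, z') \<Rightarrow> F h u) \<partial>law_z M x0 (p, q)) =
      (\<integral>\<^sup>+h. \<integral>\<^sup>+w. (case w of (h, u, z') \<Rightarrow> F h u) \<partial>(q h \<bind> (\<lambda>u. return ?R (h, u, fst h N))) \<partial>LZ x0 p)"
    unfolding law
    by (rule nn_integral_bind[OF F])
       (use m2 P.sets_hist_law[of N] in \<open>auto intro!: measurable_prob_algebraD cong: measurable_cong_sets\<close>)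
  also have "\<dots> = (\<integral>\<^sup>+h. \<integral>\<^sup>+u. F h u \<partial>q h \<partial>LZ x0 p)"
  proof (rule nn_integral_cong)
    fix h assume "h \<in> space (LZ x0 p)"
    then have h: "h \<in> space HZ" using P.space_hist_law by auto
    have m: "(\<lambda>u. return ?R (h, u, fst h N)) \<in> q h \<rightarrow>\<^sub>M subprob_algebra ?R"
    proof -
      have "sets (q h) = sets ?C" using qsp(1)[OF h] unfolding sets_count_space .
      from measurable_compose[OF measurable_compose[OF measurable_Pair1'[OF h] m3] return_measurable]
      show ?thesis
        unfolding measurable_cong_sets[OF \<open>sets (q h) = sets ?C\<close> refl] fst_conv snd_conv .
    qed
    show "(\<integral>\<^sup>+w. (case w of (h, u, z') \<Rightarrow> F h u) \<partial>(q h \<bind> (\<lambda>u. return ?R (h, u, fst h N)))) = (\<integral>\<^sup>+u. F h u \<partial>q h)"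
      unfolding nn_integral_bind[OF F m]
    proof (rule nn_integral_cong)
      fix u assume "u \<in> space (q h)"
      then have "(h, u, fst h N) \<in> space ?R" using qsp(2)[OF h] h last[OF h] by (auto simp: space_pair_measure)
      from nn_integral_return[OF this F]
      show "(\<integral>\<^sup>+w. (case w of (h, u, z') \<Rightarrow> F h u) \<partial>return ?R (h, u, fst h N)) = F h u" by simp
    qed
  qed
  finally show "(\<integral>\<^sup>+(h, u, z'). F h u \<partial>law_z M x0 (p, q)) = (\<integral>\<^sup>+h. \<integral>\<^sup>+u. F h u \<partial>q h \<partial>LZ x0 p)" .
qed

lemma measurable_real_of_coin: "(\<lambda>(h, u, z'). real u) \<in> borel_measurable (HZ \<Otimes>\<^sub>M count_space {0, 1} \<Otimes>\<^sub>M BZ M)"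
  unfolding case_prod_beta'
  by (rule measurable_compose[OF measurable_compose[OF measurable_snd measurable_fst]]) simp

lemma last_cost_measurable[measurable]:
  "(\<lambda>h. snd (fst h N) + term_cost M (fst (fst h N))) \<in> borel_measurable HZ"
proof -
  have [measurable]: "(\<lambda>h. fst h N) \<in> HZ \<rightarrow>\<^sub>M BZ M" by (rule measurable_hist_state) simp
  show ?thesis by measurable
qed

lemma last_safe_measurable[measurable]:
  "(\<lambda>h. indicator (safe M \<times> {0..}) (fst h N) :: real) \<in> borel_measurable HZ"
  by (intro measurable_compose[OF measurable_hist_state] borel_measurable_indicator safe_product_measurable) auto

text \<open>The last input matters only through the probability of accepting.\<close>

lemma cost_Pz_eq:
  assumes x0: "x0 \<in> X" and pol: "(p, q) \<in> zpolicies M"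
  shows "cost_Pz M x0 (p, q) =
    (\<integral>\<^sup>+h. ennreal (measure (q h) {1} * (snd (fst h N) + term_cost M (fst (fst h N)))) \<partial>LZ x0 p)"
proof -
  interpret P: controlled_process "BZ M" "BU M" "kern_z M" p "(x0, 0)" N by (rule controlled_z[OF x0 pol])
  have q: "q \<in> HZ \<rightarrow>\<^sub>M prob_algebra (count_space {0, 1})" using pol by (simp add: zpolicies_def)
  have "(\<lambda>w. real (fst (snd w)) * (snd (fst (fst w) N) + term_cost M (fst (fst (fst w) N))))
      \<in> borel_measurable (HZ \<Otimes>\<^sub>M count_space {0, 1} \<Otimes>\<^sub>M BZ M)"
    using measurable_real_of_coin measurable_compose[OF measurable_fst last_cost_measurable]
    by (intro borel_measurable_times) (auto simp: case_prod_beta')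
  then have F: "(\<lambda>(h, u, z'). ennreal (final_cost M (fst h N) u)) \<in> borel_measurable (HZ \<Otimes>\<^sub>M count_space {0, 1} \<Otimes>\<^sub>M BZ M)"
    by (auto simp: final_cost_def case_prod_beta')
  show ?thesis
    unfolding cost_Pz_def nn_integral_law_z[OF x0 pol F]
  proof (rule nn_integral_cong)
    fix h assume "h \<in> space (LZ x0 p)"
    then have h: "h \<in> space HZ" using P.space_hist_law by auto
    have z: "fst h N \<in> Z" using P.hist_state_space[OF h order_refl] by simp
    then have "0 \<le> snd (fst h N) + term_cost M (fst (fst h N))"
      using term_cost_nonneg[of "fst (fst h N)"] by (auto simp: mem_Times_iff)
    then show "(\<integral>\<^sup>+u. ennreal (final_cost M (fst h N) u) \<partial>q h) =
      ennreal (measure (q h) {1} * (snd (fst h N) + term_cost M (fst (fst h N))))"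
      using nn_integral_coin[OF measurable_space[OF q h], of "\<lambda>u. ennreal (final_cost M (fst h N) u)"]
      by (simp add: final_cost_def case_prod_beta' ennreal_mult' mult.commute)
  qed
qed

lemma kernel_prob_le_1:
  assumes "q \<in> space (prob_algebra K)"
  shows "measure q B \<le> 1"
  using assms by (auto simp: space_prob_algebra intro: prob_space.prob_le_1)

lemma safety_Pz_eq:
  assumes x0: "x0 \<in> X" and pol: "(p, q) \<in> zpolicies M"
  shows "ennreal (safety_Pz M x0 (p, q)) =
      (\<integral>\<^sup>+h. ennreal (measure (q h) {1} * indicator (safe M \<times> {0..}) (fst h N)) \<partial>LZ x0 p)" (is "_ = ?I")
    and "0 \<le> safety_Pz M x0 (p, q)"
proof -
  interpret P: controlled_process "BZ M" "BU M" "kern_z M" p "(x0, 0)" N by (rule controlled_z[OF x0 pol])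
  interpret prob_space "LZ x0 p" by (rule P.prob_space_hist_law) simp
  have q: "q \<in> HZ \<rightarrow>\<^sub>M prob_algebra (count_space {0, 1})" using pol by (simp add: zpolicies_def)
  have F0: "(\<lambda>w. final_safety M (fst (fst w) N) (fst (snd w)))
      \<in> borel_measurable (HZ \<Otimes>\<^sub>M count_space {0, 1} \<Otimes>\<^sub>M BZ M)"
    unfolding final_safety_def
    using measurable_real_of_coin measurable_compose[OF measurable_fst last_safe_measurable]
    by (intro borel_measurable_times) (auto simp: case_prod_beta')
  then have F: "(\<lambda>(h, u, z'). ennreal (final_safety M (fst h N) u)) \<in> borel_measurable (HZ \<Otimes>\<^sub>M count_space {0, 1} \<Otimes>\<^sub>M BZ M)"
    by (auto simp: case_prod_beta')
  have I: "(\<integral>\<^sup>+(h, u, z'). ennreal (final_safety M (fst h N) u) \<partial>law_z M x0 (p, q)) = ?I"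
    unfolding nn_integral_law_z[OF x0 pol F]
  proof (rule nn_integral_cong)
    fix h assume "h \<in> space (LZ x0 p)"
    then have h: "h \<in> space HZ" using P.space_hist_law by auto
    show "(\<integral>\<^sup>+u. ennreal (final_safety M (fst h N) u) \<partial>q h) =
      ennreal (measure (q h) {1} * indicator (safe M \<times> {0..}) (fst h N))"
      using nn_integral_coin[OF measurable_space[OF q h], of "\<lambda>u. ennreal (final_safety M (fst h N) u)"]
      by (simp add: final_safety_def ennreal_mult' mult.commute)
  qed
  have "?I \<le> (\<integral>\<^sup>+h. 1 \<partial>LZ x0 p)"
  proof (rule nn_integral_mono)
    fix h assume "h \<in> space (LZ x0 p)"
    then have h: "h \<in> space HZ" using P.space_hist_law by auto
    show "ennreal (measure (q h) {1} * indicator (safe M \<times> {0..}) (fst h N)) \<le> 1"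
      using kernel_prob_le_1[OF measurable_space[OF q h], of "{1}"] by (auto simp: indicator_def)
  qed
  also have "\<dots> = 1" by (simp add: emeasure_space_1)
  finally have I1: "?I \<noteq> \<infinity>" by (auto simp: top_unique)
  have nonneg: "0 \<le> final_safety M z u" for z u by (simp add: final_safety_def)
  show "0 \<le> safety_Pz M x0 (p, q)"
    unfolding safety_Pz_def case_prod_beta' by (intro Bochner_Integration.integral_nonneg nonneg)
  have "(\<lambda>w. final_safety M (fst (fst w) N) (fst (snd w))) \<in> borel_measurable (law_z M x0 (p, q))"
    using F0 sets_law_z[OF x0 pol] by (simp cong: measurable_cong_sets)
  then have "safety_Pz M x0 (p, q) = enn2real ?I"
    unfolding I[symmetric] safety_Pz_def case_prod_beta'
    by (rule integral_eq_nn_integral) (simp add: nonneg)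
  then show "ennreal (safety_Pz M x0 (p, q)) = ?I" using I1 by (simp add: less_top)
qed

end

section \<open>Recording accumulated costs along histories\<close>

context safety_process
begin

definition augment :: "nat \<Rightarrow> ('x, 'u) hist \<Rightarrow> ('x, 'u) zhist" where
  "augment k h = ((\<lambda>i\<in>{..k}. (fst h i, \<Sum>j<i. stage_cost M j (fst h j, snd h j))), snd h)"

definition forget :: "nat \<Rightarrow> ('x, 'u) zhist \<Rightarrow> ('x, 'u) hist" where
  "forget k h = ((\<lambda>i\<in>{..k}. fst (fst h i)), snd h)"

abbreviation HX :: "nat \<Rightarrow> ('x, 'u) hist measure" where "HX k \<equiv> hist_space (BX M) (BU M) k"

lemma accumulated_cost_measurable:
  assumes k: "i \<le> k" "k \<le> N"
  shows "(\<lambda>h. \<Sum>j<i. stage_cost M j (fst h j, snd h j)) \<in> HX k \<rightarrow>\<^sub>M BC"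
  unfolding BC_def
proof (rule measurable_restrict_space2)
  show "(\<lambda>h. \<Sum>j<i. stage_cost M j (fst h j, snd h j)) \<in> borel_measurable (HX k)"
  proof (rule borel_measurable_sum)
    fix j assume "j \<in> {..<i}"
    then show "(\<lambda>h. stage_cost M j (fst h j, snd h j)) \<in> borel_measurable (HX k)"
      using k by (intro measurable_compose[OF _ stage_cost_measurable] measurable_Pair
        measurable_hist_state measurable_hist_input) auto
  qed
  show "(\<lambda>h. \<Sum>j<i. stage_cost M j (fst h j, snd h j)) \<in> space (HX k) \<rightarrow> {0..}"
    using k by (auto simp: space_hist_space PiE_iff intro!: sum_nonneg stage_cost_nonneg)
qed

lemma measurable_augment: "k \<le> N \<Longrightarrow> augment k \<in> HX k \<rightarrow>\<^sub>M hist_space (BZ M) (BU M) k"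
  unfolding augment_def[abs_def] BZ_def hist_space_def[of "BX M \<Otimes>\<^sub>M BC"]
  by (intro measurable_Pair measurable_restrict accumulated_cost_measurable measurable_hist_state)
     (auto simp: hist_space_def)

lemma measurable_forget: "forget k \<in> hist_space (BZ M) (BU M) k \<rightarrow>\<^sub>M HX k"
  unfolding forget_def[abs_def] hist_space_def[of "BX M"]
  by (intro measurable_Pair measurable_restrict measurable_compose[OF measurable_hist_state])
     (auto simp: hist_space_def intro: BZ_projections)

lemma forget_augment: "h \<in> space (HX k) \<Longrightarrow> forget k (augment k h) = h"
  by (cases h) (auto simp: forget_def augment_def space_hist_space PiE_iff extensional_def fun_eq_iff)

lemma augment_hist_ext:
  "hist_ext k (augment k h) u (y, snd (fst (augment k h) k) + stage_cost M k (fst h k, u))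
    = augment (Suc k) (hist_ext k h u y)"
  by (auto simp: augment_def hist_ext_def fun_eq_iff restrict_def intro!: sum.cong)

text \<open>The accumulated cost is a function of the history, so an augmented policy that agrees with the
  original one on histories with their true costs produces the image law.\<close>

lemma nn_integral_augment:
  assumes x0: "x0 \<in> X" and p: "p \<in> policies M" and pz: "(pz, q) \<in> zpolicies M"
    and eq: "\<And>k h. k < N \<Longrightarrow> h \<in> space (HX k) \<Longrightarrow> pz k (augment k h) = p k h"
    and F: "F \<in> borel_measurable HZ"
  shows "(\<integral>\<^sup>+h. F h \<partial>LZ x0 pz) = (\<integral>\<^sup>+h. F (augment N h) \<partial>law M x0 p)"
  unfolding law_def
proof (rule hist_law_image[OF controlled_x[OF x0 p] controlled_z[OF x0 pz] measurable_augment _ eq _ _ F])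
  show "augment 0 (\<lambda>i\<in>{0}. x0, \<lambda>_. undefined) = (\<lambda>i\<in>{0}. (x0, 0), \<lambda>_. undefined)"
    by (auto simp: augment_def fun_eq_iff)
  fix k h u and G :: "('x, 'u) zhist \<Rightarrow> ennreal"
  assume k: "k < N" and h: "h \<in> space (HX k)" and u: "u \<in> space (BU M)"
    and G: "G \<in> borel_measurable (hist_space (BZ M) (BU M) (Suc k))"
  have A: "augment k h \<in> space (hist_space (BZ M) (BU M) k)"
    using measurable_space[OF measurable_augment h] k by simp
  then have z: "fst (augment k h) k \<in> Z" by (auto simp: space_hist_space PiE_iff)
  have x: "fst (fst (augment k h) k) = fst h k" by (simp add: augment_def)
  have m: "(\<lambda>y. hist_ext k (augment k h) u y) \<in> BZ M \<rightarrow>\<^sub>M hist_space (BZ M) (BU M) (Suc k)"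
    using A u by (intro measurable_hist_ext) auto
  show "(\<integral>\<^sup>+y. G (hist_ext k (augment k h) u y) \<partial>kern_z M k (fst (augment k h) k, u)) =
    (\<integral>\<^sup>+x. G (augment (Suc k) (hist_ext k h u x)) \<partial>kern M (fst h k, u))"
    using nn_integral_kern_z[OF k, of "fst (fst (augment k h) k)" "snd (fst (augment k h) k)" u
        "\<lambda>y. G (hist_ext k (augment k h) u y)"] z u measurable_compose[OF m G]
    unfolding x augment_hist_ext by (cases "fst (augment k h) k") (use x in auto)
qed simp_all

text \<open>Since the unsafe state is absorbing, the product of the safety indicators along the path is
  almost surely the indicator of safety at the horizon. The proof propagates the integral of the
  indicator of an unsafe past with a safe present.\<close>

lemma safe_at_horizon:
  assumes x0: "x0 \<in> X" and p: "p \<in> policies M"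
  shows "AE h in law M x0 p. fst h N \<in> safe M \<longrightarrow> (\<forall>j\<le>N. fst h j \<in> safe M)"
proof -
  interpret P: controlled_process "BX M" "BU M" "\<lambda>_. kern M" p x0 N by (rule controlled_x[OF x0 p])
  define F :: "nat \<Rightarrow> ('x, 'u) hist \<Rightarrow> ennreal" where
    "F k h = (if fst h k \<in> safe M \<and> (\<exists>j\<le>k. fst h j \<notin> safe M) then 1 else 0)" for k h
  have pr[measurable]: "Measurable.pred (HX k) (\<lambda>h. fst h j \<in> safe M)" if "j \<le> k" for j k
    using measurable_hist_state[OF that, of "BX M" "BU M"] by measurable
  have pr_ex: "Measurable.pred (HX k) (\<lambda>h. \<exists>j\<le>k. fst h j \<notin> safe M)" for k
  proof -
    have "Measurable.pred (HX k) (\<lambda>h. \<exists>j\<in>{..k}. fst h j \<notin> safe M)"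
      by (intro pred_intros_finite) (auto intro!: pred_intros_logic pr)
    then show ?thesis by (simp add: Bex_def)
  qed
  have F[measurable]: "F k \<in> borel_measurable (HX k)" for k
    unfolding F_def using pr_ex by measurable
  have stay: "(\<integral>\<^sup>+y. indicator (safe M) y \<partial>kern M (x, u)) = 0" if "x \<in> X" "x \<notin> safe M" "u \<in> U" for x u
  proof -
    note K = kern_space[OF that(1,3)]
    interpret prob_space "kern M (x, u)" by (rule K)
    have x: "x = unsafe M" and one: "emeasure (kern M (x, u)) {unsafe M} = 1"
      and disj: "unsafe M \<notin> safe M"
      using safety_mdp that unfolding safety_mdp_def by auto
    have "emeasure (kern M (x, u)) ({unsafe M} \<union> safe M) = emeasure (kern M (x, u)) {unsafe M} + emeasure (kern M (x, u)) (safe M)"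
    proof (rule plus_emeasure[symmetric])
      show "{unsafe M} \<in> sets (kern M (x, u))" using one by (metis emeasure_neq_0_sets zero_neq_one)
    qed (use K(1) disj in auto)
    moreover have "emeasure (kern M (x, u)) ({unsafe M} \<union> safe M) \<le> 1"
      using emeasure_le_1 .
    ultimately have "1 + emeasure (kern M (x, u)) (safe M) \<le> 1 + 0" using one by simp
    then have "emeasure (kern M (x, u)) (safe M) = 0"
      by (subst (asm) ennreal_add_left_cancel_le) simp_all
    then show ?thesis using K(1) by simp
  qed
  have "k \<le> N \<Longrightarrow> (\<integral>\<^sup>+h. F k h \<partial>P.L k) = 0" for k
  proof (induction k)
    case 0
    then show ?case using P.nn_integral_hist_law_0[OF F] by (simp add: F_def)
  next
    case (Suc k)
    then have k: "k < N" by simp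
    have "(\<integral>\<^sup>+h. F (Suc k) h \<partial>P.L (Suc k)) =
      (\<integral>\<^sup>+h. \<integral>\<^sup>+u. \<integral>\<^sup>+y. F (Suc k) (hist_ext k h u y) \<partial>kern M (fst h k, u) \<partial>p k h \<partial>P.L k)"
      by (rule P.nn_integral_hist_law_Suc[OF k F])
    also have "\<dots> \<le> (\<integral>\<^sup>+h. F k h \<partial>P.L k)"
    proof (rule nn_integral_mono)
      fix h assume "h \<in> space (P.L k)"
      then have h: "h \<in> space (HX k)" using P.space_hist_law k by auto
      have x: "fst h k \<in> X" using P.hist_state_space[OF h order_refl] by simp
      interpret prob_space "p k h" by (rule P.policy_space[OF k h])
      have "(\<integral>\<^sup>+u. \<integral>\<^sup>+y. F (Suc k) (hist_ext k h u y) \<partial>kern M (fst h k, u) \<partial>p k h) \<le> (\<integral>\<^sup>+u. F k h \<partial>p k h)"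
      proof (rule nn_integral_mono)
        fix u assume "u \<in> space (p k h)"
        then have u: "u \<in> U" using P.policy_space[OF k h] by simp
        interpret K: prob_space "kern M (fst h k, u)" using kern_space[OF x u] by simp
        show "(\<integral>\<^sup>+y. F (Suc k) (hist_ext k h u y) \<partial>kern M (fst h k, u)) \<le> F k h"
        proof (cases "fst h k \<in> safe M")
          case True
          have "(\<integral>\<^sup>+y. F (Suc k) (hist_ext k h u y) \<partial>kern M (fst h k, u)) \<le> (\<integral>\<^sup>+y. F k h \<partial>kern M (fst h k, u))"
            by (intro nn_integral_mono) (use True in \<open>auto simp: F_def hist_ext_def le_Suc_eq split: if_splits\<close>)
          then show ?thesis by (simp add: K.emeasure_space_1)
        next
          case False
          have "(\<integral>\<^sup>+y. F (Suc k) (hist_ext k h u y) \<partial>kern M (fst h k, u)) \<le> (\<integral>\<^sup>+y. indicator (safe M) y \<partial>kern M (fst h k, u))"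
            by (intro nn_integral_mono) (auto simp: F_def hist_ext_def indicator_def)
          then show ?thesis using stay[OF x False u] by simp
        qed
      qed
      then show "(\<integral>\<^sup>+u. \<integral>\<^sup>+y. F (Suc k) (hist_ext k h u y) \<partial>kern M (fst h k, u) \<partial>p k h) \<le> F k h"
        by (simp add: emeasure_space_1)
    qed
    finally show ?case using Suc by simp
  qed
  from this[OF order_refl] have "AE h in P.L N. F N h = 0"
    using P.sets_hist_law[of N] by (subst (asm) nn_integral_0_iff_AE) (auto cong: measurable_cong_sets)
  then show ?thesis
    unfolding law_def by eventually_elim (auto simp: F_def split: if_splits)
qed

text \<open>Both translations of policies between the two problems are instances of this statement.\<close>

lemma transfer:
  assumes x0: "x0 \<in> X" and p: "p \<in> policies M" and pz: "(pz, q) \<in> zpolicies M"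
    and a: "a \<in> borel_measurable (HX N)"
    and eqp: "\<And>k h. k < N \<Longrightarrow> h \<in> space (HX k) \<Longrightarrow> pz k (augment k h) = p k h"
    and eqa: "\<And>h. h \<in> space (HX N) \<Longrightarrow> measure (q (augment N h)) {1} = a h"
  shows "cost_P M x0 (p, a) = cost_Pz M x0 (pz, q)"
    and "safety_P M x0 (p, a) = safety_Pz M x0 (pz, q)"
proof -
  interpret P: controlled_process "BX M" "BU M" "\<lambda>_. kern M" p x0 N by (rule controlled_x[OF x0 p])
  have sp: "space (law M x0 p) = space (HX N)" and st: "sets (law M x0 p) = sets (HX N)"
    unfolding law_def using P.space_hist_law[of N] P.sets_hist_law[of N] by auto
  have q: "q \<in> HZ \<rightarrow>\<^sub>M prob_algebra (count_space {0, 1})" using pz by (simp add: zpolicies_def)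
  have mq[measurable]: "(\<lambda>h. measure (q h) {1}) \<in> borel_measurable HZ"
    by (rule measurable_compose[OF q measurable_measure_prob_algebra]) simp
  have last: "fst (augment N h) N = (fst h N, \<Sum>j<N. stage_cost M j (fst h j, snd h j))" for h
    by (simp add: augment_def)
  have "cost_Pz M x0 (pz, q) = (\<integral>\<^sup>+h. ennreal (measure (q (augment N h)) {1} *
      (snd (fst (augment N h) N) + term_cost M (fst (fst (augment N h) N)))) \<partial>law M x0 p)"
    unfolding cost_Pz_eq[OF x0 pz]
    by (rule nn_integral_augment[OF x0 p pz eqp])
       (auto intro!: measurable_compose[OF _ measurable_ennreal] borel_measurable_times mq[simplified] last_cost_measurable)
  also have "\<dots> = cost_P M x0 (p, a)"
    unfolding cost_P_def prod.case
    by (intro nn_integral_cong) (use eqa in \<open>simp add: sp last add.commute\<close>)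
  finally show "cost_P M x0 (p, a) = cost_Pz M x0 (pz, q)" by simp
  let ?I = "\<integral>\<^sup>+h. ennreal (a h * (\<Prod>k\<le>N. indicator (safe M) (fst h k))) \<partial>law M x0 p"
  have nn: "0 \<le> a h" if "h \<in> space (HX N)" for h using eqa[OF that] by (metis measure_nonneg)
  have "ennreal (safety_Pz M x0 (pz, q)) = (\<integral>\<^sup>+h. ennreal (measure (q (augment N h)) {1} *
      indicator (safe M \<times> {0..}) (fst (augment N h) N)) \<partial>law M x0 p)"
    unfolding safety_Pz_eq[OF x0 pz]
    by (rule nn_integral_augment[OF x0 p pz eqp])
       (auto intro!: measurable_compose[OF _ measurable_ennreal] borel_measurable_times mq[simplified] last_safe_measurable)
  also have "\<dots> = ?I"
  proof (rule nn_integral_cong_AE)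
    have "AE h in law M x0 p. h \<in> space (HX N)" using sp AE_space by metis
    with safe_at_horizon[OF x0 p]
    show "AE h in law M x0 p. ennreal (measure (q (augment N h)) {1} *
      indicator (safe M \<times> {0..}) (fst (augment N h) N)) = ennreal (a h * (\<Prod>k\<le>N. indicator (safe M) (fst h k)))"
    proof eventually_elim
      fix h assume s: "fst h N \<in> safe M \<longrightarrow> (\<forall>j\<le>N. fst h j \<in> safe M)" and h: "h \<in> space (HX N)"
      have "fst (augment N h) N \<in> Z"
        using measurable_space[OF measurable_augment h] by (auto simp: space_hist_space PiE_iff)
      then have "(0::real) \<le> (\<Sum>j<N. stage_cost M j (fst h j, snd h j))" by (simp add: last)
      moreover have "(\<Prod>k\<le>N. indicator (safe M) (fst h k)) = (indicator (safe M) (fst h N) :: real)"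
        using s by (cases "fst h N \<in> safe M") (auto intro!: prod_zero prod.neutral bexI[of _ N])
      ultimately show "ennreal (measure (q (augment N h)) {1} *
        indicator (safe M \<times> {0..}) (fst (augment N h) N)) = ennreal (a h * (\<Prod>k\<le>N. indicator (safe M) (fst h k)))"
        using eqa[OF h] by (simp add: last indicator_def)
    qed
  qed
  finally have I: "ennreal (safety_Pz M x0 (pz, q)) = ?I" .
  have "(\<lambda>h. indicator (safe M) (fst h k) :: real) \<in> borel_measurable (HX N)" if "k \<le> N" for k
    using that by (intro measurable_compose[OF measurable_hist_state] borel_measurable_indicator) auto
  then have "(\<lambda>h. a h * (\<Prod>k\<le>N. indicator (safe M) (fst h k))) \<in> borel_measurable (law M x0 p)"
    unfolding measurable_cong_sets[OF st refl] by (intro borel_measurable_times a borel_measurable_prod) auto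
  then have "safety_P M x0 (p, a) = enn2real ?I"
    unfolding safety_P_def prod.case
    by (rule integral_eq_nn_integral) (use nn sp in \<open>auto intro!: AE_I2 mult_nonneg_nonneg prod_nonneg\<close>)
  then show "safety_P M x0 (p, a) = safety_Pz M x0 (pz, q)"
    using safety_Pz_eq(2)[OF x0 pz] by (simp flip: I)
qed

end

section \<open>Equivalence of the two problems\<close>

definition coin :: "real \<Rightarrow> nat measure" where
  "coin r = point_measure {0, 1} (\<lambda>u. ennreal (if u = 1 then r else 1 - r))"

lemma measure_coin: "0 \<le> r \<Longrightarrow> measure (coin r) {1} = r"
  unfolding coin_def measure_def by (subst emeasure_point_measure_finite) auto

lemma measurable_coin: "coin \<in> restrict_space borel {0..1} \<rightarrow>\<^sub>M prob_algebra (count_space {0, 1})"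
proof (rule measurable_prob_algebraI)
  have e: "emeasure (coin r) A = (\<Sum>u\<in>A. ennreal (if u = 1 then r else 1 - r))" if "A \<subseteq> {0, 1}" for r A
    unfolding coin_def using that by (intro emeasure_point_measure_finite) auto
  show p: "prob_space (coin r)" if "r \<in> space (restrict_space borel {0..1})" for r
    using that e[of "{0, 1}" r]
    by (intro prob_spaceI) (auto simp: coin_def space_point_measure space_restrict_space simp flip: ennreal_plus)
  show "coin \<in> restrict_space borel {0..1} \<rightarrow>\<^sub>M subprob_algebra (count_space {0, 1})"
  proof (rule measurable_subprob_algebra)
    show "subprob_space (coin r)" if "r \<in> space (restrict_space borel {0..1})" for r
      using p[OF that] by (rule prob_space_imp_subprob_space)
    show "sets (coin r) = sets (count_space {0, 1})" for r
      by (simp add: coin_def sets_point_measure)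
    fix A assume "A \<in> sets (count_space {0, 1::nat})"
    then have A: "A \<subseteq> {0, 1}" by simp
    show "(\<lambda>r. emeasure (coin r) A) \<in> borel_measurable (restrict_space borel {0..1})"
      unfolding e[OF A] by (intro borel_measurable_sum measurable_restrict_space1) measurable
  qed
qed

context safety_process
begin

text \<open>Forget the cost coordinates and accept with the probability prescribed by the decision.\<close>

lemma decision_to_zpolicy:
  assumes x0: "x0 \<in> X" and d: "(p, a) \<in> feasible_P M \<alpha> x0"
  shows "\<exists>\<pi>\<in>feasible_Pz M \<alpha> x0. cost_Pz M x0 \<pi> = cost_P M x0 (p, a)"
proof -
  have p: "p \<in> policies M" and a: "a \<in> HX N \<rightarrow>\<^sub>M restrict_space borel {0..1}"
    and s: "\<alpha> \<le> safety_P M x0 (p, a)" using d by (auto simp: feasible_P_def)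
  define pz where "pz k h = p k (forget k h)" for k h
  define q where "q h = coin (a (forget N h))" for h
  have z: "(pz, q) \<in> zpolicies M"
    using p measurable_compose[OF measurable_compose[OF measurable_forget a] measurable_coin]
    by (auto simp: zpolicies_def policies_def pz_def[abs_def] q_def[abs_def] intro: measurable_compose[OF measurable_forget])
  have ab: "a \<in> borel_measurable (HX N)"
    using a by (simp add: measurable_restrict_space2_iff)
  have a0: "0 \<le> a h" if "h \<in> space (HX N)" for h
    using measurable_space[OF a that] by (simp add: space_restrict_space)
  note tr = transfer[OF x0 p z ab]
  have "cost_P M x0 (p, a) = cost_Pz M x0 (pz, q)" "safety_P M x0 (p, a) = safety_Pz M x0 (pz, q)"
    by (intro tr; simp add: pz_def q_def forget_augment measure_coin[simplified] a0)+
  then show ?thesis using z s by (auto simp: feasible_Pz_def)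
qed

lemma markov_to_decision:
  assumes x0: "x0 \<in> X" and \<pi>: "\<pi> \<in> feasible_Pz M \<alpha> x0" and mk: "markov_via M \<pi> \<mu> \<nu>"
  defines "d \<equiv> (\<lambda>k h. \<mu> k (fst h k, \<Sum>j<k. stage_cost M j (fst h j, snd h j)),
      \<lambda>h. measure (\<nu> (fst h N, \<Sum>j<N. stage_cost M j (fst h j, snd h j))) {1})"
  shows "d \<in> feasible_P M \<alpha> x0" and "cost_P M x0 d = cost_Pz M x0 \<pi>"
proof -
  obtain p q where pq: "\<pi> = (p, q)" by (cases \<pi>)
  define p' where "p' = (\<lambda>k (h::('x, 'u) hist). \<mu> k (fst h k, \<Sum>j<k. stage_cost M j (fst h j, snd h j)))"
  define a where "a = (\<lambda>h::('x, 'u) hist. measure (\<nu> (fst h N, \<Sum>j<N. stage_cost M j (fst h j, snd h j))) {1})"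
  have d: "d = (p', a)" by (simp add: d_def p'_def a_def)
  have z: "(p, q) \<in> zpolicies M" and s: "\<alpha> \<le> safety_Pz M x0 (p, q)"
    using \<pi> by (auto simp: pq feasible_Pz_def)
  have q: "q \<in> HZ \<rightarrow>\<^sub>M prob_algebra (count_space {0, 1})" using z by (simp add: zpolicies_def)
  have aug: "augment k h \<in> space (hist_space (BZ M) (BU M) k)" if "k \<le> N" "h \<in> space (HX k)" for k h
    using measurable_space[OF measurable_augment] that by blast
  have eqp: "p k (augment k h) = p' k h" if "k < N" "h \<in> space (HX k)" for k h
    using mk aug[of k h] that by (simp add: markov_via_def pq p'_def augment_def)
  have eqa: "measure (q (augment N h)) {1} = a h" if "h \<in> space (HX N)" for h
    using mk aug[of N h] that by (simp add: markov_via_def pq a_def augment_def)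
  have p': "p' \<in> policies M"
    unfolding policies_def
  proof (intro CollectI allI impI)
    fix k assume k: "k < N"
    have "(\<lambda>h. p k (augment k h)) \<in> HX k \<rightarrow>\<^sub>M prob_algebra (BU M)"
      using z k by (intro measurable_compose[OF measurable_augment]) (auto simp: zpolicies_def)
    then show "p' k \<in> HX k \<rightarrow>\<^sub>M prob_algebra (BU M)"
      by (rule measurable_cong[THEN iffD1, rotated]) (rule eqp[OF k])
  qed
  have "(\<lambda>h. measure (q (augment N h)) {1}) \<in> borel_measurable (HX N)"
    by (rule measurable_compose[OF measurable_compose[OF measurable_augment q] measurable_measure_prob_algebra]) auto
  then have a: "a \<in> borel_measurable (HX N)"
    by (rule measurable_cong[THEN iffD1, rotated]) (rule eqa)
  have a01: "a h \<in> {0..1}" if "h \<in> space (HX N)" for h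
    unfolding eqa[OF that, symmetric]
    using kernel_prob_le_1[OF measurable_space[OF q aug[OF order_refl that]]] by auto
  note tr = transfer[OF x0 p' z a eqp eqa]
  show "cost_P M x0 d = cost_Pz M x0 \<pi>" using tr(1) by (simp add: d pq)
  show "d \<in> feasible_P M \<alpha> x0"
    unfolding feasible_P_def d
    using p' tr(2) s a a01 by (auto intro!: measurable_restrict_space2)
qed

text \<open>The translated decision costs as much as the policy, and every decision is matched by a feasible
  policy of the augmented problem.\<close>

lemma optimal_decision:
  assumes x0: "x0 \<in> X" and opt: "optimal_Pz M \<alpha> x0 \<pi>" and mk: "markov_via M \<pi> \<mu> \<nu>"
  shows "optimal_P M \<alpha> x0
     (\<lambda>k h. \<mu> k (fst h k, \<Sum>j<k. stage_cost M j (fst h j, snd h j)),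
      \<lambda>h. measure (\<nu> (fst h N, \<Sum>j<N. stage_cost M j (fst h j, snd h j))) {1})" (is "optimal_P M \<alpha> x0 ?d")
proof -
  have \<pi>: "\<pi> \<in> feasible_Pz M \<alpha> x0" and min: "cost_Pz M x0 \<pi> = (INF \<pi>'\<in>feasible_Pz M \<alpha> x0. cost_Pz M x0 \<pi>')"
    using opt by (auto simp: optimal_Pz_def)
  note d = markov_to_decision[OF x0 \<pi> mk]
  have "cost_P M x0 ?d \<le> cost_P M x0 d'" if d': "d' \<in> feasible_P M \<alpha> x0" for d'
  proof -
    obtain p a where pa: "d' = (p, a)" by (cases d')
    with decision_to_zpolicy[OF x0, of p a \<alpha>] d' obtain \<pi>'
      where "\<pi>' \<in> feasible_Pz M \<alpha> x0" "cost_Pz M x0 \<pi>' = cost_P M x0 d'" by auto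
    then show ?thesis unfolding d(2) min by (metis INF_lower)
  qed
  then show ?thesis
    unfolding optimal_P_def using d(1) by (auto intro!: antisym INF_greatest INF_lower)
qed

lemma feasible_P_inputs_nonempty:
  assumes x0: "x0 \<in> X" and "feasible_P M \<alpha> x0 \<noteq> {}"
  shows "U \<noteq> {}"
proof -
  obtain p where p: "p \<in> policies M" using assms(2) by (auto simp: feasible_P_def)
  interpret P: controlled_process "BX M" "BU M" "\<lambda>_. kern M" p x0 N by (rule controlled_x[OF x0 p])
  have "prob_space (p 0 (\<lambda>i\<in>{0}. x0, \<lambda>_. undefined))" "space (p 0 (\<lambda>i\<in>{0}. x0, \<lambda>_. undefined)) = U"
    using P.policy_space[OF _ P.init_in_space] horizon_pos by auto
  then show ?thesis using prob_space.not_empty by metis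
qed

end

section \<open>Weak duality and mixed Markov policies\<close>

context continuous_safety_process
begin

text \<open>Along any history-dependent policy the process \<open>V a b (N - k) z\<^sub>k\<close> is a submartingale.\<close>

lemma V_lower_bound_law:
  assumes x0: "x0 \<in> X" and pol: "(p, q) \<in> zpolicies M" and nn: "0 \<le> a" "0 \<le> b"
  shows "ennreal (V a b N (x0, 0) + b) \<le>
    (\<integral>\<^sup>+h. ennreal (measure (q h) {1} * gain a b (fst h N) + b) \<partial>LZ x0 p)"
proof -
  let ?v = "\<lambda>k h. ennreal (V a b (N - k) (fst h k) + b)"
  let ?r = "\<lambda>k h u. \<integral>\<^sup>+z'. ennreal (V a b (N - Suc k) (fst (hist_ext k h u z') (Suc k)) + b) \<partial>kern_z M k (fst h k, u)"
  interpret P: controlled_process "BZ M" "BU M" "kern_z M" p "(x0, 0)" N by (rule controlled_z[OF x0 pol])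
  have Vm: "(\<lambda>h. ?v k h) \<in> borel_measurable (P.H k)" for k
  proof -
    have "V a b (N - k) \<in> borel_measurable (BZ M)" by (intro V_measurable nn) simp
    then have "(\<lambda>z. ennreal (V a b (N - k) z + b)) \<in> borel_measurable (BZ M)" by measurable
    from measurable_compose[OF measurable_hist_state[OF order_refl] this] show ?thesis .
  qed
  have "k \<le> N \<Longrightarrow> ennreal (V a b N (x0, 0) + b) \<le> (\<integral>\<^sup>+h. ?v k h \<partial>P.L k)" for k
  proof (induction k)
    case 0
    then show ?case using P.nn_integral_hist_law_0[OF Vm[of 0]] by simp
  next
    case (Suc k)
    then have k: "k < N" and m: "N - Suc k < N" and e: "Suc (N - Suc k) = N - k" "N - Suc (N - Suc k) = k" "N - (N - k) = k" by auto
    have "(\<integral>\<^sup>+h. ?v k h \<partial>P.L k) \<le> (\<integral>\<^sup>+h. \<integral>\<^sup>+u. ?r k h u \<partial>p k h \<partial>P.L k)"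
    proof (rule nn_integral_mono)
      fix h assume "h \<in> space (P.L k)"
      then have h: "h \<in> space (P.H k)" using P.space_hist_law k by auto
      have z: "fst h k \<in> Z" using P.hist_state_space[OF h order_refl] by simp
      interpret pk: prob_space "p k h" by (rule P.policy_space[OF k h])
      have "?v k h = (\<integral>\<^sup>+u. ?v k h \<partial>p k h)"
        by (simp add: pk.emeasure_space_1)
      also have "\<dots> \<le> (\<integral>\<^sup>+u. ?r k h u \<partial>p k h)"
      proof (rule nn_integral_mono)
        fix u assume "u \<in> space (p k h)"
        then have u: "u \<in> U" using P.policy_space[OF k h] by simp
        have "V a b (N - k) (fst h k) \<le> Q a b (N - Suc k) (fst h k, u)"
          using V_le_Q[OF nn m z u] by (simp add: e)
        then have "?v k h \<le> ennreal (Q a b (N - Suc k) (fst h k, u) + b)"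
          by (intro ennreal_leI) simp
        then show "?v k h \<le> ?r k h u"
          using nn_integral_V[OF nn m z u] by (simp add: hist_ext_def e)
      qed
      finally show "?v k h \<le>
        (\<integral>\<^sup>+u. ?r k h u \<partial>p k h)" .
    qed
    also have "\<dots> = (\<integral>\<^sup>+h. ennreal (V a b (N - Suc k) (fst h (Suc k)) + b) \<partial>P.L (Suc k))"
      by (rule P.nn_integral_hist_law_Suc[OF k Vm, symmetric])
    finally show ?case using Suc by simp
  qed
  from this[OF order_refl]
  have "ennreal (V a b N (x0, 0) + b) \<le> (\<integral>\<^sup>+h. ennreal (V a b 0 (fst h N) + b) \<partial>LZ x0 p)" by simp
  also have "\<dots> \<le> (\<integral>\<^sup>+h. ennreal (measure (q h) {1} * gain a b (fst h N) + b) \<partial>LZ x0 p)"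
  proof (intro nn_integral_mono ennreal_leI add_right_mono)
    fix h assume "h \<in> space (LZ x0 p)"
    then have h: "h \<in> space HZ" using P.space_hist_law by auto
    have q: "q \<in> HZ \<rightarrow>\<^sub>M prob_algebra (count_space {0, 1})" using pol by (simp add: zpolicies_def)
    have "0 \<le> measure (q h) {1}" "measure (q h) {1} \<le> 1"
      using kernel_prob_le_1[OF measurable_space[OF q h]] by auto
    then show "V a b 0 (fst h N) \<le> measure (q h) {1} * gain a b (fst h N)"
      using mult_left_le_one_le[of "- gain a b (fst h N)" "measure (q h) {1}"]
      by (cases "0 \<le> gain a b (fst h N)") (auto simp: V.simps min_def)
  qed
  finally show ?thesis .
qed

text \<open>The identity \<open>E(a f - b g) = a E f - b E g\<close>, arranged without subtraction because the expected
  cost may be infinite.\<close>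

lemma cost_safety_gain:
  assumes x0: "x0 \<in> X" and pol: "(p, q) \<in> zpolicies M" and nn: "0 \<le> a" "0 \<le> b"
  shows "(\<integral>\<^sup>+h. ennreal (measure (q h) {1} * gain a b (fst h N) + b) \<partial>LZ x0 p) + ennreal (b * safety_Pz M x0 (p, q))
    = ennreal a * cost_Pz M x0 (p, q) + ennreal b"
proof -
  let ?A = "\<lambda>h. measure (q h) {1}"
  let ?g = "\<lambda>h. ennreal (measure (q h) {1} * gain a b (fst h N) + b)"
  interpret P: controlled_process "BZ M" "BU M" "kern_z M" p "(x0, 0)" N by (rule controlled_z[OF x0 pol])
  interpret prob_space "LZ x0 p" by (rule P.prob_space_hist_law) simp
  have q: "q \<in> HZ \<rightarrow>\<^sub>M prob_algebra (count_space {0, 1})" using pol by (simp add: zpolicies_def)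
  note cong = measurable_cong_sets[OF P.sets_hist_law[OF order_refl] refl]
  have mq: "(\<lambda>h. ?A h) \<in> borel_measurable HZ"
    by (rule measurable_compose[OF q measurable_measure_prob_algebra]) simp
  have mg: "(\<lambda>h. gain a b (fst h N)) \<in> borel_measurable HZ"
    by (rule measurable_compose[OF measurable_hist_state[OF order_refl] borel_measurable_lsc_BZ[OF lsc_on_gain[OF nn(2)]]])
  let ?S = "\<lambda>h. ?A h * indicator (safe M \<times> {0..}) (fst h N)"
  let ?C = "\<lambda>h. ?A h * (snd (fst h N) + term_cost M (fst (fst h N)))"
  have mS: "?S \<in> borel_measurable HZ" by (intro borel_measurable_times mq last_safe_measurable)
  have mC: "?C \<in> borel_measurable HZ" by (intro borel_measurable_times mq last_cost_measurable)
  have cmult: "(\<integral>\<^sup>+h. ennreal r * ennreal (f h) \<partial>LZ x0 p) = ennreal r * (\<integral>\<^sup>+h. ennreal (f h) \<partial>LZ x0 p)"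
    if "f \<in> borel_measurable HZ" for r f
    by (rule nn_integral_cmult) (simp add: cong measurable_compose[OF that measurable_ennreal])
  have "(\<integral>\<^sup>+h. ?g h \<partial>LZ x0 p) + ennreal (b * safety_Pz M x0 (p, q))
    = (\<integral>\<^sup>+h. ?g h \<partial>LZ x0 p) + (\<integral>\<^sup>+h. ennreal b * ennreal (?S h) \<partial>LZ x0 p)"
    unfolding cmult[OF mS] safety_Pz_eq(1)[OF x0 pol, symmetric]
    using nn safety_Pz_eq(2)[OF x0 pol] by (simp add: ennreal_mult)
  also have "\<dots> = (\<integral>\<^sup>+h. ?g h + ennreal b * ennreal (?S h) \<partial>LZ x0 p)"
    by (intro nn_integral_add[symmetric])
       (use mq mg mS in \<open>auto simp: cong intro!: measurable_compose[OF _ measurable_ennreal] borel_measurable_times_ennreal\<close>)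
  also have "\<dots> = (\<integral>\<^sup>+h. ennreal a * ennreal (?C h) + ennreal b \<partial>LZ x0 p)"
  proof (rule nn_integral_cong)
    fix h assume "h \<in> space (LZ x0 p)"
    then have h: "h \<in> space HZ" using P.space_hist_law by auto
    have z: "fst h N \<in> Z" using P.hist_state_space[OF h order_refl] by simp
    have A: "0 \<le> ?A h" "?A h \<le> 1"
      using kernel_prob_le_1[OF measurable_space[OF q h]] by auto
    have C: "0 \<le> snd (fst h N) + term_cost M (fst (fst h N))"
      using term_cost_nonneg[of "fst (fst h N)"] z by (auto simp: mem_Times_iff)
    have "?A h * b \<le> 1 * b" using A nn by (intro mult_right_mono)
    moreover have "?A h * (- b) \<le> ?A h * gain a b (fst h N)"
      using gain_lower[OF nn z] A by (intro mult_left_mono)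
    ultimately have g: "0 \<le> ?A h * gain a b (fst h N) + b" by simp
    have "?g h + ennreal b * ennreal (?S h)
      = ennreal (?A h * gain a b (fst h N) + b + b * ?S h)"
      using g nn A by (simp add: ennreal_mult ennreal_plus)
    also have "?A h * gain a b (fst h N) + b + b * ?S h = a * ?C h + b"
      by (simp add: gain_def algebra_simps)
    also have "ennreal \<dots> = ennreal a * ennreal (?C h) + ennreal b"
      using A C nn by (simp add: ennreal_mult ennreal_plus)
    finally show "?g h + ennreal b * ennreal (?S h)
      = ennreal a * ennreal (?C h) + ennreal b" .
  qed
  also have "\<dots> = (\<integral>\<^sup>+h. ennreal a * ennreal (?C h) \<partial>LZ x0 p) + (\<integral>\<^sup>+h. ennreal b \<partial>LZ x0 p)"
    by (intro nn_integral_add) (use mC in \<open>auto simp: cong\<close>)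
  also have "\<dots> = ennreal a * cost_Pz M x0 (p, q) + ennreal b"
    unfolding cost_Pz_eq[OF x0 pol] cmult[OF mC] by (simp add: emeasure_space_1)
  finally show ?thesis .
qed

text \<open>Weak duality: the scalarized value is a lower bound for the expected gain of every policy.\<close>

lemma lagrangian_bound:
  assumes x0: "x0 \<in> X" and pol: "\<pi> \<in> zpolicies M" and nn: "0 \<le> a" "0 \<le> b"
  shows "ennreal (V a b N (x0, 0) + b) + ennreal (b * safety_Pz M x0 \<pi>) \<le> ennreal a * cost_Pz M x0 \<pi> + ennreal b"
proof -
  obtain p q where pq: "\<pi> = (p, q)" by (cases \<pi>)
  show ?thesis
    using V_lower_bound_law[OF x0 pol[unfolded pq] nn] 
    unfolding pq cost_safety_gain[OF x0 pol[unfolded pq] nn, symmetric] by (rule add_right_mono)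
qed

text \<open>Deterministic Markov policies, indexed by the number of remaining stages.\<close>

definition selector :: "(nat \<Rightarrow> 'x \<times> real \<Rightarrow> 'u) \<Rightarrow> ('x \<times> real \<Rightarrow> bool) \<Rightarrow> bool" where
  "selector s d \<longleftrightarrow> (\<forall>m<N. s m \<in> BZ M \<rightarrow>\<^sub>M BU M) \<and> d \<in> BZ M \<rightarrow>\<^sub>M count_space UNIV"

definition mix_kernel where
  "mix_kernel \<theta> s1 s2 k z = distr (measure_pmf (bernoulli_pmf \<theta>)) (BU M)
     (\<lambda>b. if b then s1 (N - Suc k) z else s2 (N - Suc k) z)"

definition mix_accept :: "real \<Rightarrow> ('x \<times> real \<Rightarrow> bool) \<Rightarrow> ('x \<times> real \<Rightarrow> bool) \<Rightarrow> 'x \<times> real \<Rightarrow> real" where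
  "mix_accept \<theta> d1 d2 z = \<theta> * of_bool (d1 z) + (1 - \<theta>) * of_bool (d2 z)"

abbreviation mix_gain where
  "mix_gain a b \<theta> d1 d2 \<equiv> \<lambda>z. ennreal (mix_accept \<theta> d1 d2 z * gain a b z + b)"

text \<open>At every stage one of two deterministic policies is chosen independently with fixed probability,
  so the mixture is again Markov. Its safety probability depends continuously on \<open>\<theta>\<close>.\<close>

definition mix_policy :: "real \<Rightarrow> (nat \<Rightarrow> 'x \<times> real \<Rightarrow> 'u) \<Rightarrow> ('x \<times> real \<Rightarrow> bool) \<Rightarrow>
    (nat \<Rightarrow> 'x \<times> real \<Rightarrow> 'u) \<Rightarrow> ('x \<times> real \<Rightarrow> bool) \<Rightarrow> ('x, 'u) zpolicy" where
  "mix_policy \<theta> s1 d1 s2 d2 =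
    (\<lambda>k h. mix_kernel \<theta> s1 s2 k (fst h k), \<lambda>h. coin (mix_accept \<theta> d1 d2 (fst h N)))"

primrec mix_value :: "real \<Rightarrow> (nat \<Rightarrow> 'x \<times> real \<Rightarrow> 'u) \<Rightarrow> (nat \<Rightarrow> 'x \<times> real \<Rightarrow> 'u) \<Rightarrow>
    ('x \<times> real \<Rightarrow> ennreal) \<Rightarrow> nat \<Rightarrow> 'x \<times> real \<Rightarrow> ennreal" where
  "mix_value \<theta> s1 s2 f 0 = f"
| "mix_value \<theta> s1 s2 f (Suc m) = (\<lambda>z.
     ennreal \<theta> * (\<integral>\<^sup>+z'. mix_value \<theta> s1 s2 f m z' \<partial>kz m (z, s1 m z)) +
     ennreal (1 - \<theta>) * (\<integral>\<^sup>+z'. mix_value \<theta> s1 s2 f m z' \<partial>kz m (z, s2 m z)))"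

lemma mix_policy_markov: "markov_via M (mix_policy \<theta> s1 d1 s2 d2) (mix_kernel \<theta> s1 s2) (\<lambda>z. coin (mix_accept \<theta> d1 d2 z))"
  by (simp add: markov_via_def mix_policy_def)

lemma mix_kernel_measurable:
  assumes "selector s1 d1" "selector s2 d2" "k < N"
  shows "mix_kernel \<theta> s1 s2 k \<in> BZ M \<rightarrow>\<^sub>M prob_algebra (BU M)"
  unfolding mix_kernel_def[abs_def]
proof (rule measurable_distr_prob_space2)
  show "(\<lambda>z. measure_pmf (bernoulli_pmf \<theta>)) \<in> BZ M \<rightarrow>\<^sub>M prob_algebra (count_space UNIV)"
    by (rule measurable_const) (simp add: space_prob_algebra prob_space_measure_pmf)
  have "s1 (N - Suc k) \<in> BZ M \<rightarrow>\<^sub>M BU M" "s2 (N - Suc k) \<in> BZ M \<rightarrow>\<^sub>M BU M"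
    using assms stage_less[OF assms(3)] by (auto simp: selector_def)
  then have [measurable]: "(\<lambda>zb. s1 (N - Suc k) (fst zb)) \<in> BZ M \<Otimes>\<^sub>M count_space UNIV \<rightarrow>\<^sub>M BU M"
    "(\<lambda>zb. s2 (N - Suc k) (fst zb)) \<in> BZ M \<Otimes>\<^sub>M count_space UNIV \<rightarrow>\<^sub>M BU M"
    by (auto intro: measurable_compose[OF measurable_fst])
  show "(\<lambda>(z, b). if b then s1 (N - Suc k) z else s2 (N - Suc k) z) \<in> BZ M \<Otimes>\<^sub>M count_space UNIV \<rightarrow>\<^sub>M BU M"
    unfolding case_prod_beta' by (intro measurable_If) measurable
qed

lemma mix_accept_bounds: "0 \<le> \<theta> \<Longrightarrow> \<theta> \<le> 1 \<Longrightarrow> 0 \<le> mix_accept \<theta> d1 d2 z \<and> mix_accept \<theta> d1 d2 z \<le> 1"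
  by (auto simp: mix_accept_def)

lemma mix_accept_measurable:
  assumes "selector s1 d1" "selector s2 d2"
  shows "mix_accept \<theta> d1 d2 \<in> borel_measurable (BZ M)"
proof -
  have [measurable]: "Measurable.pred (BZ M) d1" "Measurable.pred (BZ M) d2"
    using assms by (auto simp: selector_def)
  show ?thesis unfolding mix_accept_def of_bool_def by measurable
qed

lemma mix_policy_in_zpolicies:
  assumes s: "selector s1 d1" "selector s2 d2" and \<theta>: "0 \<le> \<theta>" "\<theta> \<le> 1"
  shows "mix_policy \<theta> s1 d1 s2 d2 \<in> zpolicies M"
proof -
  have "mix_accept \<theta> d1 d2 \<in> BZ M \<rightarrow>\<^sub>M restrict_space borel {0..1}"
    using mix_accept_measurable[OF s] mix_accept_bounds[OF \<theta>] by (intro measurable_restrict_space2) auto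
  from measurable_compose[OF measurable_compose[OF measurable_hist_state[OF order_refl] this] measurable_coin]
  show ?thesis
    unfolding zpolicies_def mix_policy_def
    by (auto intro!: measurable_compose[OF measurable_hist_state mix_kernel_measurable[OF s]])
qed

lemma mix_value_measurable:
  assumes s: "selector s1 d1" "selector s2 d2" and f: "f \<in> borel_measurable (BZ M)"
  shows "m \<le> N \<Longrightarrow> mix_value \<theta> s1 s2 f m \<in> borel_measurable (BZ M)"
proof (induction m)
  case (Suc m)
  then have m: "m < N" and IH: "mix_value \<theta> s1 s2 f m \<in> borel_measurable (BZ M)" by auto
  have "(\<lambda>z. \<integral>\<^sup>+z'. mix_value \<theta> s1 s2 f m z' \<partial>kz m (z, s z)) \<in> borel_measurable (BZ M)"
    if "s \<in> BZ M \<rightarrow>\<^sub>M BU M" for s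
  proof -
    have "(\<lambda>z. kz m (z, s z)) \<in> BZ M \<rightarrow>\<^sub>M subprob_algebra (BZ M)"
      using that by (intro measurable_prob_algebraD measurable_compose[OF _ kern_z_measurable[OF stage_less[OF m]]] measurable_Pair) auto
    from measurable_compose[OF this nn_integral_measurable_subprob_algebra[OF IH]] show ?thesis .
  qed
  then show ?case using s m by (auto simp: selector_def intro!: borel_measurable_add borel_measurable_times_ennreal)
qed (use f in simp)

lemma nn_integral_mix_policy:
  assumes x0: "x0 \<in> X" and s: "selector s1 d1" "selector s2 d2" and \<theta>: "0 \<le> \<theta>" "\<theta> \<le> 1"
    and f: "f \<in> borel_measurable (BZ M)"
  shows "(\<integral>\<^sup>+h. f (fst h N) \<partial>LZ x0 (fst (mix_policy \<theta> s1 d1 s2 d2))) = mix_value \<theta> s1 s2 f N (x0, 0)"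
proof -
  let ?p = "fst (mix_policy \<theta> s1 d1 s2 d2)" and ?v = "mix_value \<theta> s1 s2 f"
  interpret P: controlled_process "BZ M" "BU M" "kern_z M" ?p "(x0, 0)" N
    by (rule controlled_z[OF x0, where q="snd (mix_policy \<theta> s1 d1 s2 d2)"])
       (simp add: mix_policy_in_zpolicies[OF s \<theta>])
  have vm: "?v (N - k) \<in> borel_measurable (BZ M)" for k by (rule mix_value_measurable[OF s f]) simp
  have vh: "(\<lambda>h. ?v (N - k) (fst h k)) \<in> borel_measurable (P.H k)" for k
    by (rule measurable_compose[OF measurable_hist_state[OF order_refl] vm])
  have "k \<le> N \<Longrightarrow> (\<integral>\<^sup>+h. ?v (N - k) (fst h k) \<partial>P.L k) = ?v N (x0, 0)" for k
  proof (induction k)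
    case 0
    then show ?case using P.nn_integral_hist_law_0[OF vh[of 0]] by simp
  next
    case (Suc k)
    then have k: "k < N" and m: "N - Suc k < N" and e: "N - k = Suc (N - Suc k)" "N - Suc (N - Suc k) = k" by auto
    have "(\<integral>\<^sup>+h. ?v (N - Suc k) (fst h (Suc k)) \<partial>P.L (Suc k)) =
      (\<integral>\<^sup>+h. \<integral>\<^sup>+u. \<integral>\<^sup>+z'. ?v (N - Suc k) (fst (hist_ext k h u z') (Suc k)) \<partial>kern_z M k (fst h k, u) \<partial>?p k h \<partial>P.L k)"
      by (rule P.nn_integral_hist_law_Suc[OF k vh])
    also have "\<dots> = (\<integral>\<^sup>+h. ?v (N - k) (fst h k) \<partial>P.L k)"
    proof (rule nn_integral_cong)
      fix h assume "h \<in> space (P.L k)"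
      then have h: "h \<in> space (P.H k)" using P.space_hist_law k by auto
      have z: "fst h k \<in> Z" using P.hist_state_space[OF h order_refl] by simp
      let ?z = "fst h k"
      have U: "s1 (N - Suc k) ?z \<in> U" "s2 (N - Suc k) ?z \<in> U"
        using s m z by (auto simp: selector_def dest!: measurable_space[where x="?z"])
      have mu: "(\<lambda>u. \<integral>\<^sup>+z'. ?v (N - Suc k) z' \<partial>kern_z M k (?z, u)) \<in> borel_measurable (BU M)"
      proof -
        have "(\<lambda>u. kern_z M k (?z, u)) \<in> BU M \<rightarrow>\<^sub>M subprob_algebra (BZ M)"
          using z by (intro measurable_prob_algebraD measurable_compose[OF _ kern_z_measurable[OF k]] measurable_Pair) auto
        from measurable_compose[OF this nn_integral_measurable_subprob_algebra[OF vm]] show ?thesis .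
      qed
      have "(\<integral>\<^sup>+u. \<integral>\<^sup>+z'. ?v (N - Suc k) z' \<partial>kern_z M k (?z, u) \<partial>?p k h) =
        (\<integral>\<^sup>+b. (\<integral>\<^sup>+z'. ?v (N - Suc k) z' \<partial>kern_z M k (?z, if b then s1 (N - Suc k) ?z else s2 (N - Suc k) ?z)) \<partial>measure_pmf (bernoulli_pmf \<theta>))"
        unfolding mix_policy_def fst_conv mix_kernel_def
        by (rule nn_integral_distr) (use U mu in auto)
      also have "\<dots> = ?v (N - k) ?z"
        unfolding e(1) using \<theta> by (simp add: e(2) del: e(1) add: mult.commute)
      finally show "(\<integral>\<^sup>+u. \<integral>\<^sup>+z'. ?v (N - Suc k) (fst (hist_ext k h u z') (Suc k)) \<partial>kern_z M k (fst h k, u) \<partial>?p k h) = ?v (N - k) (fst h k)"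
        by (simp add: hist_ext_def)
    qed
    finally show ?case using Suc by simp
  qed
  from this[OF order_refl] show ?thesis by simp
qed

end

section \<open>Value of lexicographic and mixed policies\<close>

context continuous_safety_process
begin

lemma selector_in_inputs: "selector s d \<Longrightarrow> m < N \<Longrightarrow> z \<in> Z \<Longrightarrow> s m z \<in> U"
  unfolding selector_def using measurable_space[of "s m" "BZ M" "BU M" z] by simp

lemma lex_optimal_selector: "lex_optimal a b a' b' s d \<Longrightarrow> selector s d"
  by (simp add: lex_optimal_def selector_def)

lemma lex_optimalD:
  assumes "lex_optimal a b a' b' s d" "z \<in> Z"
  shows "m < N \<Longrightarrow> (\<integral>\<^sup>+z'. W a b a' b' m z' \<partial>kz m (z, s m z)) \<le> W a b a' b' (Suc m) z"
    and "m < N \<Longrightarrow> W a b a' b' (Suc m) z < \<infinity> \<Longrightarrow> Q a b m (z, s m z) \<le> V a b (Suc m) z"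
    and "ennreal ((if d z then gain a' b' z else 0) + b') \<le> W a b a' b' 0 z"
    and "W a b a' b' 0 z < \<infinity> \<Longrightarrow> (if d z then gain a b z else 0) \<le> V a b 0 z"
  using assms unfolding lex_optimal_def by blast+

lemma lex_optimal_secondary:
  assumes lex: "lex_optimal a b a' b' s d"
    and v0: "\<And>z. z \<in> Z \<Longrightarrow> v 0 z = ennreal (of_bool (d z) * gain a' b' z + b')"
    and vS: "\<And>m z. m < N \<Longrightarrow> z \<in> Z \<Longrightarrow> v (Suc m) z = (\<integral>\<^sup>+z'. v m z' \<partial>kz m (z, s m z))"
  shows "m \<le> N \<Longrightarrow> z \<in> Z \<Longrightarrow> v m z \<le> W a b a' b' m z"
proof (induction m arbitrary: z)
  case 0
  then show ?case using lex_optimalD(3)[OF lex 0(2)] v0 by (auto split: if_splits)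
next
  case (Suc m)
  then have m: "m < N" by simp
  have "v (Suc m) z \<le> (\<integral>\<^sup>+z'. W a b a' b' m z' \<partial>kz m (z, s m z))"
    unfolding vS[OF m Suc.prems(2)]
    using Suc.IH m kern_z_space(2)[OF stage_less[OF m] Suc.prems(2) selector_in_inputs[OF lex_optimal_selector[OF lex] m Suc.prems(2)]]
    by (intro nn_integral_mono) auto
  also have "\<dots> \<le> W a b a' b' (Suc m) z"
    by (rule lex_optimalD(1)[OF lex Suc.prems(2) m])
  finally show ?case .
qed

text \<open>Finiteness of the lexicographic value is inherited by almost every successor state, so the
  first objective is conserved along almost every path.\<close>

lemma lex_optimal_primary:
  assumes lex: "lex_optimal a b a' b' s d" and nn: "0 \<le> a" "0 \<le> b" "0 \<le> a'" "0 \<le> b'"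
    and v0: "\<And>z. z \<in> Z \<Longrightarrow> v 0 z = ennreal (of_bool (d z) * gain a b z + b)"
    and vS: "\<And>m z. m < N \<Longrightarrow> z \<in> Z \<Longrightarrow> v (Suc m) z = (\<integral>\<^sup>+z'. v m z' \<partial>kz m (z, s m z))"
  shows "m \<le> N \<Longrightarrow> z \<in> Z \<Longrightarrow> W a b a' b' m z < \<infinity> \<Longrightarrow> v m z = ennreal (V a b m z + b)"
proof (induction m arbitrary: z)
  case 0
  then have "(if d z then gain a b z else 0) \<le> V a b 0 z" using lex_optimalD(4)[OF lex] by simp
  then have "of_bool (d z) * gain a b z = V a b 0 z" by (auto simp: V.simps split: if_splits)
  then show ?case using v0[OF 0(2)] by simp
next
  case (Suc m)
  then have m: "m < N" and z: "z \<in> Z" by auto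
  let ?K = "kz m (z, s m z)"
  have u: "s m z \<in> U" by (rule selector_in_inputs[OF lex_optimal_selector[OF lex] m z])
  note K = kern_z_space[OF stage_less[OF m] z u]
  have Wm: "W a b a' b' m \<in> borel_measurable ?K"
    using W_measurable[OF nn, of m] m K(1) by (simp cong: measurable_cong_sets)
  have "(\<integral>\<^sup>+z'. W a b a' b' m z' \<partial>?K) \<le> W a b a' b' (Suc m) z"
    by (rule lex_optimalD(1)[OF lex z m])
  with Suc.prems(3) have "(\<integral>\<^sup>+z'. W a b a' b' m z' \<partial>?K) \<noteq> \<infinity>" by (auto simp: top_unique)
  from nn_integral_noteq_infinite[OF Wm this]
  have "AE z' in ?K. W a b a' b' m z' \<noteq> \<infinity>" .
  moreover have "AE z' in ?K. z' \<in> Z" using K(2) by (intro AE_I2) auto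
  ultimately have ae: "AE z' in ?K. v m z' = ennreal (V a b m z' + b)"
    by eventually_elim (use Suc.IH m in \<open>auto simp: less_top\<close>)
  have "v (Suc m) z = (\<integral>\<^sup>+z'. ennreal (V a b m z' + b) \<partial>?K)"
    unfolding vS[OF m z] by (rule nn_integral_cong_AE[OF ae])
  also have "\<dots> = ennreal (Q a b m (z, s m z) + b)" by (rule nn_integral_V[OF nn(1,2) m z u])
  also have "Q a b m (z, s m z) = V a b (Suc m) z"
    by (intro antisym lex_optimalD(2)[OF lex z m Suc.prems(3)] V_le_Q[OF nn(1,2) m z u])
  finally show ?case .
qed

text \<open>Conservation in every state, and not just almost surely under one law, is what survives mixing
  with a second policy.\<close>

definition conserving :: "real \<Rightarrow> real \<Rightarrow> (nat \<Rightarrow> 'x \<times> real \<Rightarrow> 'u) \<Rightarrow> ('x \<times> real \<Rightarrow> bool) \<Rightarrow> bool" where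
  "conserving a b s d \<longleftrightarrow> (\<forall>m<N. \<forall>z\<in>Z. Q a b m (z, s m z) = V a b (Suc m) z) \<and>
    (\<forall>z\<in>Z. of_bool (d z) * gain a b z = V a b 0 z)"

lemma lex_optimal_conserving:
  assumes lex: "lex_optimal a b a' b' s d" and nn: "0 \<le> a" "0 \<le> b"
    and fin: "\<And>m z. m \<le> N \<Longrightarrow> z \<in> Z \<Longrightarrow> W a b a' b' m z < \<infinity>"
  shows "conserving a b s d"
  unfolding conserving_def
proof (intro conjI allI impI ballI)
  fix m z assume m: "m < N" and z: "z \<in> Z"
  show "Q a b m (z, s m z) = V a b (Suc m) z"
    using lex_optimalD(2)[OF lex z m] fin[of "Suc m" z] m z
      V_le_Q[OF nn m z selector_in_inputs[OF lex_optimal_selector[OF lex] m z]] by simp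
next
  fix z assume z: "z \<in> Z"
  have "(if d z then gain a b z else 0) \<le> V a b 0 z"
    using lex_optimalD(4)[OF lex z] fin[of 0 z] z by simp
  then show "of_bool (d z) * gain a b z = V a b 0 z" by (auto simp: V.simps split: if_splits)
qed

lemma mix_conserving_value:
  assumes c: "conserving a b s1 d1" "conserving a b s2 d2" and s: "selector s1 d1" "selector s2 d2"
    and nn: "0 \<le> a" "0 \<le> b" and \<theta>: "0 \<le> \<theta>" "\<theta> \<le> 1"
  shows "m \<le> N \<Longrightarrow> z \<in> Z \<Longrightarrow>
    mix_value \<theta> s1 s2 (mix_gain a b \<theta> d1 d2) m z = ennreal (V a b m z + b)"
proof (induction m arbitrary: z)
  case 0
  have "of_bool (d1 z) * gain a b z = V a b 0 z" "of_bool (d2 z) * gain a b z = V a b 0 z"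
    using c 0 unfolding conserving_def by blast+
  then have "mix_accept \<theta> d1 d2 z * gain a b z = \<theta> * V a b 0 z + (1 - \<theta>) * V a b 0 z"
    by (simp add: mix_accept_def distrib_right mult.assoc)
  then have "mix_accept \<theta> d1 d2 z * gain a b z = V a b 0 z" by (simp add: algebra_simps)
  then show ?case by simp
next
  case (Suc m)
  then have m: "m < N" and z: "z \<in> Z" by auto
  have "(\<integral>\<^sup>+z'. mix_value \<theta> s1 s2 (mix_gain a b \<theta> d1 d2) m z' \<partial>kz m (z, s m z))
      = ennreal (V a b (Suc m) z + b)"
    if cs: "conserving a b s d" and ss: "selector s d" for s d
  proof -
    have u: "s m z \<in> U" by (rule selector_in_inputs[OF ss m z])
    have "(\<integral>\<^sup>+z'. mix_value \<theta> s1 s2 (mix_gain a b \<theta> d1 d2) m z' \<partial>kz m (z, s m z))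
      = (\<integral>\<^sup>+z'. ennreal (V a b m z' + b) \<partial>kz m (z, s m z))"
      using kern_z_space(2)[OF stage_less[OF m] z u] Suc.IH m by (intro nn_integral_cong) auto
    also have "\<dots> = ennreal (V a b (Suc m) z + b)"
    proof -
      have "Q a b m (z, s m z) = V a b (Suc m) z" using cs m z unfolding conserving_def by blast
      then show ?thesis using nn_integral_V[OF nn m z u] by simp
    qed
    finally show ?thesis .
  qed
  note this[OF c(1) s(1)] this[OF c(2) s(2)]
  moreover have "ennreal \<theta> * x + ennreal (1 - \<theta>) * x = x" for x
    using \<theta> by (simp flip: distrib_right ennreal_plus)
  ultimately show ?case by simp
qed

lemma mix_policy_cost:
  assumes x0: "x0 \<in> X" and s: "selector s1 d1" "selector s2 d2" and \<theta>: "0 \<le> \<theta>" "\<theta> \<le> 1"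
    and nn: "0 \<le> a" "0 \<le> b"
  defines "\<pi> \<equiv> mix_policy \<theta> s1 d1 s2 d2"
  shows "mix_value \<theta> s1 s2 (mix_gain a b \<theta> d1 d2) N (x0, 0)
      + ennreal (b * safety_Pz M x0 \<pi>) = ennreal a * cost_Pz M x0 \<pi> + ennreal b"
    and "ennreal (safety_Pz M x0 \<pi>) =
      mix_value \<theta> s1 s2 (\<lambda>z. ennreal (mix_accept \<theta> d1 d2 z * indicator (safe M \<times> {0..}) z)) N (x0, 0)"
    and "0 \<le> safety_Pz M x0 \<pi>"
proof -
  obtain p q where pq: "\<pi> = (p, q)" by (cases \<pi>)
  have pol: "(p, q) \<in> zpolicies M" using mix_policy_in_zpolicies[OF s \<theta>] pq by (simp add: \<pi>_def)
  have p: "p = fst (mix_policy \<theta> s1 d1 s2 d2)" using pq by (simp add: \<pi>_def)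
  have q: "measure (q h) {1} = mix_accept \<theta> d1 d2 (fst h N)" for h
    using pq measure_coin[of "mix_accept \<theta> d1 d2 (fst h N)"] mix_accept_bounds[OF \<theta>, of d1 d2 "fst h N"]
    by (auto simp: \<pi>_def mix_policy_def)
  note acc = mix_accept_measurable[OF s, measurable]
  have [measurable]: "gain a b \<in> borel_measurable (BZ M)" by (rule borel_measurable_lsc_BZ[OF lsc_on_gain[OF nn(2)]])
  have "(\<integral>\<^sup>+h. ennreal (measure (q h) {1} * gain a b (fst h N) + b) \<partial>LZ x0 p) =
    mix_value \<theta> s1 s2 (mix_gain a b \<theta> d1 d2) N (x0, 0)"
    unfolding q p by (rule nn_integral_mix_policy[OF x0 s \<theta>]) measurable
  then show "mix_value \<theta> s1 s2 (mix_gain a b \<theta> d1 d2) N (x0, 0)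
      + ennreal (b * safety_Pz M x0 \<pi>) = ennreal a * cost_Pz M x0 \<pi> + ennreal b"
    using cost_safety_gain[OF x0 pol nn] by (simp add: pq)
  have "ennreal (safety_Pz M x0 \<pi>) = (\<integral>\<^sup>+h. ennreal (mix_accept \<theta> d1 d2 (fst h N) * indicator (safe M \<times> {0..}) (fst h N)) \<partial>LZ x0 p)"
    using safety_Pz_eq(1)[OF x0 pol] unfolding q by (simp add: pq)
  also have "\<dots> = mix_value \<theta> s1 s2 (\<lambda>z. ennreal (mix_accept \<theta> d1 d2 z * indicator (safe M \<times> {0..}) z)) N (x0, 0)"
    unfolding p by (rule nn_integral_mix_policy[OF x0 s \<theta>]) measurable
  finally show "ennreal (safety_Pz M x0 \<pi>) = \<dots>" .
  show "0 \<le> safety_Pz M x0 \<pi>" using safety_Pz_eq(2)[OF x0 pol] by (simp add: pq)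
qed

lemma mix_value_endpoint:
  assumes "\<theta> = 1 \<and> s1 = s \<or> \<theta> = 0 \<and> s2 = s"
  shows "mix_value \<theta> s1 s2 f (Suc m) z = (\<integral>\<^sup>+z'. mix_value \<theta> s1 s2 f m z' \<partial>kz m (z, s m z))"
  using assms by auto

text \<open>Each of the two extreme lexicographic policies is an endpoint of the family of mixtures to which
  the intermediate value theorem is applied, so the statement covers both endpoints.\<close>

lemma lex_optimal_policy:
  assumes x0: "x0 \<in> X" and lex: "lex_optimal a b a' b' s d" and nn: "0 \<le> a" "0 \<le> b" "0 \<le> a'" "0 \<le> b'"
    and s12: "selector s1 d1" "selector s2 d2"
    and end_point: "\<theta> = 1 \<and> s1 = s \<and> d1 = d \<or> \<theta> = 0 \<and> s2 = s \<and> d2 = d"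
    and fin: "W a b a' b' N (x0, 0) < \<infinity>"
  defines "\<pi> \<equiv> mix_policy \<theta> s1 d1 s2 d2"
  shows "ennreal (V a b N (x0, 0) + b) + ennreal (b * safety_Pz M x0 \<pi>) = ennreal a * cost_Pz M x0 \<pi> + ennreal b"
    and "ennreal a' * cost_Pz M x0 \<pi> + ennreal b' \<le> W a b a' b' N (x0, 0) + ennreal (b' * safety_Pz M x0 \<pi>)"
proof -
  have \<theta>: "0 \<le> \<theta>" "\<theta> \<le> 1" using end_point by auto
  have acc: "mix_accept \<theta> d1 d2 z = of_bool (d z)" for z using end_point by (auto simp: mix_accept_def)
  have e: "\<theta> = 1 \<and> s1 = s \<or> \<theta> = 0 \<and> s2 = s" using end_point by auto
  have z0: "(x0, 0) \<in> Z" using x0 by simp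
  have "mix_value \<theta> s1 s2 (mix_gain a b \<theta> d1 d2) N (x0, 0) = ennreal (V a b N (x0, 0) + b)"
    by (rule lex_optimal_primary[OF lex nn _ mix_value_endpoint[OF e] order_refl z0 fin]) (simp add: acc)
  then show "ennreal (V a b N (x0, 0) + b) + ennreal (b * safety_Pz M x0 \<pi>) = ennreal a * cost_Pz M x0 \<pi> + ennreal b"
    using mix_policy_cost(1)[OF x0 s12 \<theta> nn(1,2)] by (simp add: \<pi>_def)
  have "mix_value \<theta> s1 s2 (mix_gain a' b' \<theta> d1 d2) N (x0, 0) \<le> W a b a' b' N (x0, 0)"
    by (rule lex_optimal_secondary[OF lex _ mix_value_endpoint[OF e] order_refl z0]) (simp add: acc)
  then show "ennreal a' * cost_Pz M x0 \<pi> + ennreal b' \<le> W a b a' b' N (x0, 0) + ennreal (b' * safety_Pz M x0 \<pi>)"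
    unfolding \<pi>_def mix_policy_cost(1)[OF x0 s12 \<theta> nn(3,4), symmetric] by (rule add_right_mono)
qed

lemma mix_value_le_1:
  assumes s: "selector s1 d1" "selector s2 d2" and \<theta>: "0 \<le> \<theta>" "\<theta> \<le> 1"
    and f: "\<And>z. z \<in> Z \<Longrightarrow> f z \<le> 1"
  shows "m \<le> N \<Longrightarrow> z \<in> Z \<Longrightarrow> mix_value \<theta> s1 s2 f m z \<le> 1"
proof (induction m arbitrary: z)
  case (Suc m)
  then have m: "m < N" and z: "z \<in> Z" by auto
  have "(\<integral>\<^sup>+z'. mix_value \<theta> s1 s2 f m z' \<partial>kz m (z, u)) \<le> 1" if u: "u \<in> U" for u
  proof -
    note K = kern_z_space[OF stage_less[OF m] z u]
    interpret prob_space "kz m (z, u)" by (rule K)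
    have "(\<integral>\<^sup>+z'. mix_value \<theta> s1 s2 f m z' \<partial>kz m (z, u)) \<le> (\<integral>\<^sup>+z'. 1 \<partial>kz m (z, u))"
      using Suc.IH m K(2) by (intro nn_integral_mono) auto
    then show ?thesis by (simp add: emeasure_space_1)
  qed
  from this[OF selector_in_inputs[OF s(1) m z]] this[OF selector_in_inputs[OF s(2) m z]]
  have "mix_value \<theta> s1 s2 f (Suc m) z \<le> ennreal \<theta> * 1 + ennreal (1 - \<theta>) * 1"
    unfolding mix_value.simps by (intro add_mono mult_left_mono) auto
  also have "\<dots> = 1" using \<theta> by (simp flip: ennreal_plus)
  finally show ?case .
qed (use f in simp)

lemma safety_continuous_in_mixture:
  assumes x0: "x0 \<in> X" and s: "selector s1 d1" "selector s2 d2"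
  shows "continuous_on {0..1} (\<lambda>\<theta>. safety_Pz M x0 (mix_policy \<theta> s1 d1 s2 d2))"
proof (rule continuous_on_sequentiallyI)
  fix t :: "nat \<Rightarrow> real" and \<theta> :: real
  assume t: "\<forall>n. t n \<in> {0..1}" and \<theta>: "\<theta> \<in> {0..1}" and lim: "t \<longlonglongrightarrow> \<theta>"
  define f where "f r z = ennreal (mix_accept r d1 d2 z * indicator (safe M \<times> {0..}) z)" for r z
  note mix_accept_measurable[OF s, measurable]
  let ?v = "\<lambda>r. mix_value r s1 s2 (f r)"
  have fm: "f r \<in> borel_measurable (BZ M)" for r unfolding f_def by measurable
  have f1: "f r z \<le> 1" if "r \<in> {0..1}" for r z
    using mix_accept_bounds[of r d1 d2 z] that by (auto simp: f_def indicator_def)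
  have "m \<le> N \<Longrightarrow> z \<in> Z \<Longrightarrow> (\<lambda>i. ?v (t i) m z) \<longlonglongrightarrow> ?v \<theta> m z" for m z
  proof (induction m arbitrary: z)
    case 0
    show ?case unfolding mix_value.simps f_def mix_accept_def
      by (intro tendsto_ennrealI tendsto_intros lim)
  next
    case (Suc m)
    then have m: "m < N" and z: "z \<in> Z" by auto
    have int: "(\<lambda>i. \<integral>\<^sup>+z'. ?v (t i) m z' \<partial>kz m (z, u))
        \<longlonglongrightarrow> (\<integral>\<^sup>+z'. ?v \<theta> m z' \<partial>kz m (z, u))"
      and fin: "(\<integral>\<^sup>+z'. ?v \<theta> m z' \<partial>kz m (z, u)) \<noteq> \<infinity>" if u: "u \<in> U" for u
    proof -
      note K = kern_z_space[OF stage_less[OF m] z u]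
      interpret prob_space "kz m (z, u)" by (rule K)
      have le1: "AE z' in kz m (z, u). ?v r m z' \<le> 1" if "r \<in> {0..1}" for r
        using K(2) m that by (intro AE_I2 mix_value_le_1[OF s]) (auto simp: f1)
      have meas: "?v r m \<in> borel_measurable (kz m (z, u))" for r
        using mix_value_measurable[OF s fm, of m] m K(1) by (simp cong: measurable_cong_sets)
      show "(\<lambda>i. \<integral>\<^sup>+z'. ?v (t i) m z' \<partial>kz m (z, u))
        \<longlonglongrightarrow> (\<integral>\<^sup>+z'. ?v \<theta> m z' \<partial>kz m (z, u))"
      proof (rule nn_integral_dominated_convergence[where w="\<lambda>_. 1"])
        show "AE z' in kz m (z, u). (\<lambda>i. ?v (t i) m z') \<longlonglongrightarrow> ?v \<theta> m z'"
          using Suc.IH m K(2) by (intro AE_I2) auto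
      qed (use meas le1 t in \<open>auto simp: emeasure_space_1\<close>)
      have "(\<integral>\<^sup>+z'. ?v \<theta> m z' \<partial>kz m (z, u)) \<le> (\<integral>\<^sup>+z'. 1 \<partial>kz m (z, u))"
        by (rule nn_integral_mono_AE[OF le1[OF \<theta>]])
      then show "(\<integral>\<^sup>+z'. ?v \<theta> m z' \<partial>kz m (z, u)) \<noteq> \<infinity>"
        by (auto simp: emeasure_space_1 top_unique)
    qed
    note u = selector_in_inputs[OF s(1) m z] selector_in_inputs[OF s(2) m z]
    show ?case unfolding mix_value.simps
      by (intro tendsto_add tendsto_mult_ennreal tendsto_ennrealI int u tendsto_diff lim tendsto_const) (use fin[OF u(1)] fin[OF u(2)] in auto)
  qed
  from this[OF order_refl, of "(x0, 0)"]
  have L: "(\<lambda>i. ?v (t i) N (x0, 0)) \<longlonglongrightarrow> ?v \<theta> N (x0, 0)" using x0 by simp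
  have sf: "?v r N (x0, 0) = ennreal (safety_Pz M x0 (mix_policy r s1 d1 s2 d2))"
    and nnf: "0 \<le> safety_Pz M x0 (mix_policy r s1 d1 s2 d2)" if "r \<in> {0..1}" for r
    using mix_policy_cost(2,3)[OF x0 s, of r 0 0] that by (auto simp: f_def[abs_def])
  from L have "(\<lambda>i. enn2real (?v (t i) N (x0, 0))) \<longlonglongrightarrow> safety_Pz M x0 (mix_policy \<theta> s1 d1 s2 d2)"
    unfolding sf[OF \<theta>] by (rule tendsto_enn2real) (rule nnf[OF \<theta>])
  then show "(\<lambda>n. safety_Pz M x0 (mix_policy (t n) s1 d1 s2 d2)) \<longlonglongrightarrow> safety_Pz M x0 (mix_policy \<theta> s1 d1 s2 d2)"
    using t sf nnf by simp
qed

end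

section \<open>Existence of an optimal Markov policy\<close>

context continuous_safety_process
begin

lemma V_scaled_comparison:
  assumes nn: "0 \<le> a" "0 \<le> b" "0 \<le> a1" "0 \<le> b1" "0 \<le> r"
    and base: "\<And>z. z \<in> Z \<Longrightarrow> r * V a1 b1 0 z + d \<le> V a b 0 z"
    and m: "m \<le> N" "z \<in> Z"
  shows "r * V a1 b1 m z + d \<le> V a b m z"
  using V_comparison(1)[OF nn(1-4) order_refl order_refl nn(5) order_refl, of d, OF _ m] base by simp

lemma V_0_nonneg: "0 \<le> a \<Longrightarrow> m \<le> N \<Longrightarrow> z \<in> Z \<Longrightarrow> V a 0 m z = 0"
  using V_lower[of a 0 m z] V_upper[of a 0 m z] by simp

lemma gain_mono: "z \<in> Z \<Longrightarrow> a \<le> a' \<Longrightarrow> b' \<le> b \<Longrightarrow> gain a b z \<le> gain a' b' z"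
  unfolding gain_def using term_cost_nonneg[of "fst z"]
  by (intro diff_mono mult_right_mono) (auto simp: mem_Times_iff)

lemma V_scale_le:
  assumes "0 \<le> a" "0 \<le> b" "0 < r" "m \<le> N" "z \<in> Z"
  shows "V (r * a) (r * b) m z \<le> r * V a b m z"
proof -
  have "(1 / r) * V (r * a) (r * b) m z + 0 \<le> V a b m z"
  proof (rule V_scaled_comparison)
    fix z
    have "V (r * a) (r * b) 0 z = r * V a b 0 z"
      using assms(3) by (simp add: V.simps gain_scale min_mult_distrib_left)
    then show "(1 / r) * V (r * a) (r * b) 0 z + 0 \<le> V a b 0 z"
      using assms(3) by simp
  qed (use assms in auto)
  then show ?thesis using assms(3) by (simp add: field_simps)
qed

lemma V_mono:
  assumes "0 \<le> a" "a \<le> a'" "0 \<le> b'" "b' \<le> b" "m \<le> N" "z \<in> Z"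
  shows "V a b m z \<le> V a' b' m z"
proof -
  have "1 * V a b m z + 0 \<le> V a' b' m z"
  proof (rule V_scaled_comparison)
    fix z assume "z \<in> Z"
    then show "1 * V a b 0 z + 0 \<le> V a' b' 0 z"
      using gain_mono[of z a a' b' b] assms by (auto simp: V.simps min_def)
  qed (use assms in auto)
  then show ?thesis by simp
qed

lemma V_safety_lipschitz:
  assumes "0 \<le> a" "0 \<le> b" "b \<le> b'" "m \<le> N" "z \<in> Z"
  shows "V a b m z - (b' - b) \<le> V a b' m z"
proof -
  have "1 * V a b m z + (- (b' - b)) \<le> V a b' m z"
  proof (rule V_scaled_comparison)
    fix z :: "'x \<times> real"
    have "gain a b z - (b' - b) \<le> gain a b' z"
      using assms by (auto simp: gain_def indicator_def)
    then show "1 * V a b 0 z + (- (b' - b)) \<le> V a b' 0 z"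
      using assms(3) by (auto simp: V.simps min_def)
  qed (use assms in auto)
  then show ?thesis by simp
qed

text \<open>As the weight of the cost vanishes, the scalarized value tends to that of the pure safety
  problem: the safest choice remains available, and along it dominated convergence applies. In
  particular, policies of infinite cost give no more safety than is approached at finite cost.\<close>

lemma V_tendsto_max_safety:
  "m \<le> N \<Longrightarrow> z \<in> Z \<Longrightarrow> (\<lambda>n. V (1 / real (Suc n)) 1 m z) \<longlonglongrightarrow> V 0 1 m z"
proof (induction m arbitrary: z)
  case 0
  have "(\<lambda>n. 1 / real (Suc n)) \<longlonglongrightarrow> 0" by (rule LIMSEQ_inverse_real_of_nat[unfolded inverse_eq_divide])
  then show ?case unfolding V.simps gain_def by (intro tendsto_intros)
next
  case (Suc m)
  then have m: "m < N" and z: "z \<in> Z" by auto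
  obtain u where u: "u \<in> U" "V 0 1 (Suc m) z = Q 0 1 m (z, u)"
    using V_attained[of 0 1, OF _ _ m z] by auto
  note K = kern_z_space[OF stage_less[OF m] z u(1)]
  interpret prob_space "kz m (z, u)" by (rule K)
  have "(\<lambda>n. Q (1 / real (Suc n)) 1 m (z, u)) \<longlonglongrightarrow> Q 0 1 m (z, u)"
    unfolding Q_def
  proof (rule integral_dominated_convergence[where w="\<lambda>_. 1"])
    show "V 0 1 m \<in> borel_measurable (kz m (z, u))"
      using V_integrable[of 0 1, OF _ _ m z u(1)] by simp
    show "V (1 / real (Suc n)) 1 m \<in> borel_measurable (kz m (z, u))" for n
      using V_integrable[of "1 / real (Suc n)" 1, OF _ _ m z u(1)] by simp
    show "AE z' in kz m (z, u). (\<lambda>n. V (1 / real (Suc n)) 1 m z') \<longlonglongrightarrow> V 0 1 m z'"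
      using Suc.IH m K(2) by (intro AE_I2) auto
    show "AE z' in kz m (z, u). norm (V (1 / real (Suc n)) 1 m z') \<le> 1" for n
    proof (rule AE_I2)
      fix z' assume "z' \<in> space (kz m (z, u))"
      then show "norm (V (1 / real (Suc n)) 1 m z') \<le> 1"
        using V_lower[of "1 / real (Suc n)" 1 m z'] V_upper[of "1 / real (Suc n)" 1 m z'] m K(2)
        by (auto simp: abs_le_iff)
    qed
  qed simp
  then have up: "(\<lambda>n. Q (1 / real (Suc n)) 1 m (z, u)) \<longlonglongrightarrow> V 0 1 (Suc m) z" by (simp add: u)
  show ?case
  proof (rule tendsto_sandwich[OF _ _ tendsto_const up])
    show "\<forall>\<^sub>F n in sequentially. V 0 1 (Suc m) z \<le> V (1 / real (Suc n)) 1 (Suc m) z"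
      using Suc.prems by (intro always_eventually allI V_mono) auto
    show "\<forall>\<^sub>F n in sequentially. V (1 / real (Suc n)) 1 (Suc m) z \<le> Q (1 / real (Suc n)) 1 m (z, u)"
      by (intro always_eventually allI V_le_Q m z u(1)) auto
  qed
qed

lemma optimal_PzI:
  assumes "\<pi> \<in> zpolicies M" "\<alpha> \<le> safety_Pz M x0 \<pi>"
    and "\<And>\<pi>'. \<pi>' \<in> zpolicies M \<Longrightarrow> \<alpha> \<le> safety_Pz M x0 \<pi>' \<Longrightarrow> cost_Pz M x0 \<pi> \<le> cost_Pz M x0 \<pi>'"
  shows "optimal_Pz M \<alpha> x0 \<pi>"
  unfolding optimal_Pz_def feasible_Pz_def
  using assms by (auto intro!: antisym INF_greatest INF_lower)

lemma safety_Pz_nonneg: "x0 \<in> X \<Longrightarrow> \<pi> \<in> zpolicies M \<Longrightarrow> 0 \<le> safety_Pz M x0 \<pi>"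
  using safety_Pz_eq(2) by (cases \<pi>) auto

text \<open>Weak duality with weight \<open>0\<close> on the cost.\<close>

lemma max_safety:
  assumes x0: "x0 \<in> X" and \<pi>: "\<pi> \<in> zpolicies M"
  shows "safety_Pz M x0 \<pi> \<le> - V 0 1 N (x0, 0)"
proof -
  have v: "- 1 \<le> V 0 1 N (x0, 0)" using V_lower[of 0 1 N "(x0, 0)"] x0 by simp
  have "ennreal (V 0 1 N (x0, 0) + 1 + safety_Pz M x0 \<pi>) \<le> ennreal 1"
    using lagrangian_bound[OF x0 \<pi>, of 0 1] v safety_Pz_nonneg[OF x0 \<pi>] by (simp flip: ennreal_plus)
  then show ?thesis by (subst (asm) ennreal_le_iff) auto
qed

text \<open>If \<open>\<alpha>\<close> is the largest achievable safety probability, a multiplier need not exist, since the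
  optimal cost may have infinite slope in \<open>\<alpha>\<close> there. Feasible policies are then exactly the
  maximizers of safety, and the cost is minimized lexicographically among them. If the lexicographic
  value is infinite, every feasible policy has infinite cost and any safest Markov policy is
  optimal.\<close>

lemma optimal_policy_at_max_safety:
  assumes x0: "x0 \<in> X" and \<alpha>: "\<alpha> = - V 0 1 N (x0, 0)"
  shows "\<exists>\<theta> s1 d1 s2 d2. optimal_Pz M \<alpha> x0 (mix_policy \<theta> s1 d1 s2 d2)"
proof -
  have z0: "(x0, 0) \<in> Z" using x0 by simp
  have lex: "\<exists>s d. selector s d \<and> mix_policy 1 s d s d \<in> zpolicies M \<and>
      safety_Pz M x0 (mix_policy 1 s d s d) = \<alpha> \<and>
      ennreal a' * cost_Pz M x0 (mix_policy 1 s d s d) \<le> W 0 1 a' 0 N (x0, 0)"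
    if a': "0 \<le> a'" and fin: "W 0 1 a' 0 N (x0, 0) < \<infinity>" for a'
  proof -
    obtain s d where sd: "lex_optimal 0 1 a' 0 s d" using lex_optimal_exists[of 0 1 a' 0] a' by auto
    note sel = lex_optimal_selector[OF sd]
    let ?\<pi> = "mix_policy 1 s d s d"
    have pol: "?\<pi> \<in> zpolicies M" by (rule mix_policy_in_zpolicies[OF sel sel]) auto
    note * = lex_optimal_policy[OF x0 sd order_refl zero_le_one a' order_refl sel sel _ fin, of 1]
    have v: "- 1 \<le> V 0 1 N (x0, 0)" using V_lower[of 0 1 N "(x0, 0)"] z0 by simp
    have "ennreal (V 0 1 N (x0, 0) + 1 + safety_Pz M x0 ?\<pi>) = ennreal 1"
      using *(1) v safety_Pz_nonneg[OF x0 pol] by (simp flip: ennreal_plus)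
    then have "V 0 1 N (x0, 0) + 1 + safety_Pz M x0 ?\<pi> = 1"
      by (subst (asm) ennreal_inj) (use v safety_Pz_nonneg[OF x0 pol] in auto)
    then show ?thesis using *(2) sel pol \<alpha> by (intro exI[of _ s] exI[of _ d]) simp
  qed
  have lower: "W 0 1 1 0 N (x0, 0) \<le> cost_Pz M x0 \<pi>" if \<pi>: "\<pi> \<in> zpolicies M" "\<alpha> \<le> safety_Pz M x0 \<pi>" for \<pi>
    unfolding W_def
  proof (rule SUP_least)
    fix n :: nat
    have v: "- real n \<le> V 1 n N (x0, 0)" using V_lower[of 1 n N "(x0, 0)"] z0 by simp
    let ?G = "safety_Pz M x0 \<pi>"
    have G: "0 \<le> ?G" by (rule safety_Pz_nonneg[OF x0 \<pi>(1)])
    have "ennreal (V 1 n N (x0, 0) + n * ?G) + ennreal n \<le> cost_Pz M x0 \<pi> + ennreal n"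
    proof (cases "0 \<le> V 1 n N (x0, 0) + n * ?G")
      case True
      then show ?thesis using lagrangian_bound[OF x0 \<pi>(1), of 1 n] v G
        by (simp add: algebra_simps flip: ennreal_plus)
    qed (simp add: ennreal_neg)
    then have "ennreal (V 1 n N (x0, 0) + n * ?G) \<le> cost_Pz M x0 \<pi>"
      by (simp add: ennreal_add_left_cancel_le add.commute)
    moreover have "n * \<alpha> \<le> n * ?G" using \<pi> by (intro mult_left_mono) auto
    ultimately have le: "ennreal (V 1 n N (x0, 0) + n * \<alpha>) \<le> cost_Pz M x0 \<pi>"
      by (meson add_left_mono ennreal_leI order_trans)
    have "V (real n * 0 + 1) (real n * 1 + 0) N (x0, 0) - real n * V 0 1 N (x0, 0) + 0 = V 1 n N (x0, 0) + n * \<alpha>"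
      by (simp add: \<alpha>)
    from le[folded this]
    show "ennreal (V (real n * 0 + 1) (real n * 1 + 0) N (x0, 0) - real n * V 0 1 N (x0, 0) + 0) \<le> cost_Pz M x0 \<pi>" .
  qed
  show ?thesis
  proof (cases "W 0 1 1 0 N (x0, 0) < \<infinity>")
    case True
    from lex[OF zero_le_one this] obtain s d where
      "mix_policy 1 s d s d \<in> zpolicies M" "safety_Pz M x0 (mix_policy 1 s d s d) = \<alpha>"
      "cost_Pz M x0 (mix_policy 1 s d s d) \<le> W 0 1 1 0 N (x0, 0)" by auto
    then have "optimal_Pz M \<alpha> x0 (mix_policy 1 s d s d)"
      using lower by (intro optimal_PzI) (auto intro: order_trans)
    then show ?thesis by blast
  next
    case False
    have "W 0 1 0 0 N (x0, 0) \<le> ennreal 0"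
      unfolding W_def
    proof (intro SUP_least ennreal_leI)
      fix n :: nat
      show "V (real n * 0 + 0) (real n * 1 + 0) N (x0, 0) - real n * V 0 1 N (x0, 0) + 0 \<le> 0"
        using V_scale_le[of 0 1 "real n" N "(x0, 0)"] V_0_nonneg[of 0 N "(x0, 0)"] z0 by (cases "n = 0") auto
    qed
    then have "W 0 1 0 0 N (x0, 0) < \<infinity>" by (simp add: less_top)
    from lex[OF order_refl this] obtain s d where
      "mix_policy 1 s d s d \<in> zpolicies M" "safety_Pz M x0 (mix_policy 1 s d s d) = \<alpha>" by auto
    moreover have "cost_Pz M x0 \<pi> = \<infinity>" if "\<pi> \<in> zpolicies M" "\<alpha> \<le> safety_Pz M x0 \<pi>" for \<pi>
      using lower[OF that] False by (metis infinity_ennreal_def less_top top_unique)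
    ultimately have "optimal_Pz M \<alpha> x0 (mix_policy 1 s d s d)"
      by (intro optimal_PzI) auto
    then show ?thesis by blast
  qed
qed

text \<open>Below the maximal safety probability, the dual function is continuous and, for large
  multipliers, at most its value at \<open>0\<close>, so it attains its maximum.\<close>

lemma optimal_multiplier:
  assumes x0: "x0 \<in> X" and \<alpha>: "\<alpha> < - V 0 1 N (x0, 0)"
  obtains l where "0 \<le> l" "\<And>l'. 0 \<le> l' \<Longrightarrow> V 1 l' N (x0, 0) + l' * \<alpha> \<le> V 1 l N (x0, 0) + l * \<alpha>"
proof -
  have z0: "(x0, 0) \<in> Z" using x0 by simp
  define D where "D l = V 1 l N (x0, 0) + l * \<alpha>" for l
  have "eventually (\<lambda>n. V (1 / real (Suc n)) 1 N (x0, 0) < - \<alpha>) sequentially"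
    using order_tendstoD(2)[OF V_tendsto_max_safety[OF order_refl z0], of "- \<alpha>"] \<alpha> by simp
  then obtain n where n: "V (1 / real (Suc n)) 1 N (x0, 0) < - \<alpha>"
    unfolding eventually_sequentially by blast
  have big: "D l \<le> D 0" if l: "real (Suc n) \<le> l" for l
  proof -
    have l0: "0 < l" using l by simp
    have "V 1 l N (x0, 0) \<le> l * V (1 / l) 1 N (x0, 0)"
      using V_scale_le[of "1 / l" 1 l N "(x0, 0)"] l0 z0 by simp
    also have "\<dots> \<le> l * V (1 / real (Suc n)) 1 N (x0, 0)"
      using l l0 z0 by (intro mult_left_mono V_mono) (auto intro!: divide_left_mono)
    also have "\<dots> \<le> l * (- \<alpha>)" using n l0 by (intro mult_left_mono) auto
    finally show ?thesis using V_0_nonneg[of 1 N "(x0, 0)"] z0 by (simp add: D_def)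
  qed
  have "continuous_on {0..real (Suc n)} D"
  proof -
    have lip: "\<bar>V 1 l N (x0, 0) - V 1 l' N (x0, 0)\<bar> \<le> \<bar>l - l'\<bar>" if "0 \<le> l" "0 \<le> l'" for l l'
      using V_safety_lipschitz[of 1 l l' N "(x0, 0)"] V_safety_lipschitz[of 1 l' l N "(x0, 0)"]
        V_mono[of 1 1 l l' N "(x0, 0)"] V_mono[of 1 1 l' l N "(x0, 0)"] that z0
      by (cases "l \<le> l'") auto
    have "continuous_on {0..real (Suc n)} (\<lambda>l. V 1 l N (x0, 0))"
    proof (rule continuous_onI)
      fix l e :: real assume l: "l \<in> {0..real (Suc n)}" "0 < e"
      show "\<exists>d>0. \<forall>l'\<in>{0..real (Suc n)}. dist l' l < d \<longrightarrow> dist (V 1 l' N (x0, 0)) (V 1 l N (x0, 0)) \<le> e"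
      proof (intro exI[of _ e] conjI ballI impI)
        fix l' assume l': "l' \<in> {0..real (Suc n)}" "dist l' l < e"
        then show "dist (V 1 l' N (x0, 0)) (V 1 l N (x0, 0)) \<le> e"
          using lip[of l' l] l by (auto simp: dist_real_def)
      qed (rule l(2))
    qed
    then show ?thesis unfolding D_def by (intro continuous_intros)
  qed
  from continuous_attains_sup[OF _ _ this] obtain l where
    l: "l \<in> {0..real (Suc n)}" "\<And>l'. l' \<in> {0..real (Suc n)} \<Longrightarrow> D l' \<le> D l" by force
  have "D l' \<le> D l" if "0 \<le> l'" for l'
    using l(2)[of l'] l(2)[of 0] big[of l'] that by (cases "l' \<le> real (Suc n)") auto
  then show ?thesis using that[of l] l(1) by (auto simp: D_def)
qed

text \<open>Among the minimizers of the Lagrangian at the optimal multiplier, the one chosen lexicographically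
  for largest safety satisfies the constraint: maximality of the dual function just to the right of
  \<open>l\<close> bounds the lexicographic value by \<open>1 - \<alpha>\<close>.\<close>

lemma safe_conserving_selector:
  assumes x0: "x0 \<in> X" and \<alpha>: "\<alpha> \<le> - V 0 1 N (x0, 0)" "\<alpha> \<le> 1" and l: "0 \<le> l"
    and max: "\<And>l'. 0 \<le> l' \<Longrightarrow> V 1 l' N (x0, 0) + l' * \<alpha> \<le> V 1 l N (x0, 0) + l * \<alpha>"
  obtains s d where "selector s d" "conserving 1 l s d"
    "\<And>s2 d2. selector s2 d2 \<Longrightarrow> \<alpha> \<le> safety_Pz M x0 (mix_policy 1 s d s2 d2)"
proof -
  have z0: "(x0, 0) \<in> Z" using x0 by simp
  obtain s d where sd: "lex_optimal 1 l 0 1 s d" using lex_optimal_exists[of 1 l 0 1] l by auto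
  note sel = lex_optimal_selector[OF sd]
  have J: "V (real n * 1 + 0) (real n * l + 1) m z - real n * V 1 l m z + 1 \<le> 1" if "m \<le> N" "z \<in> Z" for m z and n :: nat
  proof (cases "n = 0")
    case True then show ?thesis using V_upper[of 0 1 m z] that by simp
  next
    case False
    have "V n (n * l + 1) m z \<le> V n (n * l) m z" using l that by (intro V_mono) auto
    also have "\<dots> \<le> n * V 1 l m z" using V_scale_le[of 1 l n m z] l that False by simp
    finally show ?thesis by simp
  qed
  have "W 1 l 0 1 m z \<le> ennreal 1" if "m \<le> N" "z \<in> Z" for m z
    unfolding W_def by (intro SUP_least ennreal_leI J that)
  then have fin: "W 1 l 0 1 m z < \<infinity>" if "m \<le> N" "z \<in> Z" for m z
    using that by (metis ennreal_less_top infinity_ennreal_def le_less_trans)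
  have Wz: "W 1 l 0 1 N (x0, 0) \<le> ennreal (1 - \<alpha>)"
    unfolding W_def
  proof (intro SUP_least ennreal_leI)
    fix n :: nat
    show "V (real n * 1 + 0) (real n * l + 1) N (x0, 0) - real n * V 1 l N (x0, 0) + 1 \<le> 1 - \<alpha>"
    proof (cases "n = 0")
      case True then show ?thesis using \<alpha> by simp
    next
      case False
      have "V n (n * l + 1) N (x0, 0) \<le> n * V 1 (l + 1 / n) N (x0, 0)"
        using V_scale_le[of 1 "l + 1 / n" n N "(x0, 0)"] l z0 False by (simp add: distrib_left)
      also have "\<dots> \<le> n * (V 1 l N (x0, 0) - \<alpha> / n)"
        using max[of "l + 1 / n"] l False by (intro mult_left_mono) (auto simp: distrib_right)
      also have "\<dots> = n * V 1 l N (x0, 0) - \<alpha>" using False by (simp add: field_simps)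
      finally show ?thesis by simp
    qed
  qed
  have "\<alpha> \<le> safety_Pz M x0 (mix_policy 1 s d s2 d2)" if s2: "selector s2 d2" for s2 d2
  proof -
    let ?\<pi> = "mix_policy 1 s d s2 d2"
    have G: "0 \<le> safety_Pz M x0 ?\<pi>" by (rule safety_Pz_nonneg[OF x0 mix_policy_in_zpolicies[OF sel s2]]) auto
    have "1 \<le> W 1 l 0 1 N (x0, 0) + ennreal (safety_Pz M x0 ?\<pi>)"
      using lex_optimal_policy(2)[OF x0 sd zero_le_one l order_refl zero_le_one sel s2 _ fin[OF order_refl z0], of 1] by simp
    also have "\<dots> \<le> ennreal (1 - \<alpha>) + ennreal (safety_Pz M x0 ?\<pi>)" by (intro add_right_mono Wz)
    finally have "ennreal 1 \<le> ennreal (1 - \<alpha> + safety_Pz M x0 ?\<pi>)"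
      using G \<alpha> by (simp add: ennreal_plus)
    then show ?thesis using G \<alpha> by (subst (asm) ennreal_le_iff) auto
  qed
  then show ?thesis using that[OF sel lex_optimal_conserving[OF sd zero_le_one l fin]] by blast
qed

text \<open>The counterpart to the left of \<open>l\<close>, for smallest safety. The second objective is safety itself,
  whose weight has the wrong sign; adding \<open>k\<close> copies of the Lagrangian with \<open>1 \<le> k * l\<close> makes both
  weights nonnegative and does not change the order among minimizers of the Lagrangian.\<close>

lemma unsafe_conserving_selector:
  assumes x0: "x0 \<in> X" and \<alpha>: "0 \<le> \<alpha>" and l: "0 < l"
    and max: "\<And>l'. 0 \<le> l' \<Longrightarrow> V 1 l' N (x0, 0) + l' * \<alpha> \<le> V 1 l N (x0, 0) + l * \<alpha>"
  obtains s d where "selector s d" "conserving 1 l s d"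
    "\<And>s1 d1. selector s1 d1 \<Longrightarrow> safety_Pz M x0 (mix_policy 0 s1 d1 s d) \<le> \<alpha>"
proof -
  have z0: "(x0, 0) \<in> Z" using x0 by simp
  obtain k :: nat where k1: "1 \<le> k * l"
    using reals_Archimedean3[OF l, rule_format, of 1] by (metis less_imp_le)
  then have k: "0 < k" by (cases k) auto
  define b' where "b' = k * l - 1"
  have b': "0 \<le> b'" using k1 by (simp add: b'_def)
  obtain s d where sd: "lex_optimal 1 l k b' s d" using lex_optimal_exists[of 1 l k b'] l b' by auto
  note sel = lex_optimal_selector[OF sd]
  have arg: "real n * 1 + real k = real (n + k)" "real n * l + b' = real (n + k) * l - 1"
    and pos: "0 < real (n + k)" "0 \<le> real (n + k) * l - 1" for n :: nat
  proof -
    show "0 < real (n + k)" using k by simp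
    have "0 \<le> real n * l" using l by simp
    then show "0 \<le> real (n + k) * l - 1" using k1 by (simp add: distrib_right)
  qed (simp_all add: b'_def distrib_right)
  have J: "V (real n * 1 + real k) (real n * l + b') m z - real n * V 1 l m z + b' \<le> k * V 1 l m z + 1 + b'"
    if mz: "m \<le> N" "z \<in> Z" for m z and n :: nat
  proof -
    let ?n = "real (n + k)"
    have "V ?n (?n * l - 1) m z - (?n * l - (?n * l - 1)) \<le> V ?n (?n * l) m z"
      using pos[of n] mz by (intro V_safety_lipschitz) auto
    also have "\<dots> \<le> ?n * V 1 l m z" using V_scale_le[of 1 l ?n m z] l pos[of n] mz by simp
    finally have "V ?n (?n * l - 1) m z \<le> n * V 1 l m z + k * V 1 l m z + 1" by (simp add: distrib_right)
    then show ?thesis unfolding arg by simp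
  qed
  have "W 1 l k b' m z \<le> ennreal (k * V 1 l m z + 1 + b')" if "m \<le> N" "z \<in> Z" for m z
    unfolding W_def by (intro SUP_least ennreal_leI J that)
  then have fin: "W 1 l k b' m z < \<infinity>" if "m \<le> N" "z \<in> Z" for m z
    using that by (metis ennreal_less_top infinity_ennreal_def le_less_trans)
  have Jz: "V (real n * 1 + real k) (real n * l + b') N (x0, 0) - real n * V 1 l N (x0, 0) + b'
      \<le> k * V 1 l N (x0, 0) + \<alpha> + b'" for n :: nat
  proof -
    let ?n = "real (n + k)"
    have l': "0 \<le> l - 1 / ?n" using pos[of n] by (simp add: field_simps)
    have "V ?n (?n * l - 1) N (x0, 0) \<le> ?n * V 1 (l - 1 / ?n) N (x0, 0)"
      using V_scale_le[of 1 "l - 1 / ?n" ?n N "(x0, 0)"] l' pos[of n] z0 by (simp add: right_diff_distrib)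
    also have "\<dots> \<le> ?n * (V 1 l N (x0, 0) + \<alpha> / ?n)"
      using max[OF l'] pos[of n] by (intro mult_left_mono) (auto simp: left_diff_distrib)
    also have "\<dots> = ?n * V 1 l N (x0, 0) + \<alpha>"
      using pos(1)[of n] by (subst distrib_left) (simp del: of_nat_add)
    also have "\<dots> = n * V 1 l N (x0, 0) + k * V 1 l N (x0, 0) + \<alpha>"
      by (simp add: distrib_right)
    finally show ?thesis unfolding arg by simp
  qed
  have Wz: "W 1 l k b' N (x0, 0) \<le> ennreal (k * V 1 l N (x0, 0) + \<alpha> + b')"
    unfolding W_def by (intro SUP_least ennreal_leI Jz)
  have rhs: "0 \<le> k * V 1 l N (x0, 0) + \<alpha> + b'"
    using Jz[of 0] V_lower[of "real k" b' N "(x0, 0)"] b' z0 by simp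
  have "safety_Pz M x0 (mix_policy 0 s1 d1 s d) \<le> \<alpha>" if s1: "selector s1 d1" for s1 d1
  proof -
    let ?\<pi> = "mix_policy 0 s1 d1 s d"
    let ?G = "safety_Pz M x0 ?\<pi>" and ?v = "V 1 l N (x0, 0)"
    have G: "0 \<le> ?G" by (rule safety_Pz_nonneg[OF x0 mix_policy_in_zpolicies[OF s1 sel]]) auto
    have v: "- l \<le> ?v" using V_lower[of 1 l N "(x0, 0)"] l z0 by simp
    note * = lex_optimal_policy[OF x0 sd zero_le_one less_imp_le[OF l] of_nat_0_le_iff b' s1 sel _ fin[OF order_refl z0], of 0]
    have F1: "ennreal (?v + l + l * ?G) = cost_Pz M x0 ?\<pi> + ennreal l"
      using *(1) v G l by (simp add: ennreal_plus)
    then have "cost_Pz M x0 ?\<pi> \<noteq> top" by (metis ennreal_add_eq_top ennreal_neq_top)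
    then obtain F where F: "0 \<le> F" "cost_Pz M x0 ?\<pi> = ennreal F" by (cases "cost_Pz M x0 ?\<pi>") auto
    have "ennreal (?v + l + l * ?G) = ennreal (F + l)" using F1 F l by (simp add: ennreal_plus)
    then have F2: "?v + l * ?G = F" using v G l F by (subst (asm) ennreal_inj) auto
    have "ennreal (k * F + b') = ennreal k * cost_Pz M x0 ?\<pi> + ennreal b'"
      using F b' by (simp add: ennreal_plus ennreal_mult)
    also have "\<dots> \<le> W 1 l k b' N (x0, 0) + ennreal (b' * ?G)" using *(2) by simp
    also have "\<dots> \<le> ennreal (k * ?v + \<alpha> + b') + ennreal (b' * ?G)" by (intro add_right_mono Wz)
    also have "\<dots> = ennreal (k * ?v + \<alpha> + b' + b' * ?G)" using rhs b' G by (simp add: ennreal_plus)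
    finally have "k * F + b' \<le> k * ?v + \<alpha> + b' + b' * ?G"
      using rhs b' G by (subst (asm) ennreal_le_iff) (auto intro!: add_nonneg_nonneg)
    then show ?thesis unfolding F2[symmetric] by (simp add: b'_def algebra_simps)
  qed
  then show ?thesis using that[OF sel lex_optimal_conserving[OF sd zero_le_one less_imp_le[OF l] fin]] by blast
qed

text \<open>By the intermediate value theorem some mixture of the two extreme minimizers of the Lagrangian has
  safety exactly \<open>\<alpha>\<close>; complementary slackness then gives optimality. For the multiplier \<open>0\<close> the
  safer minimizer has cost \<open>0\<close>.\<close>

lemma optimal_policy_below_max_safety:
  assumes x0: "x0 \<in> X" and \<alpha>: "0 \<le> \<alpha>" "\<alpha> \<le> 1" "\<alpha> < - V 0 1 N (x0, 0)"
  shows "\<exists>\<theta> s1 d1 s2 d2. optimal_Pz M \<alpha> x0 (mix_policy \<theta> s1 d1 s2 d2)"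
proof -
  have z0: "(x0, 0) \<in> Z" using x0 by simp
  obtain l where l: "0 \<le> l"
    and max: "\<And>l'. 0 \<le> l' \<Longrightarrow> V 1 l' N (x0, 0) + l' * \<alpha> \<le> V 1 l N (x0, 0) + l * \<alpha>"
    using optimal_multiplier[OF x0 \<alpha>(3)] by blast
  obtain s1 d1 where s1: "selector s1 d1" "conserving 1 l s1 d1"
    and safe1: "\<And>s2 d2. selector s2 d2 \<Longrightarrow> \<alpha> \<le> safety_Pz M x0 (mix_policy 1 s1 d1 s2 d2)"
    using safe_conserving_selector[OF x0 less_imp_le[OF \<alpha>(3)] \<alpha>(2) l max] by blast
  have v: "- l \<le> V 1 l N (x0, 0)" using V_lower[of 1 l N "(x0, 0)"] l z0 by simp
  have cost: "ennreal (V 1 l N (x0, 0) + l + l * safety_Pz M x0 (mix_policy \<theta> s1 d1 s2 d2))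
      = cost_Pz M x0 (mix_policy \<theta> s1 d1 s2 d2) + ennreal l"
    if s2: "selector s2 d2" "conserving 1 l s2 d2" and \<theta>: "0 \<le> \<theta>" "\<theta> \<le> 1" for \<theta> s2 d2
  proof -
    have "0 \<le> safety_Pz M x0 (mix_policy \<theta> s1 d1 s2 d2)"
      by (rule safety_Pz_nonneg[OF x0 mix_policy_in_zpolicies[OF s1(1) s2(1) \<theta>]])
    then show ?thesis
      using mix_policy_cost(1)[OF x0 s1(1) s2(1) \<theta> zero_le_one l]
        mix_conserving_value[OF s1(2) s2(2) s1(1) s2(1) zero_le_one l \<theta> order_refl z0] v l
      by (simp add: ennreal_plus)
  qed
  have opt: "optimal_Pz M \<alpha> x0 \<pi>" if \<pi>: "\<pi> \<in> zpolicies M" "\<alpha> \<le> safety_Pz M x0 \<pi>"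
    and c: "cost_Pz M x0 \<pi> + ennreal l \<le> ennreal (V 1 l N (x0, 0) + l + l * \<alpha>)" for \<pi>
  proof (rule optimal_PzI[OF \<pi>])
    fix \<pi>' assume \<pi>': "\<pi>' \<in> zpolicies M" "\<alpha> \<le> safety_Pz M x0 \<pi>'"
    have "ennreal (V 1 l N (x0, 0) + l + l * \<alpha>) \<le> ennreal (V 1 l N (x0, 0) + l + l * safety_Pz M x0 \<pi>')"
      using \<pi>' l by (intro ennreal_leI add_left_mono mult_left_mono)
    also have "\<dots> = ennreal (V 1 l N (x0, 0) + l) + ennreal (l * safety_Pz M x0 \<pi>')"
      using v l safety_Pz_nonneg[OF x0 \<pi>'(1)] by (simp add: ennreal_plus)
    also have "\<dots> \<le> cost_Pz M x0 \<pi>' + ennreal l"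
      using lagrangian_bound[OF x0 \<pi>'(1) zero_le_one l] by simp
    finally have "cost_Pz M x0 \<pi> + ennreal l \<le> cost_Pz M x0 \<pi>' + ennreal l" using c by (rule order_trans[rotated])
    then show "cost_Pz M x0 \<pi> \<le> cost_Pz M x0 \<pi>'"
      by (simp add: ennreal_add_left_cancel_le add.commute[of _ "ennreal l"])
  qed
  show ?thesis
  proof (cases "l = 0")
    case True
    have "optimal_Pz M \<alpha> x0 (mix_policy 1 s1 d1 s1 d1)"
      using cost[OF s1, of 1] True
      by (intro opt mix_policy_in_zpolicies s1 safe1) auto
    then show ?thesis by blast
  next
    case False
    then have l0: "0 < l" using l by simp
    obtain s2 d2 where s2: "selector s2 d2" "conserving 1 l s2 d2"
      and safe2: "\<And>s1 d1. selector s1 d1 \<Longrightarrow> safety_Pz M x0 (mix_policy 0 s1 d1 s2 d2) \<le> \<alpha>"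
      using unsafe_conserving_selector[OF x0 \<alpha>(1) l0 max] by blast
    obtain \<theta> where \<theta>: "0 \<le> \<theta>" "\<theta> \<le> 1" "safety_Pz M x0 (mix_policy \<theta> s1 d1 s2 d2) = \<alpha>"
      using IVT'[OF safe2[OF s1(1)] safe1[OF s2(1)] zero_le_one safety_continuous_in_mixture[OF x0 s1(1) s2(1)]] by blast
    have "optimal_Pz M \<alpha> x0 (mix_policy \<theta> s1 d1 s2 d2)"
      using cost[OF s2 \<theta>(1,2)] \<theta>
      by (intro opt mix_policy_in_zpolicies s1 s2) auto
    then show ?thesis by blast
  qed
qed

lemma optimal_markov_policy_exists:
  assumes x0: "x0 \<in> X" and \<alpha>: "0 \<le> \<alpha>" "\<alpha> \<le> 1" and feas: "feasible_Pz M \<alpha> x0 \<noteq> {}"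
  shows "\<exists>\<pi> \<mu> \<nu>. markov_via M \<pi> \<mu> \<nu> \<and> optimal_Pz M \<alpha> x0 \<pi>"
proof -
  obtain \<pi> where "\<pi> \<in> zpolicies M" "\<alpha> \<le> safety_Pz M x0 \<pi>" using feas by (auto simp: feasible_Pz_def)
  then have "\<alpha> \<le> - V 0 1 N (x0, 0)" using max_safety[OF x0] by (meson order_trans)
  then consider "\<alpha> = - V 0 1 N (x0, 0)" | "\<alpha> < - V 0 1 N (x0, 0)" by linarith
  then obtain \<theta> s1 d1 s2 d2 where "optimal_Pz M \<alpha> x0 (mix_policy \<theta> s1 d1 s2 d2)"
    using optimal_policy_at_max_safety[OF x0] optimal_policy_below_max_safety[OF x0 \<alpha>] by cases blast+
  then show ?thesis using mix_policy_markov by blast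
qed

end

theorem mainTheorem1:
  fixes M :: "('x::polish_space, 'u::polish_space) mdp" and \<alpha> :: real and x0 :: 'x
  assumes "safety_mdp M"
    and "0 \<le> \<alpha>" and "\<alpha> \<le> 1" and "x0 \<in> states M"
    and "feasible_P M \<alpha> x0 \<noteq> {}"
    and "compact (inputs M)"
    and "closedin (top_of_set (states M)) (safe M)"
    and "\<And>k x u. k < horizon M \<Longrightarrow> x \<in> states M \<Longrightarrow> u \<in> inputs M \<Longrightarrow> 0 \<le> stage_cost M k (x, u)"
    and "\<And>x. x \<in> states M \<Longrightarrow> 0 \<le> term_cost M x"
    and "\<And>k. k < horizon M \<Longrightarrow> continuous_on (states M \<times> inputs M) (stage_cost M k)"
    and "continuous_on (states M) (term_cost M)"
    and "weakly_continuous_kernel M"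
  shows "(\<exists>\<pi> \<mu> \<nu>. markov_via M \<pi> \<mu> \<nu> \<and> optimal_Pz M \<alpha> x0 \<pi>) \<and>
    (\<forall>\<pi> \<mu> \<nu>. markov_via M \<pi> \<mu> \<nu> \<and> optimal_Pz M \<alpha> x0 \<pi> \<longrightarrow>
       optimal_P M \<alpha> x0
         (\<lambda>k h. \<mu> k (fst h k, \<Sum>j<k. stage_cost M j (fst h j, snd h j)),
          \<lambda>h. measure (\<nu> (fst h (horizon M),
                          \<Sum>j<horizon M. stage_cost M j (fst h j, snd h j))) {1}))"
proof -
  interpret safety_process M by unfold_locales fact
  interpret continuous_safety_process M
    by unfold_locales (use assms feasible_P_inputs_nonempty in auto)
  obtain d where "d \<in> feasible_P M \<alpha> x0" using assms(5) by blast
  then have "feasible_Pz M \<alpha> x0 \<noteq> {}"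
    using decision_to_zpolicy[OF assms(4)] by (cases d) blast
  then show ?thesis
    using optimal_markov_policy_exists[OF assms(4,2,3)] optimal_decision[OF assms(4)] by blast
qed

end
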